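(* Let $T$ be a tree. If one of the following holds, then $Sib(T)=1$ or $Sib(T)=\infty$. 1. Some leafy branch $H_r$ of $T$ has infinitely many siblings as a tree rooted at $r$, i.e. $Sib((H_r,r))=\infty$. 2. $T$ is of finite rank and for some embedding $f$ of $T$, $T\setminus f(T)$ contains a ray. 3. $T$ is of finite rank with only finitely many leafy branches.
   Context: A tree is a connected acyclic simple graph, of arbitrary cardinality. An embedding from a tree $T$ to a tree $S$ is an injective map $V(T)\to V(S)$ preserving adjacency; an embedding of $T$ is an embedding from $T$ to itself. Two trees are siblings (equimorphic), written $T\approx S$, if each embeds in the other. $Sib(T)$ is the number of isomorphism classes of trees that are siblings of $T$; $Sib(T)=\infty$ means that this number is infinite. A rooted tree $(T,r)$ is a tree with a distinguished vertex $r$; embeddings and isomorphisms of rooted trees are required to map root to root. Two rooted trees are siblings if each embeds in the other in this sense, and $Sib((T,r))$ is the number of isomorphism classes (as rooted trees) of rooted trees that are siblings of $(T,r)$. A ray is a one-way infinite path. $T\setminus f(T)$ is the subgraph of $T$ induced on the vertices not in the image of $f$. Define by transfinite recursion: $T^0=T$; $T^{\alpha+1}=T^\alpha\setminus\{v\in T^\alpha : \deg_{T^\alpha}(v)\le 1\}$ (delete these vertices); $T^\lambda=\bigcap_{\alpha<\lambda}T^\alpha$ for limit $\lambda$. The rank of $T$ is the least ordinal $\alpha$ with $T^{\alpha+1}=T^\alpha$, and $T^\infty:=T^\alpha$ for this $\alpha$ (possibly empty). $T$ is of finite rank if its rank is a finite ordinal. If $T^\infty\ne\emptyset$, a leafy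 branch of $T$ is a maximal non-trivial (more than one vertex) subtree of $T$ that is edge-disjoint from $T^\infty$; it is denoted $H_r$, where $r$ is the unique vertex common to it and $T^\infty$. Rooted leafy branches $H_r$ are defined only when $T^\infty\neq\emptyset$; if $T^\infty=\emptyset$, then $T$ itself is the maximal subtree edge-disjoint from $T^\infty$, and $T$ is regarded as having only finitely many leafy branches. *)

theory Defs
  imports "HOL-Library.Extended_Nat"
begin

definition ecard :: "'a set \<Rightarrow> enat" where
  "ecard A = (if finite A then enat (card A) else \<infinity>)"

record 'a graph =
  verts :: "'a set"
  edges :: "'a set set"

definition simple_graph :: "'a graph \<Rightarrow> bool" where
  "simple_graph G \<longleftrightarrow> (\<forall>e\<in>edges G. e \<subseteq> verts G \<and> card e = 2)"

definition adj :: "'a graph \<Rightarrow> 'a \<Rightarrow> 'a \<Rightarrow> bool" where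
  "adj G u v \<longleftrightarrow> {u, v} \<in> edges G"

definition degree :: "'a graph \<Rightarrow> 'a \<Rightarrow> enat" where
  "degree G v = ecard {u. adj G v u}"

definition connected_graph :: "'a graph \<Rightarrow> bool" where
  "connected_graph G \<longleftrightarrow> verts G \<noteq> {} \<and> (\<forall>u\<in>verts G. \<forall>v\<in>verts G. (adj G)\<^sup>*\<^sup>* u v)"

definition is_cycle :: "'a graph \<Rightarrow> 'a list \<Rightarrow> bool" where
  "is_cycle G vs \<longleftrightarrow>
     3 \<le> length vs \<and> distinct vs \<and> successively (adj G) vs \<and> adj G (last vs) (hd vs)"

definition tree :: "'a graph \<Rightarrow> bool" where
  "tree G \<longleftrightarrow> simple_graph G \<and> connected_graph G \<and> (\<nexists>vs. is_cycle G vs)"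

definition subgraph :: "'a graph \<Rightarrow> 'a graph \<Rightarrow> bool" where
  "subgraph H G \<longleftrightarrow> verts H \<subseteq> verts G \<and> edges H \<subseteq> edges G"

definition delete_verts :: "'a graph \<Rightarrow> 'a set \<Rightarrow> 'a graph" where
  "delete_verts G X =
     \<lparr>verts = verts G - X, edges = {e \<in> edges G. e \<subseteq> verts G - X}\<rparr>"

definition contains_ray :: "'a graph \<Rightarrow> bool" where
  "contains_ray G \<longleftrightarrow>
     (\<exists>x :: nat \<Rightarrow> 'a. inj x \<and> range x \<subseteq> verts G \<and> (\<forall>n. adj G (x n) (x (Suc n))))"

definition embedding :: "('a \<Rightarrow> 'b) \<Rightarrow> 'a graph \<Rightarrow> 'b graph \<Rightarrow> bool" where
  "embedding f G H \<longleftrightarrow>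
     inj_on f (verts G) \<and> f ` verts G \<subseteq> verts H \<and>
     (\<forall>u\<in>verts G. \<forall>v\<in>verts G. adj G u v \<longrightarrow> adj H (f u) (f v))"

definition isomorphism :: "('a \<Rightarrow> 'b) \<Rightarrow> 'a graph \<Rightarrow> 'b graph \<Rightarrow> bool" where
  "isomorphism f G H \<longleftrightarrow>
     bij_betw f (verts G) (verts H) \<and>
     (\<forall>u\<in>verts G. \<forall>v\<in>verts G. adj G u v \<longleftrightarrow> adj H (f u) (f v))"

definition siblings :: "'a graph \<Rightarrow> 'b graph \<Rightarrow> bool" where
  "siblings T S \<longleftrightarrow> (\<exists>f. embedding f T S) \<and> (\<exists>g. embedding g S T)"

text \<open>
  A sibling of \<open>T\<close> on any vertex type embeds in \<open>T\<close>, so it has an isomorphic copy whose vertices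
  are vertices of \<open>T\<close>.  Hence counting the siblings on the vertex type of \<open>T\<close> up to isomorphism
  misses no isomorphism class.  The same holds for rooted trees.
\<close>

definition sibling_trees :: "'a graph \<Rightarrow> 'a graph set" where
  "sibling_trees T = {S. tree S \<and> siblings T S}"

definition Sib :: "'a graph \<Rightarrow> enat" where
  "Sib T = ecard (sibling_trees T //
     {(S, S'). S \<in> sibling_trees T \<and> S' \<in> sibling_trees T \<and> (\<exists>f. isomorphism f S S')})"

type_synonym 'a rooted_graph = "'a graph \<times> 'a"

definition rooted_tree :: "'a rooted_graph \<Rightarrow> bool" where
  "rooted_tree = (\<lambda>(G, r). tree G \<and> r \<in> verts G)"

definition rooted_embedding :: "('a \<Rightarrow> 'b) \<Rightarrow> 'a rooted_graph \<Rightarrow> 'b rooted_graph \<Rightarrow> bool" where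
  "rooted_embedding f = (\<lambda>(G, r) (H, s). embedding f G H \<and> f r = s)"

definition rooted_isomorphism :: "('a \<Rightarrow> 'b) \<Rightarrow> 'a rooted_graph \<Rightarrow> 'b rooted_graph \<Rightarrow> bool" where
  "rooted_isomorphism f = (\<lambda>(G, r) (H, s). isomorphism f G H \<and> f r = s)"

definition rooted_siblings :: "'a rooted_graph \<Rightarrow> 'b rooted_graph \<Rightarrow> bool" where
  "rooted_siblings T S \<longleftrightarrow> (\<exists>f. rooted_embedding f T S) \<and> (\<exists>g. rooted_embedding g S T)"

definition sibling_rooted_trees :: "'a rooted_graph \<Rightarrow> 'a rooted_graph set" where
  "sibling_rooted_trees T = {S. rooted_tree S \<and> rooted_siblings T S}"

definition rooted_Sib :: "'a rooted_graph \<Rightarrow> enat" where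
  "rooted_Sib T = ecard (sibling_rooted_trees T //
     {(S, S'). S \<in> sibling_rooted_trees T \<and> S' \<in> sibling_rooted_trees T \<and>
        (\<exists>f. rooted_isomorphism f S S')})"

text \<open>
  HOL has no type of all ordinals.  The type \<open>'a ordinal\<close> is the initial ordinal of the infinite
  cardinal \<open>2 ^ (aleph_0 + |'a|)\<close>: it contains all finite ordinals, is closed under successors, and is
  long enough for the rank of every graph on \<open>'a\<close> to occur in it (\<open>rank_exists\<close> below), because each
  ordinal below the rank accounts for the deletion of at least one vertex.
\<close>

typedef 'a ordinal = "UNIV :: (nat + 'a) set set" ..

instantiation ordinal :: (type) wellorder
begin

definition less_eq_ordinal :: "'a ordinal \<Rightarrow> 'a ordinal \<Rightarrow> bool" where
  "\<alpha> \<le> \<beta> \<longleftrightarrow> (Rep_ordinal \<alpha>, Rep_ordinal \<beta>) \<in> card_of (UNIV :: (nat + 'a) set set)"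

definition less_ordinal :: "'a ordinal \<Rightarrow> 'a ordinal \<Rightarrow> bool" where
  "\<alpha> < \<beta> \<longleftrightarrow> \<alpha> \<le> \<beta> \<and> \<not> \<beta> \<le> (\<alpha> :: 'a ordinal)"

instance
proof -
  let ?r = "card_of (UNIV :: (nat + 'a) set set)"
  have wo: "well_order_on UNIV ?r"
    using card_of_well_order_on by auto
  then have lin: "linear_order_on UNIV ?r" and wf: "wf (?r - Id)"
    by (auto simp: well_order_on_def)
  then have part: "partial_order_on UNIV ?r" and tot: "total_on UNIV ?r"
    by (auto simp: linear_order_on_def)
  then have anti: "antisym ?r" and refl: "refl ?r" and trans: "trans ?r"
    by (auto simp: partial_order_on_def preorder_on_def)
  have lin': "(x, y) \<in> ?r \<or> (y, x) \<in> ?r" for x y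
    using tot refl by (cases "x = y") (auto simp: total_on_def refl_on_def)
  show "OFCLASS('a ordinal, wellorder_class)"
  proof
    fix x y z :: "'a ordinal"
    show "x < y \<longleftrightarrow> x \<le> y \<and> \<not> y \<le> x" by (rule less_ordinal_def)
    show "x \<le> x" using refl by (auto simp: less_eq_ordinal_def refl_on_def)
    show "x \<le> z" if "x \<le> y" "y \<le> z"
      using that transD[OF trans] unfolding less_eq_ordinal_def by blast
    show "x = y" if "x \<le> y" "y \<le> x"
      using that antisymD[OF anti] unfolding less_eq_ordinal_def Rep_ordinal_inject[symmetric] by blast
    show "x \<le> y \<or> y \<le> x" using lin' by (auto simp: less_eq_ordinal_def)
  next
    fix P :: "'a ordinal \<Rightarrow> bool" and a
    assume step: "\<And>x. (\<And>y. y < x \<Longrightarrow> P y) \<Longrightarrow> P x"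
    have "\<forall>a. Rep_ordinal a = x \<longrightarrow> P a" for x
      using wf
    proof (induction x rule: wf_induct_rule)
      case (less x)
      show ?case
      proof (intro allI impI)
        fix a :: "'a ordinal" assume "Rep_ordinal a = x"
        show "P a"
        proof (rule step)
          fix y assume "y < a"
          then have "(Rep_ordinal y, x) \<in> ?r - Id"
            using \<open>Rep_ordinal a = x\<close> by (auto simp: less_ordinal_def less_eq_ordinal_def)
          then show "P y" using less by blast
        qed
      qed
    qed
    then show "P a" by blast
  qed
qed

end

lemma ordinal_no_max: "\<exists>\<beta>. \<alpha> < (\<beta> :: 'a ordinal)"
proof -
  let ?r = "card_of (UNIV :: (nat + 'a) set set)"
  have inf: "infinite (Field ?r)"
    unfolding Field_card_of Finite_Set.finite_set by simp
  obtain b where "b \<noteq> Rep_ordinal \<alpha>" "(Rep_ordinal \<alpha>, b) \<in> ?r"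
    using infinite_Card_order_limit[OF card_of_Card_order inf, of "Rep_ordinal \<alpha>"]
    unfolding Field_card_of by auto
  then have "\<alpha> \<le> Abs_ordinal b" "\<alpha> \<noteq> Abs_ordinal b"
    by (auto simp: less_eq_ordinal_def Abs_ordinal_inverse)
  then show ?thesis by (metis order_le_less)
qed

definition is_succ :: "'o::wellorder \<Rightarrow> 'o \<Rightarrow> bool" where
  "is_succ \<alpha> \<beta> \<longleftrightarrow> \<alpha> < \<beta> \<and> (\<forall>\<gamma>. \<alpha> < \<gamma> \<longrightarrow> \<beta> \<le> \<gamma>)"

definition osucc :: "'o::wellorder \<Rightarrow> 'o" where
  "osucc \<alpha> = (LEAST \<beta>. \<alpha> < \<beta>)"

lemma is_succ_osucc: "is_succ \<alpha> (osucc \<alpha> :: 'a ordinal)"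
  unfolding is_succ_def osucc_def
  using LeastI_ex[OF ordinal_no_max[of \<alpha>]] by (auto intro: Least_le)

lemma is_succ_unique: "is_succ \<alpha> \<beta> \<Longrightarrow> is_succ \<alpha>' \<beta> \<Longrightarrow> \<alpha> = \<alpha>'"
  unfolding is_succ_def by (meson leD linorder_neqE)

lemma the_predecessor_less: "\<exists>\<beta>. is_succ \<beta> \<alpha> \<Longrightarrow> (THE \<beta>. is_succ \<beta> \<alpha>) < \<alpha>"
proof -
  assume "\<exists>\<beta>. is_succ \<beta> \<alpha>"
  then obtain \<beta> where b: "is_succ \<beta> \<alpha>" ..
  then have "(THE \<beta>. is_succ \<beta> \<alpha>) = \<beta>" by (rule the_equality) (rule is_succ_unique[OF _ b])
  then show ?thesis using b by (simp add: is_succ_def)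
qed

definition prune :: "'a graph \<Rightarrow> 'a graph" where
  "prune G = delete_verts G {v \<in> verts G. degree G v \<le> 1}"

function stage :: "'a graph \<Rightarrow> 'o::wellorder \<Rightarrow> 'a graph" where
  "stage T \<alpha> =
     (if \<forall>\<beta>. \<alpha> \<le> \<beta> then T
      else if \<exists>\<beta>. is_succ \<beta> \<alpha> then prune (stage T (THE \<beta>. is_succ \<beta> \<alpha>))
      else \<lparr>verts = (\<Inter>\<beta>\<in>{..<\<alpha>}. verts (stage T \<beta>)),
            edges = (\<Inter>\<beta>\<in>{..<\<alpha>}. edges (stage T \<beta>))\<rparr>)"
  by pat_completeness auto
termination
  by (relation "inv_image {(x, y). x < y} snd")
    (simp_all add: wf_inv_image wf the_predecessor_less)

declare stage.simps [simp del]

definition rank :: "'a graph \<Rightarrow> 'a ordinal" where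
  "rank T = (LEAST \<alpha>. stage T (osucc \<alpha>) = stage T \<alpha>)"

definition finite_rank :: "'a graph \<Rightarrow> bool" where
  "finite_rank T \<longleftrightarrow> finite {..<rank T}"

text \<open>\<open>core T\<close> is the graph usually written \<open>T\<^sup>\<infinity>\<close>; it may be empty.\<close>

definition core :: "'a graph \<Rightarrow> 'a graph" where
  "core T = stage T (rank T)"

definition core_disjoint_subtree :: "'a graph \<Rightarrow> 'a graph \<Rightarrow> bool" where
  "core_disjoint_subtree T H \<longleftrightarrow>
     subgraph H T \<and> tree H \<and> (\<exists>u\<in>verts H. \<exists>v\<in>verts H. u \<noteq> v) \<and>
     edges H \<inter> edges (core T) = {}"

text \<open>
  Trees with empty core have no leafy branches in the sense below; in particular they have finitely
  many, which is the convention used for them.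
\<close>

definition leafy_branch :: "'a graph \<Rightarrow> 'a graph \<Rightarrow> bool" where
  "leafy_branch T H \<longleftrightarrow>
     verts (core T) \<noteq> {} \<and> core_disjoint_subtree T H \<and>
     (\<forall>H'. core_disjoint_subtree T H' \<and> subgraph H H' \<longrightarrow> H' = H)"

text \<open>\<open>rooted_leafy_branch T (H, r)\<close>: in the usual notation, \<open>H\<close> is the leafy branch \<open>H\<^sub>r\<close>.\<close>

definition rooted_leafy_branch :: "'a graph \<Rightarrow> 'a rooted_graph \<Rightarrow> bool" where
  "rooted_leafy_branch T =
     (\<lambda>(H, r). leafy_branch T H \<and> verts H \<inter> verts (core T) = {r})"

lemma stage_zero: "(\<And>\<beta>. \<alpha> \<le> \<beta>) \<Longrightarrow> stage T \<alpha> = T"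
  by (subst stage.simps) simp

lemma stage_succ: "is_succ \<alpha> \<beta> \<Longrightarrow> stage T \<beta> = prune (stage T \<alpha>)"
proof -
  assume s: "is_succ \<alpha> \<beta>"
  then have "(THE \<gamma>. is_succ \<gamma> \<beta>) = \<alpha>" by (auto dest: is_succ_unique)
  moreover have "\<not> (\<forall>\<gamma>. \<beta> \<le> \<gamma>)" using s by (auto simp: is_succ_def not_le)
  moreover have "\<exists>\<gamma>. is_succ \<gamma> \<beta>" using s ..
  ultimately show ?thesis by (subst stage.simps) (simp only: if_True if_False)
qed

lemma stage_limit:
  assumes "\<beta> < \<alpha>" and "\<And>\<gamma>. \<not> is_succ \<gamma> \<alpha>"
  shows "stage T \<alpha> = \<lparr>verts = (\<Inter>\<beta>\<in>{..<\<alpha>}. verts (stage T \<beta>)),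
                       edges = (\<Inter>\<beta>\<in>{..<\<alpha>}. edges (stage T \<beta>))\<rparr>"
proof -
  have "\<not> (\<forall>\<gamma>. \<alpha> \<le> \<gamma>)" using assms(1) by (auto simp: not_le)
  moreover have "\<not> (\<exists>\<gamma>. is_succ \<gamma> \<alpha>)" using assms(2) by blast
  ultimately show ?thesis by (subst stage.simps) (simp only: if_False)
qed

lemma is_succ_le: "is_succ \<gamma> \<beta> \<Longrightarrow> \<alpha> < \<beta> \<Longrightarrow> \<alpha> \<le> \<gamma>"
  unfolding is_succ_def by (meson leD leI)

lemma verts_prune: "verts (prune G) = verts G - {v \<in> verts G. degree G v \<le> 1}"
  by (simp add: prune_def delete_verts_def)

lemma verts_stage_antimono: "\<alpha> \<le> \<beta> \<Longrightarrow> verts (stage T \<beta>) \<subseteq> verts (stage T \<alpha>)"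
proof (induction \<beta> rule: less_induct)
  case (less \<beta>)
  show ?case
  proof (cases "\<alpha> = \<beta>")
    case False
    with less.prems have lt: "\<alpha> < \<beta>" by simp
    show ?thesis
    proof (cases "\<exists>\<gamma>. is_succ \<gamma> \<beta>")
      case True
      then obtain \<gamma> where g: "is_succ \<gamma> \<beta>" ..
      have "verts (stage T \<gamma>) \<subseteq> verts (stage T \<alpha>)"
        using less.IH[of \<gamma>] is_succ_le[OF g lt] g by (simp add: is_succ_def)
      then show ?thesis by (auto simp: stage_succ[OF g] verts_prune)
    next
      case False
      then show ?thesis using lt by (subst stage_limit[OF lt]) auto
    qed
  qed simp
qed

lemma simple_stage: "simple_graph T \<Longrightarrow> simple_graph (stage T \<alpha>)"
proof (induction \<alpha> rule: less_induct)
  case (less \<alpha>)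
  consider "\<And>\<beta>. \<alpha> \<le> \<beta>" | \<gamma> where "is_succ \<gamma> \<alpha>" | \<beta> where "\<beta> < \<alpha>" "\<And>\<gamma>. \<not> is_succ \<gamma> \<alpha>"
    by (meson leI)
  then show ?case
  proof cases
    case 1
    then show ?thesis using less.prems by (simp add: stage_zero)
  next
    case 2
    then have "simple_graph (stage T \<gamma>)" using less by (simp add: is_succ_def)
    then show ?thesis
      by (auto simp: stage_succ[OF 2] prune_def delete_verts_def simple_graph_def)
  next
    case 3
    have "e \<subseteq> verts (stage T \<alpha>) \<and> card e = 2" if "e \<in> edges (stage T \<alpha>)" for e
    proof -
      have "e \<subseteq> verts (stage T \<gamma>) \<and> card e = 2" if "\<gamma> < \<alpha>" for \<gamma>
        using less.IH[OF that less.prems] that \<open>e \<in> edges (stage T \<alpha>)\<close>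
        by (auto simp: stage_limit[OF 3] simple_graph_def)
      then show ?thesis using 3(1) by (auto simp: stage_limit[OF 3])
    qed
    then show ?thesis by (simp add: simple_graph_def)
  qed
qed

lemma rank_exists:
  fixes T :: "'a graph"
  assumes "simple_graph T"
  shows "\<exists>\<alpha> :: 'a ordinal. stage T (osucc \<alpha>) = stage T \<alpha>"
proof (rule ccontr)
  assume "\<not> ?thesis"
  then have ne: "stage T (osucc \<alpha>) \<noteq> stage T \<alpha>" for \<alpha> :: "'a ordinal" by blast
  have "\<exists>v. v \<in> verts (stage T \<alpha>) - verts (stage T (osucc \<alpha>))" for \<alpha> :: "'a ordinal"
  proof (rule ccontr)
    assume *: "\<not> ?thesis"
    have eq: "stage T (osucc \<alpha>) = prune (stage T \<alpha>)" by (rule stage_succ[OF is_succ_osucc])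
    with * have "{v \<in> verts (stage T \<alpha>). degree (stage T \<alpha>) v \<le> 1} = {}"
      by (auto simp: verts_prune)
    then have "prune (stage T \<alpha>) = stage T \<alpha>"
      using simple_stage[OF assms, of \<alpha>]
      unfolding prune_def delete_verts_def simple_graph_def by (cases "stage T \<alpha>") auto
    then show False using ne eq by simp
  qed
  then obtain v where
    v: "v \<alpha> \<in> verts (stage T \<alpha>) - verts (stage T (osucc \<alpha>))" for \<alpha> :: "'a ordinal"
    by metis
  have "v \<alpha> \<noteq> v \<beta>" if "\<alpha> < \<beta>" for \<alpha> \<beta>
  proof -
    have "osucc \<alpha> \<le> \<beta>" using is_succ_osucc[of \<alpha>] that by (auto simp: is_succ_def)
    then have "verts (stage T \<beta>) \<subseteq> verts (stage T (osucc \<alpha>))" by (rule verts_stage_antimono)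
    then show ?thesis using v[of \<alpha>] v[of \<beta>] by auto
  qed
  then have "inj v" by (intro linorder_injI)
  moreover have "inj (\<lambda>X. Abs_ordinal (Inr ` X) :: 'a ordinal)"
    by (auto simp: inj_def Abs_ordinal_inject inj_image_eq_iff)
  ultimately have "inj (\<lambda>X :: 'a set. v (Abs_ordinal (Inr ` X)))"
    by (auto simp: inj_def)
  then show False using Cantors_theorem[of "UNIV :: 'a set"]
    using inj_imp_surj_inv by auto
qed

end

theory Submission
  imports Defs "HOL-Library.Transitive_Closure_Table"
begin

text \<open>
  An embedding of a tree into a tree reflects adjacency, so every sibling of \<open>T\<close> is isomorphic to the
  subtree induced on a connected vertex set \<open>X\<close> of \<open>T\<close> into which \<open>T\<close> embeds.  The whole argument
  takes place inside \<open>T\<close>, with connected sets in place of trees.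

  Let \<open>C\<close> be a connected set, the centre.  Every vertex has a nearest point in \<open>C\<close>, so \<open>T\<close> falls
  apart into rooted blocks, one at each point of \<open>C\<close> (\<open>dec_proj\<close>).  Embeddings of the centre
  and of the blocks can be glued, and an embedding that respects the centre splits into embeddings of
  blocks (\<open>glue\<close>, \<open>split_dec\<close>).  If a block has infinitely many rooted siblings, replace \<^emph>\<open>all\<close> blocks
  equimorphic to it by the same one of these siblings: as every replaced block then shows which
  sibling was used, the results are pairwise non-isomorphic (\<open>replace_blocks\<close>).  The core is a
  connected set that every isomorphism respects, being the greatest set inducing minimum degree at
  least two, and the leafy branches are its non-trivial blocks.  This settles the first condition.

  Rayless rooted trees have one or infinitely many rooted siblings (\<open>rooted_one_or_many\<close>).  Here the
  centre is the root with its neighbours.  If equimorphic rooted trees are not isomorphic, some type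
  of subtree at a neighbour of the root is more frequent in one than in the other.  If that type has a
  single sibling, going back and forth between the two trees yields infinite increasing chains of
  subtrees in which additional copies of this type can be inserted, or all copies be absorbed
  (\<open>many_siblings_if_fewer\<close>); otherwise its copies can be replaced, as above.

  Let \<open>T\<close> have finite rank.  If an embedding \<open>f\<close> of \<open>T\<close> maps the core properly into itself, there is
  a ray that starts in the image of the core and leaves the image of \<open>T\<close>.  Adding longer and longer
  initial segments of it to the image of \<open>T\<close> gives siblings of unbounded finite rank
  (\<open>Sib_infinite_if_core_shrinks\<close>).  This applies under the second condition, because every ray is
  eventually in the core.  Otherwise every embedding maps the core onto itself.  If only finitely many
  blocks are non-trivial, a power of the embedding fixes their roots, so each block of a sibling is
  equimorphic to the corresponding block of \<open>T\<close>; as blocks are rayless, either all blocks have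
  a single sibling and then so has \<open>T\<close>, or one has infinitely many
  (\<open>one_or_infinite_if_invariant_centre\<close>).  When the core is empty, the last non-empty set in the
  sequence of deletions, a vertex or an edge, serves as centre instead.
\<close>

section \<open>Paths, injections, quotients and isomorphisms\<close>

lemma rtranclp_distinct_path:
  assumes "R\<^sup>*\<^sup>* x y"
  obtains xs where "rtrancl_path R x xs y" "distinct (x # xs)"
  using assms rtrancl_path_distinct unfolding rtranclp_eq_rtrancl_path by metis

lemma rtrancl_path_imp_rtranclp_on:
  "rtrancl_path R x xs y \<Longrightarrow> (\<lambda>u v. R u v \<and> u \<in> set (x # xs) \<and> v \<in> set (x # xs))\<^sup>*\<^sup>* x y"
proof (induction rule: rtrancl_path.induct)
  case (step x y ys z)
  let ?R = "\<lambda>u v. R u v \<and> u \<in> set (x # y # ys) \<and> v \<in> set (x # y # ys)"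
  have "?R\<^sup>*\<^sup>* y z"
    by (rule mono_rtranclp[THEN mp, rotated, OF step.IH]) auto
  moreover have "?R x y" using step.hyps by simp
  ultimately show ?case by (rule converse_rtranclp_into_rtranclp[rotated])
qed simp

lemma rtrancl_path_successively: "rtrancl_path R x xs y \<Longrightarrow> successively R (x # xs) \<and> last (x # xs) = y"
  by (induction rule: rtrancl_path.induct) auto

lemma rtranclp_map:
  assumes "\<And>a b. R a b \<Longrightarrow> S (f a) (f b)" "R\<^sup>*\<^sup>* a b"
  shows "S\<^sup>*\<^sup>* (f a) (f b)"
  using assms(2) by (induction rule: rtranclp_induct) (auto intro: rtranclp.rtrancl_into_rtrancl assms(1))

text \<open>
  Hilbert's hotel, in many hotels at once.  The forward orbits \<open>k e, k (k e), ...\<close> of the points of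
  \<open>E\<close> never meet \<open>Z\<close>, hence are disjoint.  Moving each of them one place on frees all the \<open>k e\<close>,
  which make room for \<open>Z\<close>.
\<close>

lemma absorbing_injection:
  assumes k: "inj_on k J" "k ` J \<subseteq> J" and E: "E \<subseteq> Z" "Z \<subseteq> J"
    and exit: "\<And>e m. e \<in> E \<Longrightarrow> (k ^^ Suc m) e \<notin> Z"
    and \<tau>: "inj_on \<tau> Z" "\<tau> ` Z \<subseteq> E"
  obtains \<theta> where "inj_on \<theta> J" "\<theta> ` J \<subseteq> J - Z" "\<And>j. j \<in> Z \<Longrightarrow> \<theta> j = k (\<tau> j)"
    "\<And>j. j \<in> J - Z \<Longrightarrow> \<theta> j = j \<or> \<theta> j = k j"
proof -
  define Orb where "Orb = {(k ^^ Suc m) e | m e. e \<in> E}"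
  have kJ: "(k ^^ m) e \<in> J" if "e \<in> J" for m e
    using that k(2) by (induction m) auto
  have OrbJ: "Orb \<subseteq> J - Z"
  proof
    fix x assume "x \<in> Orb"
    then obtain m e where x: "x = (k ^^ Suc m) e" "e \<in> E" unfolding Orb_def by blast
    moreover have "e \<in> J" using x(2) E by blast
    ultimately show "x \<in> J - Z" using kJ[of e "Suc m"] exit[of e m] by (simp del: funpow.simps)
  qed
  have kE: "k e \<in> Orb" if "e \<in> E" for e
    unfolding Orb_def using that by (auto intro!: exI[of _ 0] exI[of _ e])
  have kO: "k x \<in> Orb" if x: "x \<in> Orb" for x
  proof -
    obtain m e where "x = (k ^^ Suc m) e" "e \<in> E" using x unfolding Orb_def by blast
    then have "k x = (k ^^ Suc (Suc m)) e" by simp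
    then show ?thesis using \<open>e \<in> E\<close> unfolding Orb_def by blast
  qed
  define \<theta> where "\<theta> j = (if j \<in> Z then k (\<tau> j) else if j \<in> Orb then k j else j)" for j
  have \<tau>E: "\<tau> j \<in> E" "\<tau> j \<in> Z" "\<tau> j \<in> J" if "j \<in> Z" for j using that \<tau> E by auto
  have "inj_on \<theta> J"
  proof (rule inj_onI)
    fix x y assume xy: "x \<in> J" "y \<in> J" "\<theta> x = \<theta> y"
    have kinj: "a = b" if "k a = k b" "a \<in> J" "b \<in> J" for a b
      using that k(1) by (auto dest: inj_onD)
    show "x = y"
    proof (cases "x \<in> Z"; cases "y \<in> Z")
      assume "x \<in> Z" "y \<in> Z"
      then have "\<tau> x = \<tau> y" using xy kinj \<tau>E by (simp add: \<theta>_def)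
      then show ?thesis using \<tau>(1) \<open>x \<in> Z\<close> \<open>y \<in> Z\<close> by (auto dest: inj_onD)
    next
      assume "x \<in> Z" "y \<notin> Z"
      show ?thesis
      proof (cases "y \<in> Orb")
        case True
        then have "\<tau> x = y" using xy kinj \<tau>E \<open>x \<in> Z\<close> \<open>y \<notin> Z\<close> by (simp add: \<theta>_def)
        then show ?thesis using \<tau>E \<open>x \<in> Z\<close> \<open>y \<notin> Z\<close> by auto
      next
        case False
        then have "y = k (\<tau> x)" using xy \<open>x \<in> Z\<close> \<open>y \<notin> Z\<close> by (simp add: \<theta>_def)
        then show ?thesis using False kE \<tau>E \<open>x \<in> Z\<close> by auto
      qed
    next
      assume "x \<notin> Z" "y \<in> Z"
      show ?thesis
      proof (cases "x \<in> Orb")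
        case True
        then have "\<tau> y = x" using xy kinj \<tau>E \<open>y \<in> Z\<close> \<open>x \<notin> Z\<close> by (simp add: \<theta>_def)
        then show ?thesis using \<tau>E \<open>y \<in> Z\<close> \<open>x \<notin> Z\<close> by auto
      next
        case False
        then have "x = k (\<tau> y)" using xy \<open>y \<in> Z\<close> \<open>x \<notin> Z\<close> by (simp add: \<theta>_def)
        then show ?thesis using False kE \<tau>E \<open>y \<in> Z\<close> by auto
      qed
    next
      assume "x \<notin> Z" "y \<notin> Z"
      then show ?thesis
        using xy kinj kO by (cases "x \<in> Orb"; cases "y \<in> Orb") (auto simp: \<theta>_def)
    qed
  qed
  moreover have "\<theta> j \<in> J - Z" if "j \<in> J" for j
    using that kE[OF \<tau>E(1)] kO OrbJ by (auto simp: \<theta>_def)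
  then have "\<theta> ` J \<subseteq> J - Z" by (rule image_subsetI)
  moreover have "\<theta> j = k (\<tau> j)" if "j \<in> Z" for j using that by (simp add: \<theta>_def)
  moreover have "\<theta> j = j \<or> \<theta> j = k j" if "j \<in> J - Z" for j using that by (simp add: \<theta>_def)
  ultimately show thesis by (rule that)
qed

text \<open>
  Moving the single orbit of \<open>e\<close> by \<open>n\<close> places frees its first \<open>n\<close> places.
\<close>

lemma freeing_injection:
  assumes k: "inj_on k J" "k ` J \<subseteq> J" and e: "e \<in> J" and noret: "\<And>m. (k ^^ Suc m) e \<noteq> e"
  obtains \<theta> where "inj_on \<theta> J" "\<theta> ` J \<subseteq> J - (\<lambda>m. (k ^^ Suc m) e) ` {..<n}"
    "\<And>j. j \<in> J \<Longrightarrow> \<theta> j = j \<or> \<theta> j = (k ^^ n) j"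
    "inj (\<lambda>m. (k ^^ Suc m) e)"
proof -
  define a where "a = (\<lambda>m. (k ^^ Suc m) e)"
  have kJ: "(k ^^ m) x \<in> J" if "x \<in> J" for m x
    using that k(2) by (induction m) auto
  have kinj: "inj_on (k ^^ m) J" for m
  proof (induction m)
    case (Suc m)
    have "inj_on (k \<circ> (k ^^ m)) J"
      using Suc kJ k(1) by (intro comp_inj_on) (auto intro: inj_on_subset)
    then show ?case by (simp add: comp_def)
  qed simp
  have aJ: "a m \<in> J" for m using kJ[OF e, of "Suc m"] by (simp add: a_def)
  have ne: "a m \<noteq> a (Suc (m + l))" for m l
  proof
    assume "a m = a (Suc (m + l))"
    then have "(k ^^ Suc m) e = (k ^^ Suc m) ((k ^^ Suc l) e)"
      unfolding a_def by (simp only: funpow_add[symmetric, THEN fun_cong, unfolded comp_def]) (simp add: add.commute)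
    then show False using kinj[of "Suc m"] e kJ noret[of l] by (metis inj_onD)
  qed
  have inja: "inj a"
    by (rule linorder_injI) (use ne in \<open>metis less_imp_Suc_add\<close>)
  have ka: "(k ^^ n) (a m) = a (n + m)" for m
    by (simp add: a_def funpow_add funpow_swap1)
  define \<theta> where "\<theta> j = (if j \<in> range a then (k ^^ n) j else j)" for j
  have "inj_on \<theta> J"
  proof (rule inj_onI)
    fix x y assume "x \<in> J" "y \<in> J" "\<theta> x = \<theta> y"
    then show "x = y"
      using kinj[of n] ka by (auto simp: \<theta>_def split: if_splits dest: inj_onD)
  qed
  moreover have "\<theta> j \<in> J - a ` {..<n}" if "j \<in> J" for j
  proof (cases "j \<in> range a")
    case True
    then obtain m where "j = a m" by auto
    then have "\<theta> j = a (n + m)" using ka by (simp add: \<theta>_def)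
    moreover have "a (n + m) \<notin> a ` {..<n}" using inja by (auto dest: injD)
    ultimately show ?thesis using aJ by simp
  qed (use that in \<open>auto simp: \<theta>_def\<close>)
  then have "\<theta> ` J \<subseteq> J - a ` {..<n}" by (rule image_subsetI)
  moreover have "\<theta> j = j \<or> \<theta> j = (k ^^ n) j" for j by (simp add: \<theta>_def)
  ultimately show thesis using inja unfolding a_def by (intro that[of \<theta>])
qed

lemma bij_betw_fibres:
  assumes "\<And>k. \<exists>h. bij_betw h {i \<in> I. f i = k} {j \<in> J. g j = k}"
  obtains \<sigma> where "bij_betw \<sigma> I J" "\<And>i. i \<in> I \<Longrightarrow> g (\<sigma> i) = f i"
proof -
  obtain h where h: "\<And>k. bij_betw (h k) {i \<in> I. f i = k} {j \<in> J. g j = k}"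
    using assms by metis
  have im: "h (f i) i \<in> J \<and> g (h (f i) i) = f i" if "i \<in> I" for i
    using h[of "f i"] that by (auto dest: bij_betwE)
  have "bij_betw (\<lambda>i. h (f i) i) I J"
  proof (intro bij_betw_imageI inj_onI)
    fix x y assume xy: "x \<in> I" "y \<in> I" "h (f x) x = h (f y) y"
    then have "f x = f y" using im by metis
    then show "x = y" using xy h[of "f x"] by (auto simp: bij_betw_def dest: inj_onD)
  next
    show "(\<lambda>i. h (f i) i) ` I = J"
    proof
      show "J \<subseteq> (\<lambda>i. h (f i) i) ` I"
      proof
        fix j assume "j \<in> J"
        then have "j \<in> h (g j) ` {i \<in> I. f i = g j}" using h[of "g j"] by (auto simp: bij_betw_def)
        then obtain i where "i \<in> I" "f i = g j" "j = h (g j) i" by auto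
        then show "j \<in> (\<lambda>i. h (f i) i) ` I" by (intro image_eqI[of _ _ i]) simp_all
      qed
    qed (use im in auto)
  qed
  then show thesis using im by (intro that) auto
qed

lemma card_of_minus_small:
  fixes Z E :: "'a set"
  assumes "infinite Z" "E \<subseteq> Z" and small: "\<And>\<tau> :: 'a \<Rightarrow> 'a. inj_on \<tau> Z \<Longrightarrow> \<not> \<tau> ` Z \<subseteq> Z - E"
  shows "\<exists>\<tau>. inj_on \<tau> Z \<and> \<tau> ` Z \<subseteq> E"
proof (rule ccontr)
  have less: "(card_of A, card_of Z) \<in> ordLess" if "\<not> (\<exists>\<tau>. inj_on \<tau> Z \<and> \<tau> ` Z \<subseteq> A)" for A :: "'a set"
    using that card_of_ordLeq[of Z A]
      not_ordLeq_iff_ordLess[OF card_of_Well_order card_of_Well_order, of Z A]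
    by simp
  assume "\<not> ?thesis"
  then have "(card_of E, card_of Z) \<in> ordLess" by (rule less)
  moreover have "(card_of (Z - E), card_of Z) \<in> ordLess" by (rule less) (use small in blast)
  ultimately have "(card_of (E \<union> (Z - E)), card_of Z) \<in> ordLess"
    by (rule card_of_Un_ordLess_infinite[OF assms(1)])
  moreover have "E \<union> (Z - E) = Z" using assms(2) by auto
  ultimately show False by (simp add: ordLess_irreflexive)
qed

lemma infinite_quotient:
  assumes R: "equiv A R" and F: "\<And>n :: nat. F n \<in> A" "\<And>n m. (F n, F m) \<in> R \<Longrightarrow> n = m"
  shows "infinite (A // R)"
proof -
  have "inj (\<lambda>n. R `` {F n})"
    using eq_equiv_class[OF _ R F(1)] F(2) by (intro injI) blast
  then have "infinite (range (\<lambda>n. R `` {F n}))" by (rule range_inj_infinite)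
  moreover have "range (\<lambda>n. R `` {F n}) \<subseteq> A // R" using F(1) by (auto intro: quotientI)
  ultimately show ?thesis using finite_subset by blast
qed

lemma infinite_quotient_representatives:
  assumes R: "equiv A R" and inf: "infinite (A // R)"
  shows "\<exists>F :: nat \<Rightarrow> 'a. (\<forall>n. F n \<in> A) \<and> (\<forall>n m. (F n, F m) \<in> R \<longrightarrow> n = m)"
proof -
  obtain c :: "nat \<Rightarrow> 'a set" where c: "inj c" "range c \<subseteq> A // R"
    using infinite_countable_subset[OF inf] by blast
  have "\<exists>x. x \<in> A \<and> c n = R `` {x}" for n
    using c(2) by (auto simp: quotient_def image_subset_iff)
  then obtain F where F: "\<And>n. F n \<in> A" "\<And>n. c n = R `` {F n}" by metis
  have "n = m" if "(F n, F m) \<in> R" for n m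
    using equiv_class_eq[OF R that] F(2) c(1) by (metis injD)
  then show ?thesis using F(1) by (intro exI[of _ F]) blast
qed

lemma card_quotient_one:
  assumes R: "equiv A R" and "x \<in> A" "\<And>y. y \<in> A \<Longrightarrow> (x, y) \<in> R"
  shows "ecard (A // R) = 1"
proof -
  have "A // R = {R `` {x}}"
  proof (intro equalityI subsetI)
    fix c assume "c \<in> A // R"
    then obtain y where "y \<in> A" "c = R `` {y}" by (rule quotientE)
    then show "c \<in> {R `` {x}}" using equiv_class_eq[OF R assms(3)] by simp
  qed (use assms(2) in \<open>auto intro: quotientI\<close>)
  then show ?thesis by (simp add: ecard_def one_enat_def)
qed

lemma isomorphism_id: "isomorphism (\<lambda>x. x) S S"
  by (simp add: isomorphism_def bij_betw_def)

lemma isomorphism_comp: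
  "isomorphism f S S' \<Longrightarrow> isomorphism g S' S'' \<Longrightarrow> isomorphism (\<lambda>x. g (f x)) S S''"
  using bij_betw_trans[of f "verts S" "verts S'" g "verts S''"]
  by (auto simp: isomorphism_def comp_def dest: bij_betwE)

lemma isomorphism_inv:
  assumes "isomorphism f S S'" shows "isomorphism (inv_into (verts S) f) S' S"
proof -
  let ?g = "inv_into (verts S) f"
  have b: "bij_betw f (verts S) (verts S')" using assms by (simp add: isomorphism_def)
  have g: "?g u \<in> verts S" "f (?g u) = u" if "u \<in> verts S'" for u
    using b that by (auto simp: bij_betw_def inv_into_into f_inv_into_f)
  have "adj S' u v \<longleftrightarrow> adj S (?g u) (?g v)" if "u \<in> verts S'" "v \<in> verts S'" for u v
    using assms g[OF that(1)] g[OF that(2)] unfolding isomorphism_def by metis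
  then show ?thesis using bij_betw_inv_into[OF b] by (simp add: isomorphism_def)
qed

lemma equiv_isomorphic:
  "equiv A {(S, S'). S \<in> A \<and> S' \<in> A \<and> (\<exists>f. isomorphism f S S')}"
  by (intro equivI refl_onI symI transI)
    (auto intro: isomorphism_id isomorphism_comp isomorphism_inv)

lemma rooted_isomorphism_iff:
  "rooted_isomorphism f p q \<longleftrightarrow> isomorphism f (fst p) (fst q) \<and> f (snd p) = snd q"
  by (simp add: rooted_isomorphism_def split_def)

lemma equiv_rooted_isomorphic:
  assumes "\<And>S. S \<in> A \<Longrightarrow> rooted_tree S"
  shows "equiv A {(S, S'). S \<in> A \<and> S' \<in> A \<and> (\<exists>f. rooted_isomorphism f S S')}"
proof (intro equivI refl_onI symI transI)
  let ?R = "{(S, S'). S \<in> A \<and> S' \<in> A \<and> (\<exists>f. rooted_isomorphism f S S')}"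
  show "(x, x) \<in> ?R" if "x \<in> A" for x
    using that isomorphism_id[of "fst x"] by (auto simp: rooted_isomorphism_iff)
  show "(y, x) \<in> ?R" if xy: "(x, y) \<in> ?R" for x y
  proof -
    obtain f where f: "isomorphism f (fst x) (fst y)" "f (snd x) = snd y" and A: "x \<in> A" "y \<in> A"
      using xy by (auto simp: rooted_isomorphism_iff)
    have "snd x \<in> verts (fst x)" using assms[OF A(1)] by (auto simp: rooted_tree_def split: prod.splits)
    then have "inv_into (verts (fst x)) f (snd y) = snd x"
      using f by (metis bij_betw_inv_into_left isomorphism_def)
    then show ?thesis using isomorphism_inv[OF f(1)] A
      by (auto simp: rooted_isomorphism_iff)
  qed
  show "(x, z) \<in> ?R" if xy: "(x, y) \<in> ?R" and yz: "(y, z) \<in> ?R" for x y z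
  proof -
    obtain f where f: "isomorphism f (fst x) (fst y)" "f (snd x) = snd y" and A: "x \<in> A" "y \<in> A"
      using xy by (auto simp: rooted_isomorphism_iff)
    obtain g where g: "isomorphism g (fst y) (fst z)" "g (snd y) = snd z" and z: "z \<in> A"
      using yz by (auto simp: rooted_isomorphism_iff)
    show ?thesis using isomorphism_comp[OF f(1) g(1)] f(2) g(2) A z
      by (auto simp: rooted_isomorphism_iff intro!: exI[of _ "\<lambda>x. g (f x)"])
  qed
qed auto

lemma ecard_le_one: "ecard A \<le> 1 \<longleftrightarrow> (\<forall>a\<in>A. \<forall>b\<in>A. a = b)"
proof
  assume "ecard A \<le> 1"
  then have "finite A" "card A \<le> 1"
    by (auto simp: ecard_def one_enat_def split: if_splits)
  then show "\<forall>a\<in>A. \<forall>b\<in>A. a = b" by (auto simp: card_le_Suc0_iff_eq)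
next
  assume *: "\<forall>a\<in>A. \<forall>b\<in>A. a = b"
  have "finite A"
  proof (cases "A = {}")
    case False
    then obtain a where "a \<in> A" by blast
    then have "A \<subseteq> {a}" using * by blast
    then show ?thesis by (rule finite_subset) simp
  qed simp
  then show "ecard A \<le> 1" using * by (auto simp: ecard_def one_enat_def card_le_Suc0_iff_eq)
qed

lemma exists_crossing_step:
  assumes "R\<^sup>*\<^sup>* a b" "P a" "\<not> P b"
  shows "\<exists>x y. R x y \<and> P x \<and> \<not> P y"
  using assms by (induction rule: rtranclp_induct) auto

section \<open>Connected vertex sets of a tree\<close>

locale tree_graph =
  fixes T :: "'a graph"
  assumes tree: "tree T"
begin

abbreviation V where "V \<equiv> verts T"

lemma adj_sym: "adj T u v \<Longrightarrow> adj T v u"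
  by (simp add: adj_def insert_commute)

lemma adj_verts: "adj T u v \<Longrightarrow> u \<in> V \<and> v \<in> V"
  using tree unfolding tree_def simple_graph_def adj_def by blast

lemma adj_irrefl: "\<not> adj T u u"
  using tree unfolding tree_def simple_graph_def adj_def by fastforce

text \<open>
  Every edge of a tree is a bridge: a walk between its ends that avoids it contains a path, which the
  edge would close to a cycle.  Acyclicity of \<open>T\<close> enters the arguments below in this form.
\<close>

lemma bridge:
  assumes "adj T a b"
  shows "\<not> (\<lambda>u v. adj T u v \<and> {u, v} \<noteq> {a, b})\<^sup>*\<^sup>* a b"
proof
  let ?R = "\<lambda>u v. adj T u v \<and> {u, v} \<noteq> {a, b}"
  assume "?R\<^sup>*\<^sup>* a b"
  then obtain xs where xs: "rtrancl_path ?R a xs b" "distinct (a # xs)"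
    by (rule rtranclp_distinct_path)
  have s: "successively ?R (a # xs)" "last (a # xs) = b"
    using rtrancl_path_successively[OF xs(1)] by auto
  have "xs \<noteq> []" using s(2) assms adj_irrefl by auto
  moreover have "xs \<noteq> [b]" using s(1) by auto
  ultimately have "3 \<le> length (a # xs)"
    using s(2) by (cases xs; cases "tl xs") auto
  moreover have "successively (adj T) (a # xs)"
    using s(1) by (rule successively_mono) auto
  ultimately have "is_cycle T (a # xs)"
    using xs(2) s(2) assms adj_sym unfolding is_cycle_def by auto
  then show False using tree by (auto simp: tree_def)
qed

definition step :: "'a set \<Rightarrow> 'a \<Rightarrow> 'a \<Rightarrow> bool" where
  "step X u v \<longleftrightarrow> adj T u v \<and> u \<in> X \<and> v \<in> X"

definition conn :: "'a set \<Rightarrow> bool" where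
  "conn X \<longleftrightarrow> X \<subseteq> V \<and> X \<noteq> {} \<and> (\<forall>u\<in>X. \<forall>v\<in>X. (step X)\<^sup>*\<^sup>* u v)"

lemma step_sym: "(step X)\<^sup>*\<^sup>* u v \<Longrightarrow> (step X)\<^sup>*\<^sup>* v u"
  by (rule sympD[OF symp_rtranclp]) (auto simp: symp_def step_def adj_sym)

lemma step_mono: "X \<subseteq> Y \<Longrightarrow> (step X)\<^sup>*\<^sup>* u v \<Longrightarrow> (step Y)\<^sup>*\<^sup>* u v"
  by (rule mono_rtranclp[THEN mp, rotated]) (auto simp: step_def)

lemma connI:
  assumes "X \<subseteq> V" "c \<in> X" "\<And>v. v \<in> X \<Longrightarrow> (step X)\<^sup>*\<^sup>* v c"
  shows "conn X"
  unfolding conn_def using assms by (blast intro: step_sym rtranclp_trans)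

lemma conn_V: "conn V"
proof -
  have "step V = adj T" by (auto simp: fun_eq_iff step_def dest: adj_verts)
  then show ?thesis using tree by (auto simp: conn_def tree_def connected_graph_def)
qed

lemma conn_single: "c \<in> V \<Longrightarrow> conn {c}"
  by (auto simp: conn_def)

definition emb :: "('a \<Rightarrow> 'a) \<Rightarrow> 'a set \<Rightarrow> 'a set \<Rightarrow> bool" where
  "emb f X Y \<longleftrightarrow> inj_on f X \<and> f ` X \<subseteq> Y \<and> (\<forall>u\<in>X. \<forall>v\<in>X. adj T u v \<longrightarrow> adj T (f u) (f v))"

lemma emb_id: "X \<subseteq> Y \<Longrightarrow> emb (\<lambda>x. x) X Y"
  by (auto simp: emb_def)

lemma emb_comp: "emb f X Y \<Longrightarrow> emb g Y Z \<Longrightarrow> emb (\<lambda>x. g (f x)) X Z"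
  by (auto simp: emb_def inj_on_def image_subset_iff)

lemma emb_mono: "emb f X Y \<Longrightarrow> X' \<subseteq> X \<Longrightarrow> f ` X' \<subseteq> Y' \<Longrightarrow> emb f X' Y'"
  unfolding emb_def by (blast intro: inj_on_subset)

lemma emb_funpow: "emb f X X \<Longrightarrow> emb (f ^^ n) X X"
proof (induction n)
  case (Suc n)
  then show ?case using emb_comp[of "f ^^ n" X X f X] by (simp add: comp_def)
qed (simp add: emb_id id_def)

text \<open>
  The image of the walk from \<open>u\<close> to \<open>v\<close> would be a walk around the edge between \<open>f u\<close> and \<open>f v\<close>.
  Therefore an embedded tree is an induced subgraph, and siblings can be represented by vertex sets.
\<close>

lemma hom_reflects_adj:
  assumes walk: "R\<^sup>*\<^sup>* u v" and sym: "symp R" and inj: "inj_on f A" "u \<in> A" "v \<in> A"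
    and hom: "\<And>a b. R a b \<Longrightarrow> a \<in> A \<and> b \<in> A \<and> adj T (f a) (f b)"
    and uv: "adj T (f u) (f v)"
  shows "R u v"
proof (rule ccontr)
  assume na: "\<not> R u v"
  let ?R = "\<lambda>a b. adj T a b \<and> {a, b} \<noteq> {f u, f v}"
  have st: "?R (f a) (f b)" if ab: "R a b" for a b
  proof -
    have "{a, b} \<noteq> {u, v}" using na ab sym by (auto simp: doubleton_eq_iff dest: sympD)
    then have "f ` {a, b} \<noteq> f ` {u, v}"
      using hom[OF ab] inj by (subst inj_on_image_eq_iff[of f A]) auto
    then show ?thesis using hom[OF ab] by auto
  qed
  have "?R\<^sup>*\<^sup>* (f u) (f v)" using walk by (rule rtranclp_map[rotated]) (rule st)
  then show False using bridge[OF uv] by simp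
qed

lemma emb_reflects_adj:
  assumes "conn X" "emb f X Y" "u \<in> X" "v \<in> X" "adj T (f u) (f v)"
  shows "adj T u v"
proof -
  have "(step X)\<^sup>*\<^sup>* u v" using assms by (auto simp: conn_def)
  then have "step X u v"
    by (rule hom_reflects_adj[where f = f and A = X])
      (use assms in \<open>auto simp: symp_def step_def adj_sym emb_def\<close>)
  then show ?thesis by (simp add: step_def)
qed

lemma conn_image:
  assumes "conn X" "emb f X Y" "Y \<subseteq> V"
  shows "conn (f ` X)"
proof -
  have "(step (f ` X))\<^sup>*\<^sup>* (f u) (f v)" if "(step X)\<^sup>*\<^sup>* u v" for u v
    using that by (rule rtranclp_map[rotated]) (use assms(2) in \<open>auto simp: step_def emb_def\<close>)
  then show ?thesis using assms by (auto simp: conn_def emb_def)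
qed

lemma emb_inv:
  assumes "conn X" "emb f X Y" "f ` X = Y"
  shows "emb (inv_into X f) Y X"
  unfolding emb_def
proof (intro conjI ballI impI)
  show "inj_on (inv_into X f) Y" "inv_into X f ` Y \<subseteq> X"
    using assms(3) by (auto simp: inj_on_inv_into inv_into_into)
  fix u v assume uv: "u \<in> Y" "v \<in> Y" "adj T u v"
  show "adj T (inv_into X f u) (inv_into X f v)"
  proof (rule emb_reflects_adj[OF assms(1,2)])
    have "u \<in> f ` X" "v \<in> f ` X" using uv assms(3) by auto
    then show "inv_into X f u \<in> X" "inv_into X f v \<in> X"
      "adj T (f (inv_into X f u)) (f (inv_into X f v))"
      using uv(3) by (auto simp only: inv_into_into f_inv_into_f)
  qed
qed

section \<open>Decomposing a tree along a connected set\<close>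

definition off :: "'a set \<Rightarrow> 'a \<Rightarrow> 'a \<Rightarrow> bool" where
  "off C u v \<longleftrightarrow> adj T u v \<and> \<not> (u \<in> C \<and> v \<in> C)"

lemma off_sym: "(off C)\<^sup>*\<^sup>* u v \<Longrightarrow> (off C)\<^sup>*\<^sup>* v u"
  by (rule sympD[OF symp_rtranclp]) (auto simp: symp_def off_def adj_sym)

text \<open>
  A walk off \<open>C\<close> from \<open>r\<close> to \<open>s\<close>, followed by a path back inside \<open>C\<close>, would bypass the edge of
  \<open>C\<close> at \<open>r\<close> on this path.
\<close>

lemma off_separates:
  assumes "conn C" "r \<in> C" "s \<in> C" "(off C)\<^sup>*\<^sup>* r s"
  shows "r = s"
proof (rule ccontr)
  assume ne: "r \<noteq> s"
  have "(step C)\<^sup>*\<^sup>* r s" using assms by (auto simp: conn_def)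
  then obtain xs where xs: "rtrancl_path (step C) r xs s" "distinct (r # xs)"
    by (rule rtranclp_distinct_path)
  from xs(1) ne obtain c ys where c: "xs = c # ys" "step C r c" "rtrancl_path (step C) c ys s"
    by (cases rule: rtrancl_path.cases) auto
  let ?R = "\<lambda>u v. adj T u v \<and> {u, v} \<noteq> {r, c}"
  have "?R\<^sup>*\<^sup>* c s"
    by (rule mono_rtranclp[THEN mp, rotated, OF rtrancl_path_imp_rtranclp_on[OF c(3)]])
      (use xs(2) c(1) in \<open>auto simp: step_def doubleton_eq_iff\<close>)
  then have "?R\<^sup>*\<^sup>* s c"
    by (rule sympD[OF symp_rtranclp, rotated]) (auto simp: symp_def adj_sym insert_commute)
  moreover have "?R\<^sup>*\<^sup>* r s"
    by (rule mono_rtranclp[THEN mp, rotated, OF assms(4)])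
      (use c(2) in \<open>auto simp: off_def step_def doubleton_eq_iff\<close>)
  ultimately have "?R\<^sup>*\<^sup>* r c" by (rule rtranclp_trans[rotated])
  then show False using bridge c(2) by (simp add: step_def)
qed

text \<open>
  The point of \<open>C\<close> nearest to \<open>v\<close>.
\<close>

definition proj :: "'a set \<Rightarrow> 'a \<Rightarrow> 'a" where
  "proj C v = (THE r. r \<in> C \<and> (off C)\<^sup>*\<^sup>* v r)"

lemma proj_eq: "conn C \<Longrightarrow> r \<in> C \<Longrightarrow> (off C)\<^sup>*\<^sup>* v r \<Longrightarrow> proj C v = r"
proof -
  assume r: "conn C" "r \<in> C" "(off C)\<^sup>*\<^sup>* v r"
  have "s = r" if "s \<in> C \<and> (off C)\<^sup>*\<^sup>* v s" for s
    using off_separates[OF r(1) _ r(2) rtranclp_trans[OF off_sym r(3)]] that by simp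
  then show ?thesis unfolding proj_def by (rule the_equality[rotated]) (use r in simp_all)
qed

lemma proj_exists:
  assumes "conn C" "v \<in> V"
  shows "proj C v \<in> C \<and> (off C)\<^sup>*\<^sup>* v (proj C v)"
proof -
  obtain c where c: "c \<in> C" "c \<in> V" using assms by (auto simp: conn_def)
  then have "(step V)\<^sup>*\<^sup>* v c" using conn_V assms by (auto simp: conn_def)
  then have "\<exists>r\<in>C. (off C)\<^sup>*\<^sup>* v r"
  proof (induction rule: converse_rtranclp_induct)
    case base then show ?case using c by auto
  next
    case (step y z)
    then show ?case
      by (cases "y \<in> C") (auto simp: step_def off_def intro: converse_rtranclp_into_rtranclp)
  qed
  then show ?thesis using proj_eq[OF assms(1)] by auto
qed

lemma proj_self: "conn C \<Longrightarrow> r \<in> C \<Longrightarrow> proj C r = r"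
  by (rule proj_eq) auto

lemma proj_adj:
  assumes "conn C" "adj T u v"
  shows "proj C u = proj C v \<or> (u \<in> C \<and> v \<in> C)"
proof (cases "u \<in> C \<and> v \<in> C")
  case False
  then have "off C u v" using assms by (simp add: off_def)
  moreover have "proj C v \<in> C \<and> (off C)\<^sup>*\<^sup>* v (proj C v)"
    using assms adj_verts proj_exists by blast
  ultimately show ?thesis using proj_eq[OF assms(1)] by (meson converse_rtranclp_into_rtranclp)
qed simp

definition block :: "'a set \<Rightarrow> ('a \<Rightarrow> 'a) \<Rightarrow> 'a \<Rightarrow> 'a set" where
  "block X t r = {v \<in> X. t v = r}"

text \<open>
  The block \<open>block X t r\<close> is attached to the centre \<open>C\<close> at \<open>r\<close>, and \<open>t\<close> finds the block of a vertex.
  The map \<open>t\<close> is a parameter, rather than \<open>proj C\<close>, so that the same \<open>t\<close> also decomposes subtrees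
  with a smaller centre (\<open>dec_restrict\<close>).
\<close>

definition decomposition :: "'a set \<Rightarrow> 'a set \<Rightarrow> ('a \<Rightarrow> 'a) \<Rightarrow> bool" where
  "decomposition X C t \<longleftrightarrow> X \<subseteq> V \<and> conn C \<and> C \<subseteq> X \<and> (\<forall>r\<in>C. t r = r) \<and> (\<forall>v\<in>X. t v \<in> C) \<and>
     (\<forall>r\<in>C. conn (block X t r)) \<and>
     (\<forall>u\<in>X. \<forall>v\<in>X. adj T u v \<longrightarrow> t u = t v \<or> u \<in> C \<and> v \<in> C)"

lemma dec_blk: "decomposition X C t \<Longrightarrow> r \<in> C \<Longrightarrow> r \<in> block X t r"
  by (auto simp: decomposition_def block_def)

lemma dec_blk_Int: "decomposition X C t \<Longrightarrow> r \<in> C \<Longrightarrow> block X t r \<inter> C = {r}"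
  by (auto simp: decomposition_def block_def)

lemma dec_conn:
  assumes "decomposition X C t" shows "conn X"
proof -
  obtain c where c: "c \<in> C" using assms by (auto simp: decomposition_def conn_def)
  have "(step X)\<^sup>*\<^sup>* v c" if "v \<in> X" for v
  proof -
    have tv: "t v \<in> C" using assms that by (auto simp: decomposition_def)
    have "conn (block X t (t v))" using assms tv by (auto simp: decomposition_def)
    moreover have "t v \<in> block X t (t v)" "v \<in> block X t (t v)"
      using dec_blk[OF assms tv] that by (auto simp: block_def)
    ultimately have "(step (block X t (t v)))\<^sup>*\<^sup>* v (t v)" by (auto simp: conn_def)
    then have "(step X)\<^sup>*\<^sup>* v (t v)" by (rule step_mono[rotated]) (auto simp: block_def)
    moreover have "(step C)\<^sup>*\<^sup>* (t v) c" using assms tv c by (auto simp: decomposition_def conn_def)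
    then have "(step X)\<^sup>*\<^sup>* (t v) c" using assms by (auto simp: decomposition_def intro: step_mono[rotated])
    ultimately show ?thesis by simp
  qed
  then show ?thesis using c assms by (intro connI) (auto simp: decomposition_def)
qed

lemma dec_proj:
  assumes X: "conn X" and C: "conn C" "C \<subseteq> X"
  shows "decomposition X C (proj C)"
proof -
  have XV: "X \<subseteq> V" using X by (simp add: conn_def)
  have walk: "(step (block X (proj C) (proj C v)))\<^sup>*\<^sup>* v (proj C v)" if v: "v \<in> X" for v
  proof -
    obtain c where c: "c \<in> C" using C by (auto simp: conn_def)
    then have "(step X)\<^sup>*\<^sup>* v c" using X C v by (auto simp: conn_def)
    then show ?thesis
    proof (induction rule: converse_rtranclp_induct)
      case base then show ?case using c proj_self[OF C(1)] by auto
    next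
      case (step y z)
      show ?case
      proof (cases "y \<in> C")
        case True then show ?thesis using proj_self[OF C(1)] by auto
      next
        case False
        then have "proj C y = proj C z" using proj_adj[OF C(1)] step by (auto simp: step_def)
        then have "step (block X (proj C) (proj C y)) y z"
          using step by (auto simp: step_def block_def)
        then show ?thesis using step.IH \<open>proj C y = proj C z\<close>
          by (simp add: converse_rtranclp_into_rtranclp)
      qed
    qed
  qed
  have "conn (block X (proj C) r)" if "r \<in> C" for r
    using walk that XV C proj_self[OF C(1)]
    by (intro connI[of _ r]) (auto simp: block_def)
  then show ?thesis
    using assms XV proj_exists[OF C(1)] proj_self[OF C(1)] proj_adj[OF C(1)]
    unfolding decomposition_def by blast
qed

lemma dec_restrict:
  assumes d: "decomposition X C t" and C': "conn C'" "C' \<subseteq> C"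
    and W: "\<And>r. r \<in> C' \<Longrightarrow> W r \<subseteq> block X t r \<and> r \<in> W r \<and> conn (W r)"
  shows "decomposition (\<Union>r\<in>C'. W r) C' t" and "\<And>r. r \<in> C' \<Longrightarrow> block (\<Union>r\<in>C'. W r) t r = W r"
proof -
  show b: "block (\<Union>r\<in>C'. W r) t r = W r" if "r \<in> C'" for r
    using W that by (fastforce simp: block_def)
  have X: "(\<Union>r\<in>C'. W r) \<subseteq> X" using W by (auto simp: block_def)
  have t: "t v \<in> C'" if "v \<in> (\<Union>r\<in>C'. W r)" for v
    using that W by (fastforce simp: block_def)
  have core: "u \<in> C'" if "u \<in> (\<Union>r\<in>C'. W r)" "u \<in> C" for u
    using t[OF that(1)] that(2) d by (metis decomposition_def)
  show "decomposition (\<Union>r\<in>C'. W r) C' t"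
    unfolding decomposition_def
  proof (intro conjI ballI impI)
    show "(\<Union>r\<in>C'. W r) \<subseteq> V" using X d by (auto simp: decomposition_def)
    show "C' \<subseteq> (\<Union>r\<in>C'. W r)" using W by blast
    show "conn C'" by (rule C')
    show "t r = r" if "r \<in> C'" for r using that d C' by (auto simp: decomposition_def)
    show "t v \<in> C'" if "v \<in> (\<Union>r\<in>C'. W r)" for v using t[OF that] .
    show "conn (block (\<Union>r\<in>C'. W r) t r)" if "r \<in> C'" for r using b W that by simp
    fix u v
    assume uv: "u \<in> (\<Union>r\<in>C'. W r)" "v \<in> (\<Union>r\<in>C'. W r)" "adj T u v"
    then have "t u = t v \<or> u \<in> C \<and> v \<in> C" using X d unfolding decomposition_def by blast
    then show "t u = t v \<or> u \<in> C' \<and> v \<in> C'" using core uv by blast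
  qed
qed

text \<open>
  Edges between different blocks lie in the centre, so an embedding of the centre and embeddings of
  the blocks that agree on the centre form an embedding.
\<close>

lemma glue:
  assumes X: "decomposition X C t" and Y: "decomposition Y D t'"
    and s: "emb \<sigma> C D"
    and h: "\<And>r. r \<in> C \<Longrightarrow> emb (h r) (block X t r) (block Y t' (\<sigma> r)) \<and> h r r = \<sigma> r"
  shows "emb (\<lambda>v. h (t v) v) X Y" and "\<And>r. r \<in> C \<Longrightarrow> h (t r) r = \<sigma> r"
    and "\<sigma> ` C = D \<Longrightarrow> (\<And>r. r \<in> C \<Longrightarrow> h r ` block X t r = block Y t' (\<sigma> r)) \<Longrightarrow>
           (\<lambda>v. h (t v) v) ` X = Y"
proof -
  let ?g = "\<lambda>v. h (t v) v"
  have tC: "t v \<in> C" "v \<in> block X t (t v)" if "v \<in> X" for v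
    using that X by (auto simp: decomposition_def block_def)
  have gb: "?g v \<in> Y \<and> t' (?g v) = \<sigma> (t v)" if "v \<in> X" for v
    using h[OF tC(1)[OF that]] tC(2)[OF that] by (auto simp: emb_def block_def)
  show gC: "?g r = \<sigma> r" if "r \<in> C" for r
    using that X h by (auto simp: decomposition_def)
  have "inj_on ?g X"
  proof (rule inj_onI)
    fix u v assume uv: "u \<in> X" "v \<in> X" "?g u = ?g v"
    then have "\<sigma> (t u) = \<sigma> (t v)" using gb by metis
    then have t: "t u = t v" using s tC(1) uv by (auto simp: emb_def dest: inj_onD)
    have "inj_on (h (t u)) (block X t (t u))" using h[OF tC(1)[OF uv(1)]] by (simp add: emb_def)
    moreover have "u \<in> block X t (t u)" "v \<in> block X t (t u)" using uv t by (auto simp: block_def)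
    ultimately show "u = v" using uv(3) t by (auto dest: inj_onD)
  qed
  moreover have "adj T (?g u) (?g v)" if uv: "u \<in> X" "v \<in> X" "adj T u v" for u v
  proof (cases "t u = t v")
    case True
    then have "u \<in> block X t (t u)" "v \<in> block X t (t u)" using uv by (auto simp: block_def)
    then show ?thesis using True uv(3) h[OF tC(1)[OF uv(1)]] unfolding emb_def by metis
  next
    case False
    then have "u \<in> C \<and> v \<in> C" using X uv by (auto simp: decomposition_def)
    then show ?thesis using gC s uv by (auto simp: emb_def)
  qed
  ultimately show "emb ?g X Y" using gb by (auto simp: emb_def)
  show "?g ` X = Y"
    if onC: "\<sigma> ` C = D" and on: "\<And>r. r \<in> C \<Longrightarrow> h r ` block X t r = block Y t' (\<sigma> r)"
  proof
    show "?g ` X \<subseteq> Y" using gb by auto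
    show "Y \<subseteq> ?g ` X"
    proof
      fix y assume y: "y \<in> Y"
      then have "t' y \<in> D" using Y by (auto simp: decomposition_def)
      then obtain r where r: "r \<in> C" "t' y = \<sigma> r" using onC by blast
      then have "y \<in> h r ` block X t r" using on y by (auto simp: block_def)
      then show "y \<in> ?g ` X" by (auto simp: block_def)
    qed
  qed
qed

text \<open>
  Inside a block, \<open>f\<close> sends edges to edges that are not inside \<open>D\<close>; such edges do not leave their
  block.
\<close>

lemma emb_respects_dec:
  assumes f: "emb f X Y" and X: "decomposition X C t" and Y: "decomposition Y D t'"
    and fC: "f ` C \<subseteq> D" and fX: "\<And>v. v \<in> X \<Longrightarrow> f v \<in> D \<Longrightarrow> v \<in> C" and v: "v \<in> X"
  shows "t' (f v) = f (t v)"
proof -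
  obtain r where r: "r = t v" "r \<in> C" using X v by (auto simp: decomposition_def)
  then have "conn (block X t r)" "v \<in> block X t r" using X v by (auto simp: decomposition_def block_def)
  then have "(step (block X t r))\<^sup>*\<^sup>* v r" using dec_blk[OF X r(2)] by (auto simp: conn_def)
  then have "t' (f v) = f r"
  proof (induction rule: converse_rtranclp_induct)
    case base
    have "f r \<in> D" using fC r by auto
    then show ?case using Y by (auto simp: decomposition_def)
  next
    case (step a b)
    then have ab: "a \<in> X" "b \<in> X" "adj T a b" "t a = t b" by (auto simp: step_def block_def)
    have "\<not> (a \<in> C \<and> b \<in> C)" using ab X adj_irrefl unfolding decomposition_def by metis
    then have "\<not> (f a \<in> D \<and> f b \<in> D)" using fX ab by auto
    moreover have "f a \<in> Y" "f b \<in> Y" "adj T (f a) (f b)" using ab f by (auto simp: emb_def)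
    ultimately have "t' (f a) = t' (f b)" using Y unfolding decomposition_def by blast
    then show ?case using step by simp
  qed
  then show ?thesis using r by simp
qed

section \<open>Rooted subtrees and their siblings\<close>

text \<open>
  The pair \<open>(X, c)\<close> stands for the subtree of \<open>T\<close> induced on \<open>X\<close>, rooted at \<open>c\<close>.
\<close>

definition piece :: "'a set \<times> 'a \<Rightarrow> bool" where
  "piece p \<longleftrightarrow> conn (fst p) \<and> snd p \<in> fst p"

definition embeds :: "'a set \<times> 'a \<Rightarrow> 'a set \<times> 'a \<Rightarrow> bool" where
  "embeds p q \<longleftrightarrow> (\<exists>f. emb f (fst p) (fst q) \<and> f (snd p) = snd q)"

definition isomorphic :: "'a set \<times> 'a \<Rightarrow> 'a set \<times> 'a \<Rightarrow> bool" where
  "isomorphic p q \<longleftrightarrow> (\<exists>f. emb f (fst p) (fst q) \<and> f ` fst p = fst q \<and> f (snd p) = snd q)"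

definition equimorphic :: "'a set \<times> 'a \<Rightarrow> 'a set \<times> 'a \<Rightarrow> bool" where
  "equimorphic p q \<longleftrightarrow> embeds p q \<and> embeds q p"

text \<open>
  \<open>unique_sibling\<close> and \<open>many_siblings\<close> say that the number of rooted siblings is one and infinite,
  respectively.  Counting pieces suffices, as a rooted sibling of \<open>p\<close> embeds in \<open>p\<close> and so is
  isomorphic to a piece.
\<close>

definition unique_sibling :: "'a set \<times> 'a \<Rightarrow> bool" where
  "unique_sibling p \<longleftrightarrow> (\<forall>q. piece q \<and> equimorphic p q \<longrightarrow> isomorphic p q)"

definition many_siblings :: "'a set \<times> 'a \<Rightarrow> bool" where
  "many_siblings p \<longleftrightarrow> (\<exists>F :: nat \<Rightarrow> 'a set \<times> 'a.
     (\<forall>n. piece (F n) \<and> equimorphic p (F n)) \<and> (\<forall>n m. isomorphic (F n) (F m) \<longrightarrow> n = m))"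

lemma embeds_refl: "embeds p p"
  using emb_id[of "fst p" "fst p"] by (auto simp: embeds_def)

lemma embeds_trans: "embeds p q \<Longrightarrow> embeds q r \<Longrightarrow> embeds p r"
  unfolding embeds_def using emb_comp by (metis (no_types, lifting))

lemma embeds_subset: "X \<subseteq> Y \<Longrightarrow> embeds (X, c) (Y, c)"
  using emb_id[of X Y] by (auto simp: embeds_def)

lemma isomorphic_embeds: "isomorphic p q \<Longrightarrow> embeds p q"
  by (auto simp: isomorphic_def embeds_def)

lemma isomorphic_refl: "isomorphic p p"
  using emb_id[of "fst p" "fst p"] by (auto simp: isomorphic_def)

lemma isomorphic_trans: "isomorphic p q \<Longrightarrow> isomorphic q r \<Longrightarrow> isomorphic p r"
  unfolding isomorphic_def
proof (elim exE conjE)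
  fix f g assume "emb f (fst p) (fst q)" "f ` fst p = fst q" "f (snd p) = snd q"
    "emb g (fst q) (fst r)" "g ` fst q = fst r" "g (snd q) = snd r"
  then show "\<exists>f. emb f (fst p) (fst r) \<and> f ` fst p = fst r \<and> f (snd p) = snd r"
    using emb_comp[of f "fst p" "fst q" g "fst r"]
    by (intro exI[of _ "\<lambda>x. g (f x)"]) (auto simp: image_image[symmetric])
qed

lemma isomorphic_sym: "piece p \<Longrightarrow> isomorphic p q \<Longrightarrow> isomorphic q p"
  unfolding isomorphic_def
proof (elim exE conjE)
  fix f assume p: "piece p" and f: "emb f (fst p) (fst q)" "f ` fst p = fst q" "f (snd p) = snd q"
  let ?g = "inv_into (fst p) f"
  have inj: "inj_on f (fst p)" using f by (simp add: emb_def)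
  have "emb ?g (fst q) (fst p)" using emb_inv p f by (auto simp: piece_def)
  moreover have "?g ` fst q = fst p"
    using inv_into_image_cancel[OF inj, of "fst p"] f(2) by simp
  moreover have "?g (snd q) = snd p"
    using inv_into_f_f[OF inj, of "snd p"] p f(3) by (simp add: piece_def)
  ultimately show "\<exists>f. emb f (fst q) (fst p) \<and> f ` fst q = fst p \<and> f (snd q) = snd p" by blast
qed

lemma isomorphic_equimorphic: "piece p \<Longrightarrow> isomorphic p q \<Longrightarrow> equimorphic p q"
  using isomorphic_embeds isomorphic_sym unfolding equimorphic_def by blast

lemma equimorphic_trans: "equimorphic p q \<Longrightarrow> equimorphic q r \<Longrightarrow> equimorphic p r"
  using embeds_trans unfolding equimorphic_def by blast

lemma equimorphic_sym: "equimorphic p q \<Longrightarrow> equimorphic q p"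
  by (simp add: equimorphic_def)

lemma embeds_image:
  assumes "embeds p q" "piece p" "piece q"
  shows "\<exists>W \<subseteq> fst q. piece (W, snd q) \<and> isomorphic p (W, snd q)"
proof -
  obtain f where f: "emb f (fst p) (fst q)" "f (snd p) = snd q" using assms by (auto simp: embeds_def)
  have "conn (f ` fst p)"
    using conn_image[OF _ f(1)] assms by (auto simp: piece_def conn_def)
  moreover have "snd q \<in> f ` fst p"
    using f(2)[symmetric] assms(2) by (simp add: piece_def)
  moreover have "emb f (fst p) (f ` fst p)" "f ` fst p \<subseteq> fst q" using f(1) by (auto simp: emb_def)
  ultimately show ?thesis using f(2)
    by (intro exI[of _ "f ` fst p"]) (auto simp: piece_def isomorphic_def)
qed

lemma many_equimorphic: "many_siblings p \<Longrightarrow> equimorphic p q \<Longrightarrow> many_siblings q"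
  unfolding many_siblings_def using equimorphic_trans equimorphic_sym by metis

lemma glue_embeds:
  assumes "decomposition X C t" "decomposition Y D t'" "emb \<sigma> C D"
    and "\<And>r. r \<in> C \<Longrightarrow> embeds (block X t r, r) (block Y t' (\<sigma> r), \<sigma> r)"
  obtains f where "emb f X Y" "\<And>r. r \<in> C \<Longrightarrow> f r = \<sigma> r"
proof -
  obtain h where h: "\<And>r. r \<in> C \<Longrightarrow> emb (h r) (block X t r) (block Y t' (\<sigma> r)) \<and> h r r = \<sigma> r"
    using assms(4) unfolding embeds_def by (metis fst_conv snd_conv)
  show thesis
    by (rule that[OF glue(1)[OF assms(1-3) h]]) (use glue(2)[OF assms(1-3) h] in auto)
qed

lemma glue_iso:
  assumes "decomposition X C t" "decomposition Y D t'" "emb \<sigma> C D" "\<sigma> ` C = D"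
    and "\<And>r. r \<in> C \<Longrightarrow> isomorphic (block X t r, r) (block Y t' (\<sigma> r), \<sigma> r)"
  obtains f where "emb f X Y" "f ` X = Y" "\<And>r. r \<in> C \<Longrightarrow> f r = \<sigma> r"
proof -
  obtain h where h: "\<And>r. r \<in> C \<Longrightarrow> emb (h r) (block X t r) (block Y t' (\<sigma> r)) \<and>
      h r ` block X t r = block Y t' (\<sigma> r) \<and> h r r = \<sigma> r"
    using assms(5) unfolding isomorphic_def by (metis fst_conv snd_conv)
  have h': "\<And>r. r \<in> C \<Longrightarrow> emb (h r) (block X t r) (block Y t' (\<sigma> r)) \<and> h r r = \<sigma> r"
    using h by blast
  have on: "\<And>r. r \<in> C \<Longrightarrow> h r ` block X t r = block Y t' (\<sigma> r)" using h by blast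
  show thesis
    by (rule that[OF glue(1)[OF assms(1-3) h'] glue(3)[OF assms(1-3) h' assms(4) on]])
      (use glue(2)[OF assms(1-3) h'] in auto)
qed

lemma dec_piece: "decomposition X C t \<Longrightarrow> r \<in> C \<Longrightarrow> piece (block X t r, r)"
  using dec_blk by (auto simp: piece_def decomposition_def)

text \<open>
  All blocks equimorphic to the block at \<open>r0\<close> are replaced by copies of its \<open>n\<close>-th sibling.  Then
  each block in this equimorphism class, wherever an isomorphism may move it, determines \<open>n\<close>.
\<close>

lemma replace_blocks:
  assumes X: "decomposition X C t" and r0: "r0 \<in> C" and many_siblings: "many_siblings (block X t r0, r0)"
  obtains W :: "nat \<Rightarrow> 'a \<Rightarrow> 'a set" where
    "\<And>n r. r \<in> C \<Longrightarrow> W n r \<subseteq> block X t r \<and> piece (W n r, r) \<and> equimorphic (block X t r, r) (W n r, r)"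
    "\<And>n m s. s \<in> C \<Longrightarrow> isomorphic (W n r0, r0) (W m s, s) \<Longrightarrow> n = m"
proof -
  obtain F :: "nat \<Rightarrow> 'a set \<times> 'a" where F0: "\<forall>n. piece (F n) \<and> equimorphic (block X t r0, r0) (F n)"
    "\<forall>n m. isomorphic (F n) (F m) \<longrightarrow> n = m"
    using many_siblings unfolding many_siblings_def by (elim exE conjE) (rule that)
  then have F: "\<And>n. piece (F n)" "\<And>n. equimorphic (block X t r0, r0) (F n)"
    "\<And>n m. isomorphic (F n) (F m) \<Longrightarrow> n = m"
    by simp_all
  let ?b = "\<lambda>r. (block X t r, r)"
  have ex: "\<exists>W. W \<subseteq> block X t r \<and> piece (W, r) \<and> equimorphic (?b r) (W, r) \<and>
      (if equimorphic (?b r0) (?b r) then isomorphic (F n) (W, r) else W = block X t r)" if r: "r \<in> C" for n r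
  proof (cases "equimorphic (?b r0) (?b r)")
    case True
    then have "equimorphic (F n) (?b r)" using F(2) equimorphic_trans equimorphic_sym by blast
    then obtain W where W: "W \<subseteq> block X t r" "piece (W, r)" "isomorphic (F n) (W, r)"
      using embeds_image[of "F n" "?b r"] F(1) dec_piece[OF X r] by (auto simp: equimorphic_def)
    then have "equimorphic (?b r) (W, r)"
      using \<open>equimorphic (F n) (?b r)\<close> isomorphic_equimorphic[OF F(1)] equimorphic_trans equimorphic_sym by blast
    then show ?thesis using W True by auto
  next
    case False
    then show ?thesis using dec_piece[OF X r] embeds_refl by (auto simp: equimorphic_def)
  qed
  define W where "W n r = (SOME W. W \<subseteq> block X t r \<and> piece (W, r) \<and> equimorphic (?b r) (W, r) \<and>
      (if equimorphic (?b r0) (?b r) then isomorphic (F n) (W, r) else W = block X t r))" for n r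
  have W: "W n r \<subseteq> block X t r \<and> piece (W n r, r) \<and> equimorphic (?b r) (W n r, r) \<and>
      (if equimorphic (?b r0) (?b r) then isomorphic (F n) (W n r, r) else W n r = block X t r)"
    if "r \<in> C" for n r
    unfolding W_def by (rule someI_ex[OF ex[OF that]])
  have "n = m" if s: "s \<in> C" and isomorphic: "isomorphic (W n r0, r0) (W m s, s)" for n m s
  proof -
    have n: "isomorphic (F n) (W n r0, r0)" using W[OF r0, of n] embeds_refl by (auto simp: equimorphic_def)
    then have Fn: "isomorphic (F n) (W m s, s)" using isomorphic isomorphic_trans by blast
    have "equimorphic (?b r0) (?b s)"
      using F(2)[of n] isomorphic_equimorphic[OF F(1) Fn] W[OF s, of m] equimorphic_trans equimorphic_sym by blast
    then have "isomorphic (F m) (W m s, s)" using W[OF s, of m] by simp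
    then show ?thesis using F(1,3) Fn isomorphic_sym isomorphic_trans by blast
  qed
  then show thesis using W by (intro that[of W]) blast+
qed

lemma replaced_blocks_embed:
  assumes X: "decomposition X C t"
    and W: "\<And>r. r \<in> C \<Longrightarrow> W r \<subseteq> block X t r \<and> piece (W r, r) \<and> equimorphic (block X t r, r) (W r, r)"
  shows "decomposition (\<Union>r\<in>C. W r) C t" "\<And>r. r \<in> C \<Longrightarrow> block (\<Union>r\<in>C. W r) t r = W r"
    "\<exists>f. emb f X (\<Union>r\<in>C. W r) \<and> (\<forall>r\<in>C. f r = r)"
proof -
  have C: "conn C" using X by (simp add: decomposition_def)
  have W': "\<And>r. r \<in> C \<Longrightarrow> W r \<subseteq> block X t r \<and> r \<in> W r \<and> conn (W r)"
    using W by (auto simp: piece_def)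
  note r = dec_restrict[OF X C order_refl W']
  show d: "decomposition (\<Union>r\<in>C. W r) C t" by (rule r(1)) 
  show b: "\<And>r. r \<in> C \<Longrightarrow> block (\<Union>r\<in>C. W r) t r = W r" by (rule r(2))
  show "\<exists>f. emb f X (\<Union>r\<in>C. W r) \<and> (\<forall>r\<in>C. f r = r)"
    by (rule glue_embeds[OF X d emb_id[OF order_refl]]) (use W b in \<open>auto simp: equimorphic_def\<close>)
qed

text \<open>
  The converse of gluing: an embedding that respects the centres sends blocks into blocks.
\<close>

lemma split_dec:
  assumes X: "decomposition X C t" and Y: "decomposition Y D t'" and f: "emb f X Y"
    and fC: "f ` C \<subseteq> D" and fD: "\<And>v. v \<in> X \<Longrightarrow> f v \<in> D \<Longrightarrow> v \<in> C" and r: "r \<in> C"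
  shows "emb f (block X t r) (block Y t' (f r))"
    and "f ` X = Y \<Longrightarrow> isomorphic (block X t r, r) (block Y t' (f r), f r)"
proof -
  have pruned: "t' (f v) = f (t v)" if "v \<in> X" for v
    by (rule emb_respects_dec[OF f X Y fC fD that])
  show eb: "emb f (block X t r) (block Y t' (f r))"
    using pruned f by (intro emb_mono[OF f]) (auto simp: block_def emb_def)
  show "isomorphic (block X t r, r) (block Y t' (f r), f r)" if on: "f ` X = Y"
  proof -
    have "y \<in> f ` block X t r" if y: "y \<in> block Y t' (f r)" for y
    proof -
      obtain x where x: "x \<in> X" "y = f x" using on y by (auto simp: block_def)
      then have "f (t x) = f r" using pruned y by (auto simp: block_def)
      moreover have "t x \<in> X" "r \<in> X" using X x r by (auto simp: decomposition_def)
      ultimately have "t x = r" using f by (auto simp: emb_def dest: inj_onD)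
      then show ?thesis using x by (auto simp: block_def)
    qed
    then have "f ` block X t r = block Y t' (f r)" using eb by (auto simp: emb_def)
    then show ?thesis using eb by (auto simp: isomorphic_def)
  qed
qed

section \<open>Stars\<close>

definition kids :: "'a set \<Rightarrow> 'a \<Rightarrow> 'a set" where
  "kids X c = {v \<in> X. adj T c v}"

text \<open>
  The root with its neighbours is used as a centre for rooted trees; the blocks at the neighbours are
  the subtrees hanging from the root.
\<close>

definition star :: "'a set \<Rightarrow> 'a \<Rightarrow> 'a set" where
  "star X c = insert c (kids X c)"

lemma no_triangle:
  assumes "adj T c u" "adj T c v" shows "\<not> adj T u v"
proof
  assume uv: "adj T u v"
  let ?R = "\<lambda>x y. adj T x y \<and> {x, y} \<noteq> {u, v}"
  have "?R u c" "?R c v"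
    using assms adj_sym adj_irrefl by (auto simp: doubleton_eq_iff)
  then have "?R\<^sup>*\<^sup>* u v" by (rule rtranclp.rtrancl_into_rtrancl[OF r_into_rtranclp[of ?R]])
  then show False using bridge[OF uv] by simp
qed

lemma conn_star:
  assumes "X \<subseteq> V" "c \<in> X" shows "conn (star X c)"
proof (rule connI[of _ c])
  fix v assume v: "v \<in> star X c"
  show "(step (star X c))\<^sup>*\<^sup>* v c"
  proof (cases "v = c")
    case False
    then have "step (star X c) v c" using v adj_sym by (auto simp: step_def star_def kids_def)
    then show ?thesis by blast
  qed simp
qed (use assms in \<open>auto simp: star_def kids_def\<close>)

lemma emb_star:
  assumes "inj_on \<sigma> (kids X c)" "\<sigma> ` kids X c \<subseteq> kids Y d"
  shows "emb (\<sigma>(c := d)) (star X c) (star Y d)"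
proof -
  have c: "c \<notin> kids X c" "d \<notin> kids Y d" using adj_irrefl by (auto simp: kids_def)
  have k: "adj T d (\<sigma> v)" "adj T (\<sigma> v) d" if "v \<in> kids X c" for v
    using that assms(2) adj_sym by (auto simp: kids_def)
  have ne: "\<sigma> v \<noteq> d" if "v \<in> kids X c" for v
    using k[OF that] adj_irrefl by metis
  show ?thesis
    unfolding emb_def
  proof (intro conjI ballI impI)
    show "inj_on (\<sigma>(c := d)) (star X c)"
      unfolding star_def
      using assms(1) c ne by (auto simp: inj_on_def)
    show "(\<sigma>(c := d)) ` star X c \<subseteq> star Y d"
      using assms(2) by (auto simp: star_def)
    fix u v assume uv: "u \<in> star X c" "v \<in> star X c" "adj T u v"
    consider "u = c" "v \<in> kids X c" | "v = c" "u \<in> kids X c"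
      using uv no_triangle[of c u v] adj_irrefl by (auto simp: star_def kids_def)
    then show "adj T ((\<sigma>(c := d)) u) ((\<sigma>(c := d)) v)"
      by cases (use k c(1) in \<open>auto simp: fun_upd_def\<close>)
  qed
qed

text \<open>
  A path from \<open>c\<close> to another vertex starts with a neighbour of \<open>c\<close>, which has a block of its own.
\<close>

lemma blk_root:
  assumes "decomposition X (star X c) t" shows "block X t c = {c}"
proof -
  have c: "c \<in> block X t c" using dec_blk[OF assms, of c] by (simp add: star_def)
  have "v = c" if "v \<in> block X t c" for v
  proof -
    have "conn (block X t c)" using assms by (auto simp: decomposition_def star_def)
    then have "(step (block X t c))\<^sup>*\<^sup>* c v" using that c by (auto simp: conn_def)
    then show ?thesis
    proof (cases rule: converse_rtranclpE)
      case (step u)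
      then have "u \<in> star X c" "u \<in> block X t c" "adj T c u"
        by (auto simp: step_def block_def star_def kids_def)
      moreover have "block X t c \<inter> star X c = {c}"
        using dec_blk_Int[OF assms] by (simp add: star_def)
      ultimately have "u = c" by auto
      then show ?thesis using \<open>adj T c u\<close> adj_irrefl by simp
    qed simp
  qed
  then show ?thesis using c by auto
qed

lemma glue_star_embeds:
  assumes "decomposition X (star X c) t" "decomposition Y (star Y d) t'" "inj_on \<sigma> (kids X c)" "\<sigma> ` kids X c \<subseteq> kids Y d"
    and embeds: "\<And>v. v \<in> kids X c \<Longrightarrow> embeds (block X t v, v) (block Y t' (\<sigma> v), \<sigma> v)"
  shows "embeds (X, c) (Y, d)"
proof (rule glue_embeds[OF assms(1,2) emb_star[OF assms(3,4)]])
  fix r assume r: "r \<in> star X c"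
  have "embeds ({c}, c) ({d}, d)" using adj_irrefl by (auto simp: embeds_def emb_def intro: exI[of _ "\<lambda>_. d"])
  then show "embeds (block X t r, r) (block Y t' ((\<sigma>(c := d)) r), (\<sigma>(c := d)) r)"
    using r embeds blk_root[OF assms(1)] blk_root[OF assms(2)] by (auto simp: star_def)
next
  fix f assume "emb f X Y" "\<And>r. r \<in> star X c \<Longrightarrow> f r = (\<sigma>(c := d)) r"
  then show ?thesis by (auto simp: embeds_def star_def intro!: exI[of _ f])
qed

lemma glue_star_iso:
  assumes "decomposition X (star X c) t" "decomposition Y (star Y d) t'" and \<sigma>: "bij_betw \<sigma> (kids X c) (kids Y d)"
    and isomorphic: "\<And>v. v \<in> kids X c \<Longrightarrow> isomorphic (block X t v, v) (block Y t' (\<sigma> v), \<sigma> v)"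
  shows "isomorphic (X, c) (Y, d)"
proof -
  have \<sigma>': "inj_on \<sigma> (kids X c)" "\<sigma> ` kids X c = kids Y d" using \<sigma> by (auto simp: bij_betw_def)
  have c: "c \<notin> kids X c" using adj_irrefl by (auto simp: kids_def)
  have on: "(\<sigma>(c := d)) ` star X c = star Y d"
    using \<sigma>' c by (auto simp: star_def)
  show ?thesis
  proof (rule glue_iso[OF assms(1,2) emb_star[OF \<sigma>'(1)] on])
    show "\<sigma> ` kids X c \<subseteq> kids Y d" using \<sigma>' by simp
    fix r assume r: "r \<in> star X c"
    have "isomorphic ({c}, c) ({d}, d)" using adj_irrefl by (auto simp: isomorphic_def emb_def intro: exI[of _ "\<lambda>_. d"])
    then show "isomorphic (block X t r, r) (block Y t' ((\<sigma>(c := d)) r), (\<sigma>(c := d)) r)"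
      using r isomorphic blk_root[OF assms(1)] blk_root[OF assms(2)] by (auto simp: star_def)
  next
    fix f assume "emb f X Y" "f ` X = Y" "\<And>r. r \<in> star X c \<Longrightarrow> f r = (\<sigma>(c := d)) r"
    then show ?thesis by (auto simp: isomorphic_def star_def intro!: exI[of _ f])
  qed
qed

lemma split_star:
  assumes X: "decomposition X (star X c) t" and Y: "decomposition Y (star Y d) t'" and f: "emb f X Y" "f c = d"
  shows "inj_on f (kids X c)" "f ` kids X c \<subseteq> kids Y d"
    and "\<And>v. v \<in> kids X c \<Longrightarrow> embeds (block X t v, v) (block Y t' (f v), f v)"
    and "f ` X = Y \<Longrightarrow> f ` kids X c = kids Y d"
    and "\<And>v. f ` X = Y \<Longrightarrow> v \<in> kids X c \<Longrightarrow> isomorphic (block X t v, v) (block Y t' (f v), f v)"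
proof -
  have cX: "c \<in> X" and cn: "conn X" using X dec_conn[OF X] by (auto simp: decomposition_def star_def)
  have kX: "kids X c \<subseteq> X" "star X c \<subseteq> X" using cX by (auto simp: kids_def star_def)
  have inj: "inj_on f X" using f by (simp add: emb_def)
  show "inj_on f (kids X c)" by (rule inj_on_subset[OF inj kX(1)])
  show fk: "f ` kids X c \<subseteq> kids Y d"
    using f cX by (auto simp: kids_def emb_def)
  have kid_back: "v \<in> kids X c" if "v \<in> X" "f v \<in> kids Y d" for v
    using emb_reflects_adj[OF cn f(1) cX that(1)] that f(2) by (auto simp: kids_def)
  have fS: "f ` star X c \<subseteq> star Y d" using fk f(2) by (auto simp: star_def)
  have star_back: "v \<in> star X c" if v: "v \<in> X" "f v \<in> star Y d" for v
    using v kid_back inj_onD[OF inj _ v(1) cX] f(2) by (auto simp: star_def)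
  note sd = split_dec[OF X Y f(1) fS star_back]
  show "embeds (block X t v, v) (block Y t' (f v), f v)" if "v \<in> kids X c" for v
    using sd(1)[of v] that by (auto simp: embeds_def star_def)
  show "isomorphic (block X t v, v) (block Y t' (f v), f v)" if "f ` X = Y" "v \<in> kids X c" for v
    using sd(2)[of v] that by (simp add: star_def)
  show "f ` kids X c = kids Y d" if on: "f ` X = Y"
  proof
    show "kids Y d \<subseteq> f ` kids X c"
    proof
      fix y assume y: "y \<in> kids Y d"
      then obtain v where "v \<in> X" "y = f v" using on by (auto simp: kids_def)
      then show "y \<in> f ` kids X c" using kid_back y by auto
    qed
  qed (rule fk)
qed

lemma restrict_star:
  assumes Y: "decomposition Y (star Y d) t" and J: "J \<subseteq> kids Y d"
    and W: "\<And>j. j \<in> J \<Longrightarrow> W j \<subseteq> block Y t j \<and> piece (W j, j)"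
    and Y': "Y' = insert d (\<Union>j\<in>J. W j)"
  shows "decomposition Y' (star Y' d) t" "kids Y' d = J" "\<And>j. j \<in> J \<Longrightarrow> block Y' t j = W j" "Y' \<subseteq> Y"
    "piece (Y', d)"
proof -
  let ?C = "insert d J" and ?W = "\<lambda>r. if r = d then {d} else W r"
  have dY: "d \<in> Y" "Y \<subseteq> V" using Y by (auto simp: decomposition_def star_def)
  have dJ: "d \<notin> J" using J adj_irrefl by (auto simp: kids_def)
  have Yeq: "Y' = (\<Union>r\<in>?C. ?W r)" using Y' dJ by auto
  have "?C = star ?C d" using J by (auto simp: star_def kids_def)
  then have C: "conn ?C" using conn_star[of ?C d] J dY by (auto simp: kids_def)
  have CS: "?C \<subseteq> star Y d" using J by (auto simp: star_def)
  have dd: "d \<in> block Y t d" using dec_blk[OF Y, of d] by (simp add: star_def)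
  have W': "?W r \<subseteq> block Y t r \<and> r \<in> ?W r \<and> conn (?W r)" if "r \<in> ?C" for r
    using that W dd conn_single dY by (auto simp: piece_def)
  have d: "decomposition Y' ?C t" and b: "\<And>r. r \<in> ?C \<Longrightarrow> block Y' t r = ?W r"
    using dec_restrict[OF Y C CS, of ?W, folded Yeq] W' by blast+
  have "\<And>r. r \<in> ?C \<Longrightarrow> ?W r \<subseteq> Y" using W' unfolding block_def by blast
  then show YY: "Y' \<subseteq> Y" unfolding Yeq by (rule UN_least)
  show k: "kids Y' d = J"
  proof
    show "kids Y' d \<subseteq> J"
    proof
      fix v assume v: "v \<in> kids Y' d"
      then have "v \<in> star Y d" using YY by (auto simp: star_def kids_def)
      then have "t v = v" using Y by (auto simp: decomposition_def)
      moreover have "t v \<in> ?C" using d v by (auto simp: decomposition_def kids_def)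
      ultimately show "v \<in> J" using v adj_irrefl by (auto simp: kids_def)
    qed
    show "J \<subseteq> kids Y' d" using J W Y' by (auto simp: kids_def piece_def)
  qed
  then have "star Y' d = ?C" by (simp add: star_def)
  then show d': "decomposition Y' (star Y' d) t" using d by simp
  show "block Y' t j = W j" if "j \<in> J" for j using b[of j] that dJ by auto
  show "piece (Y', d)" using dec_conn[OF d'] Y' by (auto simp: piece_def)
qed

section \<open>Rayless rooted trees\<close>

abbreviation rooted_block :: "'a set \<Rightarrow> ('a \<Rightarrow> 'a) \<Rightarrow> 'a \<Rightarrow> 'a set \<times> 'a" where
  "rooted_block X t r \<equiv> (block X t r, r)"

lemma kid_piece: "decomposition X (star X c) t \<Longrightarrow> v \<in> kids X c \<Longrightarrow> piece (rooted_block X t v)"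
  using dec_piece[of X "star X c" t v] unfolding star_def by blast

text \<open>
  The invariant used to tell rooted trees apart: how often the type \<open>z\<close> occurs among the subtrees at
  the root.
\<close>

lemma kids_count:
  assumes X: "decomposition X (star X c) t" and Y: "decomposition Y (star Y d) t'" and isomorphic: "isomorphic (X, c) (Y, d)"
  shows "card {i \<in> kids X c. isomorphic z (rooted_block X t i)} = card {j \<in> kids Y d. isomorphic z (rooted_block Y t' j)}"
proof -
  obtain f where f: "emb f X Y" "f ` X = Y" "f c = d" using isomorphic by (auto simp: isomorphic_def)
  note s = split_star[OF X Y f(1,3)]
  have eq: "isomorphic z (rooted_block X t i) \<longleftrightarrow> isomorphic z (rooted_block Y t' (f i))" if "i \<in> kids X c" for i
    using s(5)[OF f(2) that] isomorphic_sym[OF kid_piece[OF X that]] isomorphic_trans by blast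
  have "f ` {i \<in> kids X c. isomorphic z (rooted_block X t i)} = {j \<in> kids Y d. isomorphic z (rooted_block Y t' j)}"
  proof (intro set_eqI iffI)
    fix j assume j: "j \<in> {j \<in> kids Y d. isomorphic z (rooted_block Y t' j)}"
    then obtain i where "i \<in> kids X c" "j = f i" using s(4)[OF f(2)] by blast
    then show "j \<in> f ` {i \<in> kids X c. isomorphic z (rooted_block X t i)}" using eq j by blast
  qed (use s(4)[OF f(2)] eq in blast)
  moreover have "inj_on f {i \<in> kids X c. isomorphic z (rooted_block X t i)}"
    by (rule inj_on_subset[OF s(1)]) auto
  then have "card (f ` {i \<in> kids X c. isomorphic z (rooted_block X t i)}) = card {i \<in> kids X c. isomorphic z (rooted_block X t i)}"
    by (rule card_image)
  ultimately show ?thesis by simp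
qed

lemma many_siblings_by_counting:
  assumes F: "\<And>n :: nat. decomposition (F n) (star (F n) d) t" "\<And>n. piece (F n, d)" "\<And>n. equimorphic p (F n, d)"
    and card: "\<And>n. card {j \<in> kids (F n) d. isomorphic z (rooted_block (F n) t j)} = b + n"
  shows "many_siblings p"
proof -
  have "n = m" if "isomorphic (F n, d) (F m, d)" for n m
    using kids_count[OF F(1) F(1) that, of z] card by simp
  then have "(\<forall>n. piece (F n, d) \<and> equimorphic p (F n, d)) \<and> (\<forall>n m. isomorphic (F n, d) (F m, d) \<longrightarrow> n = m)"
    using F(2,3) by blast
  then show ?thesis unfolding many_siblings_def by (rule exI[where x = "\<lambda>n. (F n, d)"])
qed

text \<open>
  Suppose that the type \<open>z\<close> occurs more often at the root of \<open>Y\<close> than at the root of \<open>X\<close>.  Embeddings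
  \<open>\<phi>\<close> of \<open>Y\<close> in \<open>X\<close> and \<open>\<psi>\<close> of \<open>X\<close> in \<open>Y\<close> compose to an injection \<open>k\<close> of the neighbours of the
  root of \<open>Y\<close> along which the subtrees increase.  Since there are too few places of type \<open>z\<close> in \<open>X\<close>,
  some places \<open>e\<close> of type \<open>z\<close> in \<open>Y\<close> go to places of another type in \<open>X\<close>.  As \<open>z\<close> is the only
  sibling of itself, the orbit of such an \<open>e\<close> never again visits type \<open>z\<close>, and is infinite.  Every
  place on it has room for a copy of \<open>z\<close>, so that the number of copies of \<open>z\<close> can be varied.
\<close>

lemma many_siblings_if_fewer:
  assumes X: "decomposition X (star X c) t" and Y: "decomposition Y (star Y d) t'"
    and XY: "embeds (X, c) (Y, d)" and YX: "embeds (Y, d) (X, c)"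
    and j0: "j0 \<in> kids Y d" and z: "z = rooted_block Y t' j0" and unique_sibling: "unique_sibling z"
    and noinj: "\<And>h. inj_on h {j \<in> kids Y d. isomorphic z (rooted_block Y t' j)} \<Longrightarrow>
      \<not> h ` {j \<in> kids Y d. isomorphic z (rooted_block Y t' j)} \<subseteq> {i \<in> kids X c. isomorphic z (rooted_block X t i)}"
  shows "many_siblings (Y, d)"
proof -
  let ?x = "rooted_block X t" and ?y = "rooted_block Y t'"
  define J where "J = kids Y d"
  define Z where "Z = {j \<in> J. isomorphic z (?y j)}"
  define ZX where "ZX = {i \<in> kids X c. isomorphic z (?x i)}"
  have pz: "piece z" using kid_piece[OF Y j0] z by simp
  obtain \<psi> where \<psi>: "emb \<psi> X Y" "\<psi> c = d" using XY by (auto simp: embeds_def)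
  obtain \<phi> where \<phi>: "emb \<phi> Y X" "\<phi> d = c" using YX by (auto simp: embeds_def)
  note s1 = split_star[OF Y X \<phi>, folded J_def] and s2 = split_star[OF X Y \<psi>, folded J_def]
  define k where "k = (\<lambda>j. \<psi> (\<phi> j))"
  have kJ: "inj_on k J" "k ` J \<subseteq> J"
    using comp_inj_on[OF s1(1) inj_on_subset[OF s2(1) s1(2)]] s1(2) s2(2)
    by (auto simp: k_def comp_def)
  have x_le: "embeds (?x (\<phi> j)) (?y (k j))" if "j \<in> J" for j
    using s2(3)[of "\<phi> j"] s1(2) that by (auto simp: k_def)
  have k_le: "embeds (?y j) (?y (k j))" if "j \<in> J" for j
    using s1(3)[OF that] x_le[OF that] embeds_trans by blast
  have kn: "(k ^^ n) j \<in> J \<and> embeds (?y j) (?y ((k ^^ n) j))" if "j \<in> J" for n j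
    using that
  proof (induction n)
    case (Suc n)
    then show ?case using kJ(2) k_le[of "(k ^^ n) j"] embeds_trans by auto
  qed (simp add: embeds_refl)
  \<comment> \<open>the places at which type \<open>z\<close> is left on the way to \<open>X\<close>\<close>
  define E where "E = {j \<in> Z. \<phi> j \<notin> ZX}"
  have EZ: "E \<subseteq> Z" "Z \<subseteq> J" by (auto simp: E_def Z_def)
  have ZE: "\<phi> ` (Z - E) \<subseteq> ZX" by (auto simp: E_def)
  have exit: "(k ^^ Suc m) e \<notin> Z" if e: "e \<in> E" for e m
  proof
    assume "(k ^^ Suc m) e \<in> Z"
    then have "isomorphic z (?y ((k ^^ m) (k e)))" by (simp add: Z_def funpow_swap1)
    then have "embeds (?y ((k ^^ m) (k e))) z" using isomorphic_embeds isomorphic_sym[OF pz] by blast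
    moreover have eJ: "e \<in> J" using e EZ by auto
    moreover have "embeds (?y (k e)) (?y ((k ^^ m) (k e)))" using kn[of "k e" m] kJ(2) eJ by auto
    ultimately have "embeds (?x (\<phi> e)) z" using x_le[OF eJ] embeds_trans by blast
    moreover have "isomorphic z (?y e)" using e by (auto simp: E_def Z_def)
    then have "embeds z (?x (\<phi> e))" using s1(3)[OF eJ] isomorphic_embeds embeds_trans by blast
    moreover have k: "\<phi> e \<in> kids X c" using s1(2) eJ by auto
    ultimately have "isomorphic z (?x (\<phi> e))"
      using unique_sibling kid_piece[OF X k] by (auto simp: unique_sibling_def equimorphic_def)
    then have "\<phi> e \<in> ZX" using k by (simp add: ZX_def)
    then show False using e by (simp add: E_def)
  qed
  have noinj': "\<not> h ` Z \<subseteq> ZX" if "inj_on h Z" for h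
    using noinj[of h] that by (simp add: Z_def ZX_def J_def)
  have \<phi>Z: "inj_on \<phi> A" if "A \<subseteq> Z" for A
    using inj_on_subset[OF s1(1)] that EZ by blast
  have zle: "embeds z (?y j)" if "j \<in> Z" for j using that isomorphic_embeds by (auto simp: Z_def)
  have lez: "embeds (?y j) z" if "j \<in> Z" for j using that isomorphic_embeds isomorphic_sym[OF pz] by (auto simp: Z_def)
  show ?thesis
  proof (cases "finite Z")
    case False
    \<comment> \<open>\<open>Z - E\<close> is mapped into the smaller set \<open>ZX\<close>, so \<open>E\<close> is as large as \<open>Z\<close>\<close>
    have "\<exists>\<tau>. inj_on \<tau> Z \<and> \<tau> ` Z \<subseteq> E"
    proof (rule card_of_minus_small[OF False EZ(1)])
      fix \<tau> :: "'a \<Rightarrow> 'a" assume t: "inj_on \<tau> Z"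
      show "\<not> \<tau> ` Z \<subseteq> Z - E"
      proof
        assume "\<tau> ` Z \<subseteq> Z - E"
        then have "inj_on (\<phi> \<circ> \<tau>) Z" "(\<phi> \<circ> \<tau>) ` Z \<subseteq> ZX"
          using t \<phi>Z[of "\<tau> ` Z"] ZE by (auto intro!: comp_inj_on)
        then show False using noinj' by blast
      qed
    qed
    then obtain \<tau> where \<tau>: "inj_on \<tau> Z" "\<tau> ` Z \<subseteq> E" by blast
    obtain \<theta> where \<theta>: "inj_on \<theta> J" "\<theta> ` J \<subseteq> J - Z" "\<And>j. j \<in> Z \<Longrightarrow> \<theta> j = k (\<tau> j)"
        "\<And>j. j \<in> J - Z \<Longrightarrow> \<theta> j = j \<or> \<theta> j = k j"
      using absorbing_injection[OF kJ EZ exit \<tau>] by blast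
    have \<theta>_le: "embeds (?y j) (?y (\<theta> j))" if j: "j \<in> J" for j
    proof (cases "j \<in> Z")
      case True
      then have "\<tau> j \<in> Z" "\<tau> j \<in> J" using \<tau> EZ by auto
      then have "embeds (?y j) (?y (k (\<tau> j)))"
        using lez[OF True] zle k_le embeds_trans by blast
      then show ?thesis using \<theta>(3)[OF True] by simp
    next
      case False
      then show ?thesis using \<theta>(4)[of j] j k_le[of j] embeds_refl by auto
    qed
    \<comment> \<open>all of \<open>Z\<close> can be absorbed, so any finite number of its places may be kept\<close>
    obtain A where A: "\<And>n :: nat. A n \<subseteq> Z \<and> finite (A n) \<and> card (A n) = n"
      using infinite_arbitrarily_large[OF False] by metis
    define JJ where "JJ n = (J - Z) \<union> A n" for n
    define F where "F n = insert d (\<Union>j\<in>JJ n. block Y t' j)" for n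
    have JJ: "JJ n \<subseteq> kids Y d" for n using A EZ by (auto simp: JJ_def J_def)
    have bl: "block Y t' j \<subseteq> block Y t' j \<and> piece (rooted_block Y t' j)" if "j \<in> JJ n" for n j
      using kid_piece[OF Y] JJ that by blast
    have r: "decomposition (F n) (star (F n) d) t'" "kids (F n) d = JJ n"
      "\<And>j. j \<in> JJ n \<Longrightarrow> block (F n) t' j = block Y t' j" "F n \<subseteq> Y" "piece (F n, d)" for n
      by (rule restrict_star[OF Y JJ[of n] bl[where n = n] F_def[of n]]; assumption)+
    have "embeds (Y, d) (F n, d)" for n
    proof (rule glue_star_embeds[OF Y r(1)[of n], where \<sigma> = \<theta>])
      show "inj_on \<theta> (kids Y d)" using \<theta> by (simp add: J_def)
      show "\<theta> ` kids Y d \<subseteq> kids (F n) d"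
        using \<theta>(2) r(2)[of n] by (auto simp: JJ_def J_def)
      fix v assume v: "v \<in> kids Y d"
      then have "\<theta> v \<in> JJ n" using \<theta>(2) by (auto simp: JJ_def J_def)
      then show "embeds (?y v) (rooted_block (F n) t' (\<theta> v))" using r(3) \<theta>_le v by (simp add: J_def)
    qed
    moreover have "embeds (F n, d) (Y, d)" for n by (rule embeds_subset[OF r(4)])
    ultimately have eq: "equimorphic (Y, d) (F n, d)" for n by (simp add: equimorphic_def)
    have "{j \<in> kids (F n) d. isomorphic z (rooted_block (F n) t' j)} = A n" for n
    proof -
      have "{j \<in> kids (F n) d. isomorphic z (rooted_block (F n) t' j)} = {j \<in> JJ n. isomorphic z (?y j)}"
        using r(2)[of n] r(3) by auto
      also have "\<dots> = A n" using A[of n] JJ[of n] by (auto simp: JJ_def Z_def)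
      finally show ?thesis .
    qed
    then show ?thesis
      using A by (intro many_siblings_by_counting[OF r(1) r(5) eq, where z = z and b = 0]) simp
  next
    case True
    have "E \<noteq> {}" using noinj'[of \<phi>] \<phi>Z[of Z] ZE by auto
    then obtain e where e: "e \<in> E" by auto
    then have eJ: "e \<in> J" and eZ: "e \<in> Z" using EZ by auto
    define a where "a = (\<lambda>m. (k ^^ Suc m) e)"
    have aZ: "a m \<notin> Z" for m using exit[OF e] by (simp only: a_def not_False_eq_True)
    have aJ: "a m \<in> J" and za: "embeds z (?y (a m))" for m
      using kn[OF eJ, of "Suc m"] zle[OF eZ] embeds_trans unfolding a_def by blast+
    have ne: "(k ^^ Suc m) e \<noteq> e" for m using exit[OF e, of m] eZ by metis
    obtain \<theta> where \<theta>: "\<And>n. inj_on (\<theta> n) J" "\<And>n. \<theta> n ` J \<subseteq> J - a ` {..<n}"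
      "\<And>n j. j \<in> J \<Longrightarrow> \<theta> n j = j \<or> \<theta> n j = (k ^^ n) j" and inja: "inj a"
    proof -
      have "\<exists>\<theta>. inj_on \<theta> J \<and> \<theta> ` J \<subseteq> J - a ` {..<n} \<and> (\<forall>j\<in>J. \<theta> j = j \<or> \<theta> j = (k ^^ n) j) \<and> inj a" for n
        using freeing_injection[OF kJ eJ ne, of n] unfolding a_def by metis
      then show thesis using that by metis
    qed
    have "\<exists>W. W \<subseteq> block Y t' (a m) \<and> piece (W, a m) \<and> isomorphic z (W, a m)" for m
      using embeds_image[OF za pz] kid_piece[OF Y] aJ by (auto simp: J_def)
    then obtain V where V: "\<And>m. V m \<subseteq> block Y t' (a m) \<and> piece (V m, a m) \<and> isomorphic z (V m, a m)"
      by metis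
    \<comment> \<open>\<open>n\<close> additional copies of \<open>z\<close>, at the first \<open>n\<close> places of the orbit of \<open>e\<close>\<close>
    define W where "W n j = (if j \<in> a ` {..<n} then V (inv a j) else block Y t' j)" for n :: nat and j
    have Wa: "W n (a m) = V m" if "m < n" for n m
      using that inja by (auto simp: W_def)
    define F where "F n = insert d (\<Union>j\<in>J. W n j)" for n
    have W: "W n j \<subseteq> block Y t' j \<and> piece (W n j, j)" if "j \<in> J" for n j
    proof (cases "j \<in> a ` {..<n}")
      case True
      then obtain m where "m < n" "j = a m" by auto
      then show ?thesis using V[of m] Wa by simp
    next
      case False then show ?thesis using kid_piece[OF Y] that by (auto simp: W_def J_def)
    qed
    have r: "decomposition (F n) (star (F n) d) t'" "kids (F n) d = J"
      "\<And>j. j \<in> J \<Longrightarrow> block (F n) t' j = W n j" "F n \<subseteq> Y" "piece (F n, d)" for n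
      by (rule restrict_star[OF Y eq_refl[OF J_def] W[where n = n] F_def[of n]]; assumption)+
    have "embeds (Y, d) (F n, d)" for n
    proof (rule glue_star_embeds[OF Y r(1)[of n], where \<sigma> = "\<theta> n"])
      show "inj_on (\<theta> n) (kids Y d)" using \<theta> by (simp add: J_def)
      show "\<theta> n ` kids Y d \<subseteq> kids (F n) d"
        using \<theta>(2)[of n] r(2)[of n] by (auto simp: J_def)
      fix v assume v: "v \<in> kids Y d"
      then have "\<theta> n v \<in> J" "\<theta> n v \<notin> a ` {..<n}" using \<theta>(2)[of n] by (auto simp: J_def)
      then have "block (F n) t' (\<theta> n v) = block Y t' (\<theta> n v)" using r(3) by (simp add: W_def)
      moreover have "embeds (?y v) (?y (\<theta> n v))"
        using \<theta>(3)[of v n] v kn[of v n] embeds_refl by (auto simp: J_def)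
      ultimately show "embeds (?y v) (rooted_block (F n) t' (\<theta> n v))" by simp
    qed
    moreover have "embeds (F n, d) (Y, d)" for n by (rule embeds_subset[OF r(4)])
    ultimately have eq: "equimorphic (Y, d) (F n, d)" for n by (simp add: equimorphic_def)
    have "card {j \<in> kids (F n) d. isomorphic z (rooted_block (F n) t' j)} = card Z + n" for n
    proof -
      have "{j \<in> kids (F n) d. isomorphic z (rooted_block (F n) t' j)} = {j \<in> J. isomorphic z (W n j, j)}"
        using r(2)[of n] r(3) by auto
      also have "\<dots> = Z \<union> a ` {..<n}"
      proof (intro set_eqI)
        fix j
        show "j \<in> {j \<in> J. isomorphic z (W n j, j)} \<longleftrightarrow> j \<in> Z \<union> a ` {..<n}"
        proof (cases "j \<in> a ` {..<n}")
          case True then show ?thesis using V Wa aJ by auto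
        next
          case False then show ?thesis by (auto simp: W_def Z_def)
        qed
      qed
      also have "card \<dots> = card Z + card (a ` {..<n})"
        using True aZ by (intro card_Un_disjoint) auto
      also have "card (a ` {..<n}) = n" using inja by (simp add: card_image inj_on_subset)
      finally show ?thesis .
    qed
    then show ?thesis by (intro many_siblings_by_counting[OF r(1) r(5) eq, where z = z and b = "card Z"])
  qed
qed

lemma many_siblings_if_kid_many:
  assumes Y: "decomposition Y (star Y d) t" and j0: "j0 \<in> kids Y d" and m: "many_siblings (rooted_block Y t j0)"
  shows "many_siblings (Y, d)"
proof -
  have j0': "j0 \<in> star Y d" using j0 by (simp add: star_def)
  obtain W where W: "\<And>n r. r \<in> star Y d \<Longrightarrow> W n r \<subseteq> block Y t r \<and> piece (W n r, r) \<and> equimorphic (rooted_block Y t r) (W n r, r)"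
    and dist: "\<And>(n::nat) m s. s \<in> star Y d \<Longrightarrow> isomorphic (W n j0, j0) (W m s, s) \<Longrightarrow> n = m"
    using replace_blocks[OF Y j0' m] by blast
  define F where "F n = (\<Union>r\<in>star Y d. W n r)" for n
  have e: "decomposition (F n) (star Y d) t" "\<And>r. r \<in> star Y d \<Longrightarrow> block (F n) t r = W n r"
    "\<exists>f. emb f Y (F n) \<and> (\<forall>r\<in>star Y d. f r = r)" for n
    using replaced_blocks_embed[OF Y W[where n = n]] unfolding F_def by blast+
  have FY: "F n \<subseteq> Y" for n
    unfolding F_def
  proof (rule UN_least)
    fix r assume "r \<in> star Y d"
    then have "W n r \<subseteq> block Y t r" using W by simp
    then show "W n r \<subseteq> Y" by (auto simp: block_def)
  qed
  have inF: "r \<in> F n" if "r \<in> star Y d" for n r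
    using W[OF that, of n] that by (auto simp: F_def piece_def)
  have sF: "star (F n) d = star Y d" for n
    using FY[of n] inF[of _ n] by (auto simp: star_def kids_def)
  have d: "d \<in> star Y d" by (simp add: star_def)
  have eq: "equimorphic (Y, d) (F n, d)" for n
    using e(3)[of n] d embeds_subset[OF FY] by (auto simp: equimorphic_def embeds_def)
  have pc: "piece (F n, d)" for n
    using dec_conn[OF e(1)] W[OF d, of n] d by (auto simp: piece_def F_def)
  have "n = m" if isomorphic: "isomorphic (F n, d) (F m, d)" for n m
  proof -
    obtain f where f: "emb f (F n) (F m)" "f ` F n = F m" "f d = d" using isomorphic by (auto simp: isomorphic_def)
    have k: "j0 \<in> kids (F n) d" using inF[OF j0'] j0 by (simp add: kids_def)
    note s = split_star[OF e(1)[of n, folded sF[of n]] e(1)[of m, folded sF[of m]] f(1,3)]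
    have "f j0 \<in> star Y d" using s(2) k sF[of m] by (auto simp: star_def)
    then show ?thesis using s(5)[OF f(2) k] e(2)[OF j0', of n] e(2)[of "f j0" m] dist by auto
  qed
  then have "(\<forall>n. piece (F n, d) \<and> equimorphic (Y, d) (F n, d)) \<and>
      (\<forall>n m. isomorphic (F n, d) (F m, d) \<longrightarrow> n = m)"
    using pc eq by blast
  then show ?thesis unfolding many_siblings_def by (rule exI[where x = "\<lambda>n. (F n, d)"])
qed

text \<open>
  If every type were equally frequent at both roots, bijections between the places of each type would
  combine to an isomorphism.
\<close>

lemma many_siblings_if_not_iso:
  assumes X: "decomposition X (star X c) t" and Y: "decomposition Y (star Y d) t'"
    and eq: "equimorphic (X, c) (Y, d)" and niso: "\<not> isomorphic (X, c) (Y, d)"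
    and kX: "\<And>i. i \<in> kids X c \<Longrightarrow> unique_sibling (rooted_block X t i) \<or> many_siblings (rooted_block X t i)"
    and kY: "\<And>j. j \<in> kids Y d \<Longrightarrow> unique_sibling (rooted_block Y t' j) \<or> many_siblings (rooted_block Y t' j)"
  shows "many_siblings (Y, d)"
proof (rule ccontr)
  assume nY: "\<not> many_siblings (Y, d)"
  then have nX: "\<not> many_siblings (X, c)" using many_equimorphic eq by blast
  have oX: "unique_sibling (rooted_block X t i)" if "i \<in> kids X c" for i
    using kX[OF that] many_siblings_if_kid_many[OF X that] nX by blast
  have oY: "unique_sibling (rooted_block Y t' j)" if "j \<in> kids Y d" for j
    using kY[OF that] many_siblings_if_kid_many[OF Y that] nY by blast
  \<comment> \<open>the type of a subtree\<close>
  define cl where "cl p = {q. piece q \<and> isomorphic p q}" for p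
  have cl: "cl p = cl q \<longleftrightarrow> isomorphic p q" if "piece p" "piece q" for p q
  proof
    assume "cl p = cl q"
    then have "q \<in> cl p" using that isomorphic_refl by (auto simp: cl_def)
    then show "isomorphic p q" by (simp add: cl_def)
  next
    assume pq: "isomorphic p q"
    have "isomorphic p r \<longleftrightarrow> isomorphic q r" for r
      using isomorphic_trans[OF pq, of r] isomorphic_trans[OF isomorphic_sym[OF that(1) pq], of r] by blast
    then show "cl p = cl q" by (simp add: cl_def)
  qed
  have "\<exists>h. bij_betw h {i \<in> kids X c. cl (rooted_block X t i) = k} {j \<in> kids Y d. cl (rooted_block Y t' j) = k}" for k
  proof -
    let ?A = "{i \<in> kids X c. cl (rooted_block X t i) = k}" and ?B = "{j \<in> kids Y d. cl (rooted_block Y t' j) = k}"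
    have "\<exists>h. inj_on h ?B \<and> h ` ?B \<subseteq> ?A"
    proof (rule ccontr)
      assume no: "\<not> ?thesis"
      then have "?B \<noteq> {}" by force
      then obtain j0 where j0: "j0 \<in> kids Y d" "cl (rooted_block Y t' j0) = k" by auto
      have "?A = {i \<in> kids X c. isomorphic (rooted_block Y t' j0) (rooted_block X t i)}"
        "?B = {j \<in> kids Y d. isomorphic (rooted_block Y t' j0) (rooted_block Y t' j)}"
        unfolding j0(2)[symmetric] using cl[OF kid_piece[OF Y j0(1)] kid_piece[OF X]]
          cl[OF kid_piece[OF Y j0(1)] kid_piece[OF Y]] by auto
      then have "\<not> h ` {j \<in> kids Y d. isomorphic (rooted_block Y t' j0) (rooted_block Y t' j)}
          \<subseteq> {i \<in> kids X c. isomorphic (rooted_block Y t' j0) (rooted_block X t i)}"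
        if "inj_on h {j \<in> kids Y d. isomorphic (rooted_block Y t' j0) (rooted_block Y t' j)}" for h
        using that no by auto
      from many_siblings_if_fewer[OF X Y _ _ j0(1) refl oY[OF j0(1)] this] show False
        using eq nY by (simp add: equimorphic_def)
    qed
    moreover have "\<exists>h. inj_on h ?A \<and> h ` ?A \<subseteq> ?B"
    proof (rule ccontr)
      assume no: "\<not> ?thesis"
      then have "?A \<noteq> {}" by force
      then obtain i0 where i0: "i0 \<in> kids X c" "cl (rooted_block X t i0) = k" by auto
      have "?A = {i \<in> kids X c. isomorphic (rooted_block X t i0) (rooted_block X t i)}"
        "?B = {j \<in> kids Y d. isomorphic (rooted_block X t i0) (rooted_block Y t' j)}"
        unfolding i0(2)[symmetric] using cl[OF kid_piece[OF X i0(1)] kid_piece[OF X]]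
          cl[OF kid_piece[OF X i0(1)] kid_piece[OF Y]] by auto
      then have "\<not> h ` {i \<in> kids X c. isomorphic (rooted_block X t i0) (rooted_block X t i)}
          \<subseteq> {j \<in> kids Y d. isomorphic (rooted_block X t i0) (rooted_block Y t' j)}"
        if "inj_on h {i \<in> kids X c. isomorphic (rooted_block X t i0) (rooted_block X t i)}" for h
        using that no by auto
      from many_siblings_if_fewer[OF Y X _ _ i0(1) refl oX[OF i0(1)] this] show False
        using eq nX by (simp add: equimorphic_def)
    qed
    ultimately show ?thesis by (elim exE conjE) (rule Schroeder_Bernstein)
  qed
  then obtain \<sigma> where \<sigma>: "bij_betw \<sigma> (kids X c) (kids Y d)"
    "\<And>i. i \<in> kids X c \<Longrightarrow> cl (rooted_block Y t' (\<sigma> i)) = cl (rooted_block X t i)"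
    using bij_betw_fibres[of "kids X c" "\<lambda>i. cl (rooted_block X t i)" "kids Y d" "\<lambda>j. cl (rooted_block Y t' j)"] by blast
  have "isomorphic (X, c) (Y, d)"
  proof (rule glue_star_iso[OF X Y \<sigma>(1)])
    fix v assume v: "v \<in> kids X c"
    then have "\<sigma> v \<in> kids Y d" using \<sigma>(1) by (auto dest: bij_betwE)
    then show "isomorphic (rooted_block X t v) (rooted_block Y t' (\<sigma> v))"
      using cl[OF kid_piece[OF X v] kid_piece[OF Y], of "\<sigma> v"] \<sigma>(2)[OF v] by simp
  qed
  then show False using niso by simp
qed

text \<open>
  The rooted trees without a ray starting at the root.  Since they are introduced inductively, rule
  induction reaches trees of any ordinal height.
\<close>

inductive rayless :: "'a set \<Rightarrow> 'a \<Rightarrow> bool" where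
  "(\<And>v. v \<in> kids X c \<Longrightarrow> rayless (block X (proj (star X c)) v) v) \<Longrightarrow> rayless X c"

lemma piece_star_dec:
  assumes "piece (X, c)" shows "decomposition X (star X c) (proj (star X c))"
  using assms conn_star[of X c] by (intro dec_proj) (auto simp: piece_def star_def kids_def conn_def)

text \<open>
  The statement concerns all pieces embeddable in \<open>(X, c)\<close> because the siblings \<open>(Y, d)\<close> to be
  compared have subtrees that are not subtrees of \<open>(X, c)\<close>, but embed in such.
\<close>

theorem rooted_one_or_many:
  assumes "rayless X c" "piece (X, c)" "piece (Y, d)" "embeds (Y, d) (X, c)"
  shows "unique_sibling (Y, d) \<or> many_siblings (Y, d)"
  using assms
proof (induction X c arbitrary: Y d rule: rayless.induct)
  case (1 X c)
  let ?t = "\<lambda>X c. proj (star X c)"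
  note X = piece_star_dec[OF \<open>piece (X, c)\<close>]
  have kids: "unique_sibling (rooted_block Y (?t Y d) j) \<or> many_siblings (rooted_block Y (?t Y d) j)"
    if Y: "piece (Y, d)" and embeds: "embeds (Y, d) (X, c)" and j: "j \<in> kids Y d" for Y d j
  proof -
    obtain f where f: "emb f Y X" "f d = c" using embeds by (auto simp: embeds_def)
    note s = split_star[OF piece_star_dec[OF Y] X f]
    have "f j \<in> kids X c" using s(2) j by blast
    then show ?thesis
      using 1(2)[of "f j"] kid_piece[OF X] kid_piece[OF piece_star_dec[OF Y] j] s(3)[OF j] by blast
  qed
  show ?case
  proof (rule disjCI)
    assume "\<not> many_siblings (Y, d)"
    show "unique_sibling (Y, d)"
      unfolding unique_sibling_def
    proof (intro allI impI, elim conjE)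
      fix q assume q: "piece q" "equimorphic (Y, d) q"
      obtain Z e where Z: "q = (Z, e)" by (cases q)
      have "embeds (Z, e) (X, c)" 
        using q Z embeds_trans[OF _ \<open>embeds (Y, d) (X, c)\<close>] by (simp add: equimorphic_def)
      show "isomorphic (Y, d) q"
      proof (rule ccontr)
        assume "\<not> isomorphic (Y, d) q"
        then have "many_siblings (Z, e)"
          using q Z kids[OF 1(4,5)] kids[OF _ \<open>embeds (Z, e) (X, c)\<close>]
          by (intro many_siblings_if_not_iso[OF piece_star_dec[OF 1(4)] piece_star_dec]) auto
        then show False using \<open>\<not> many_siblings (Y, d)\<close> many_equimorphic equimorphic_sym q Z by blast
      qed
    qed
  qed
qed

text \<open>
  A tree that is not rayless has a subtree at the root that is not rayless either.  Descending
  for ever never turns back, as each subtree lacks the previous root.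
\<close>

lemma not_rayless_walk:
  assumes "\<not> rayless X c" "piece (X, c)"
  shows "\<exists>x. x 0 = c \<and> (\<forall>n :: nat. x n \<in> X \<and> adj T (x n) (x (Suc n)) \<and> x (Suc (Suc n)) \<noteq> x n)"
proof -
  let ?P = "\<lambda>p. \<not> rayless (fst p) (snd p) \<and> piece p \<and> fst p \<subseteq> X"
  let ?Q = "\<lambda>p q. adj T (snd p) (snd q) \<and> snd q \<in> fst p \<and> fst q \<subseteq> fst p - {snd p}"
  have "\<exists>s. \<forall>n. (?P (s n) \<and> (n = 0 \<longrightarrow> s n = (X, c))) \<and> ?Q (s n) (s (Suc n))"
  proof (rule dependent_nat_choice)
    show "\<exists>p. ?P p \<and> (0 = (0::nat) \<longrightarrow> p = (X, c))" using assms by (intro exI[of _ "(X, c)"]) auto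
    fix p and n :: nat assume p: "?P p \<and> (n = 0 \<longrightarrow> p = (X, c))"
    obtain Y d where Y: "p = (Y, d)" by (cases p)
    then have "\<not> rayless Y d" using p by simp
    then obtain v where v: "v \<in> kids Y d" "\<not> rayless (block Y (proj (star Y d)) v) v"
      using rayless.intros by blast
    have D: "decomposition Y (star Y d) (proj (star Y d))" using piece_star_dec p Y by simp
    have "piece (rooted_block Y (proj (star Y d)) v)" using kid_piece[OF D v(1)] .
    moreover have "block Y (proj (star Y d)) v \<subseteq> Y - {d}"
      using D v(1) adj_irrefl by (auto simp: block_def decomposition_def star_def kids_def)
    ultimately show "\<exists>q. (?P q \<and> (Suc n = 0 \<longrightarrow> q = (X, c))) \<and> ?Q p q"
      using v p Y by (intro exI[of _ "rooted_block Y (proj (star Y d)) v"]) (auto simp: kids_def)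
  qed
  then obtain s where s0: "\<forall>n. (?P (s n) \<and> (n = 0 \<longrightarrow> s n = (X, c))) \<and> ?Q (s n) (s (Suc n))" ..
  have s: "?P (s n)" "s 0 = (X, c)" "?Q (s n) (s (Suc n))" for n
    using s0[rule_format, of n] s0[rule_format, of 0] by simp_all
  have "snd (s n) \<in> X" for n using s(1)[of n] by (auto simp: piece_def)
  moreover have "snd (s (Suc (Suc n))) \<noteq> snd (s n)" for n
    using s(3)[of n] s(3)[of "Suc n"] by blast
  ultimately show ?thesis using s by (intro exI[of _ "\<lambda>n. snd (s n)"]) simp
qed

section \<open>Siblings as vertex sets\<close>

definition ind :: "'a set \<Rightarrow> 'a graph" where
  "ind X = \<lparr>verts = X, edges = {e \<in> edges T. e \<subseteq> X}\<rparr>"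

lemma verts_ind [simp]: "verts (ind X) = X"
  by (simp add: ind_def)

lemma adj_ind [simp]: "adj (ind X) = step X"
  by (auto simp: fun_eq_iff adj_def step_def ind_def)

lemma ind_V: "ind V = T"
proof -
  have "{e \<in> edges T. e \<subseteq> V} = edges T" using tree by (auto simp: tree_def simple_graph_def)
  then show ?thesis by (simp add: ind_def)
qed

lemma embedding_ind: "embedding f (ind X) (ind Y) \<longleftrightarrow> emb f X Y"
  by (auto simp: embedding_def emb_def step_def)

lemma isomorphism_ind:
  assumes "conn X" shows "isomorphism f (ind X) (ind Y) \<longleftrightarrow> emb f X Y \<and> f ` X = Y"
proof
  assume "isomorphism f (ind X) (ind Y)"
  then show "emb f X Y \<and> f ` X = Y"
    by (auto simp: isomorphism_def emb_def step_def bij_betw_def)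
next
  assume f: "emb f X Y \<and> f ` X = Y"
  then show "isomorphism f (ind X) (ind Y)"
    using emb_reflects_adj[OF assms, of f Y]
    by (auto simp: isomorphism_def step_def bij_betw_def emb_def)
qed

lemma tree_ind: assumes "conn X" shows "tree (ind X)"
proof -
  have "\<not> is_cycle (ind X) vs" for vs
  proof
    assume "is_cycle (ind X) vs"
    then have "is_cycle T vs"
      unfolding is_cycle_def adj_ind
      by (auto simp: step_def intro: successively_mono[of "step X"])
    then show False using tree by (auto simp: tree_def)
  qed
  moreover have "simple_graph (ind X)"
    using tree by (auto simp: tree_def simple_graph_def ind_def)
  moreover have "connected_graph (ind X)"
    using assms by (auto simp: connected_graph_def conn_def)
  ultimately show ?thesis by (simp add: tree_def)
qed

lemma embedded_tree:
  assumes S: "tree S" and g: "embedding g S (ind Y)" and Y: "Y \<subseteq> V"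
  shows "conn (g ` verts S)" "isomorphism g S (ind (g ` verts S))" "g ` verts S \<subseteq> Y"
proof -
  let ?X = "g ` verts S"
  have inj: "inj_on g (verts S)" and sub: "?X \<subseteq> Y"
    using g by (auto simp: embedding_def)
  have hom: "a \<in> verts S \<and> b \<in> verts S \<and> adj T (g a) (g b)" if "adj S a b" for a b
  proof -
    have "a \<in> verts S" "b \<in> verts S"
      using S that by (auto simp: tree_def simple_graph_def adj_def)
    then show ?thesis using g that by (auto simp: embedding_def step_def)
  qed
  have cS: "(adj S)\<^sup>*\<^sup>* u v" if "u \<in> verts S" "v \<in> verts S" for u v
    using S that by (auto simp: tree_def connected_graph_def)
  have "symp (adj S)" by (auto simp: symp_def adj_def insert_commute)
  then have "adj S u v" if "u \<in> verts S" "v \<in> verts S" "adj T (g u) (g v)" for u v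
    using hom_reflects_adj[of "adj S" u v g "verts S"] cS that inj hom by blast
  then have "adj S u v \<longleftrightarrow> step ?X (g u) (g v)" if "u \<in> verts S" "v \<in> verts S" for u v
    using that hom[of u v] unfolding step_def by blast
  then show "isomorphism g S (ind ?X)"
    using inj by (simp add: isomorphism_def bij_betw_def)
  have "(step ?X)\<^sup>*\<^sup>* (g u) (g v)" if "(adj S)\<^sup>*\<^sup>* u v" for u v
    using that by (rule rtranclp_map[rotated]) (auto simp: step_def dest: hom)
  moreover have "verts S \<noteq> {}" using S by (auto simp: tree_def connected_graph_def)
  ultimately show "conn ?X" using cS sub Y by (auto simp: conn_def)
  show "?X \<subseteq> Y" by (rule sub)
qed

lemma embedding_isomorphism_comp:
  assumes "embedding f S S'" "isomorphism g S' S''" shows "embedding (\<lambda>x. g (f x)) S S''"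
  using assms by (auto simp: embedding_def isomorphism_def bij_betw_def inj_on_def image_subset_iff)

lemma sibling_is_subset:
  assumes "S \<in> sibling_trees T"
  obtains X f g where "conn X" "emb f V X" "isomorphism g S (ind X)"
proof -
  have S: "tree S" using assms by (simp add: sibling_trees_def)
  obtain f g where f: "embedding f T S" and g: "embedding g S (ind V)"
    using assms by (auto simp: sibling_trees_def siblings_def ind_V)
  note e = embedded_tree[OF S g order_refl]
  have "embedding (\<lambda>x. g (f x)) (ind V) (ind (g ` verts S))"
    using embedding_isomorphism_comp[OF f e(2)] by (simp add: ind_V)
  then show thesis using that e by (simp add: embedding_ind)
qed

lemma subset_is_sibling:
  assumes "conn X" "emb f V X" shows "ind X \<in> sibling_trees T"
proof -
  have "emb (\<lambda>x. x) X V" using assms by (intro emb_id) (simp add: conn_def)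
  then have "siblings (ind V) (ind X)"
    using assms(2) unfolding siblings_def embedding_ind by blast
  then show ?thesis using tree_ind[OF assms(1)] by (simp add: sibling_trees_def ind_V)
qed

lemma Sib_infinite:
  assumes F: "\<And>n :: nat. conn (F n)" "\<And>n. \<exists>f. emb f V (F n)"
    and dist: "\<And>n m g. emb g (F n) (F m) \<Longrightarrow> g ` F n = F m \<Longrightarrow> n = m"
  shows "Sib T = \<infinity>"
proof -
  have "ind (F n) \<in> sibling_trees T" for n using F subset_is_sibling by blast
  then have "infinite (sibling_trees T // {(S, S'). S \<in> sibling_trees T \<and> S' \<in> sibling_trees T \<and>
      (\<exists>f. isomorphism f S S')})"
    using dist isomorphism_ind[OF F(1)]
    by (intro infinite_quotient[OF equiv_isomorphic, of "\<lambda>n. ind (F n)"]) auto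
  then show ?thesis by (simp add: Sib_def ecard_def)
qed

lemma Sib_one:
  assumes "\<And>X f. conn X \<Longrightarrow> emb f V X \<Longrightarrow> \<exists>g. emb g V X \<and> g ` V = X"
  shows "Sib T = 1"
  unfolding Sib_def
proof (rule card_quotient_one[OF equiv_isomorphic])
  show T: "T \<in> sibling_trees T"
    using subset_is_sibling[OF conn_V emb_id[OF order_refl]] by (simp add: ind_V)
  fix S assume S: "S \<in> sibling_trees T"
  then obtain X f g where X: "conn X" "emb f V X" "isomorphism g S (ind X)"
    by (rule sibling_is_subset)
  then obtain h where "emb h V X" "h ` V = X" using assms by blast
  then have "isomorphism h T (ind X)"
    using isomorphism_ind[OF conn_V] by (simp add: ind_V)
  then have "\<exists>f. isomorphism f T S"
    using isomorphism_comp[OF _ isomorphism_inv[OF X(3)]] by blast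
  then show "(T, S) \<in> {(S, S'). S \<in> sibling_trees T \<and> S' \<in> sibling_trees T \<and>
      (\<exists>f. isomorphism f S S')}"
    using T S by simp
qed

text \<open>
  Rooted siblings of a piece on arbitrary vertices are moved into it along their embeddings.
\<close>

lemma many_siblings_if_rooted_Sib_infinite:
  assumes p: "piece (B, r)" and inf: "rooted_Sib (ind B, r) = \<infinity>"
  shows "many_siblings (B, r)"
proof -
  let ?A = "sibling_rooted_trees (ind B, r)"
  let ?R = "{(S, S'). S \<in> ?A \<and> S' \<in> ?A \<and> (\<exists>f. rooted_isomorphism f S S')}"
  have BV: "B \<subseteq> V" using p by (simp add: piece_def conn_def)
  have "equiv ?A ?R"
    by (rule equiv_rooted_isomorphic) (simp add: sibling_rooted_trees_def)
  moreover have "infinite (?A // ?R)"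
    using inf by (auto simp: rooted_Sib_def ecard_def split: if_splits)
  ultimately have "\<exists>F :: nat \<Rightarrow> 'a graph \<times> 'a. (\<forall>n. F n \<in> ?A) \<and> (\<forall>n m. (F n, F m) \<in> ?R \<longrightarrow> n = m)"
    by (rule infinite_quotient_representatives)
  then obtain F :: "nat \<Rightarrow> 'a graph \<times> 'a"
    where "(\<forall>n. F n \<in> ?A) \<and> (\<forall>n m. (F n, F m) \<in> ?R \<longrightarrow> n = m)" ..
  then have F: "\<And>n. F n \<in> ?A" "\<And>n m. (F n, F m) \<in> ?R \<Longrightarrow> n = m" by blast+
  have "\<exists>X g. piece (X, r) \<and> equimorphic (B, r) (X, r) \<and> isomorphism g (fst (F n)) (ind X) \<and> g (snd (F n)) = r"
    for n
  proof -
    obtain S s where Fn: "F n = (S, s)" by (cases "F n")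
    then have S: "tree S" "s \<in> verts S"
      using F(1)[of n] by (auto simp: sibling_rooted_trees_def rooted_tree_def)
    obtain f g where f: "embedding f (ind B) S" "f r = s" and g: "embedding g S (ind B)" "g s = r"
      using F(1)[of n] Fn by (auto simp: sibling_rooted_trees_def rooted_siblings_def rooted_embedding_def)
    note e = embedded_tree[OF S(1) g(1) BV]
    have "embedding (\<lambda>x. g (f x)) (ind B) (ind (g ` verts S))"
      using embedding_isomorphism_comp[OF f(1) e(2)] by simp
    then have "embeds (B, r) (g ` verts S, r)"
      using f(2) g(2) by (auto simp: embedding_ind embeds_def)
    moreover have "embeds (g ` verts S, r) (B, r)" using e(3) by (rule embeds_subset)
    moreover have "piece (g ` verts S, r)" using e(1) S(2) g(2) by (auto simp: piece_def)
    ultimately show ?thesis using e(2) g(2) Fn by (auto simp: equimorphic_def)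
  qed
  then obtain X g where X: "\<And>n. piece (X n, r)" "\<And>n. equimorphic (B, r) (X n, r)"
    and g: "\<And>n. isomorphism (g n) (fst (F n)) (ind (X n))" "\<And>n. g n (snd (F n)) = r"
    by metis
  have "n = m" if XX: "isomorphic (X n, r) (X m, r)" for n m
  proof -
    obtain h where h: "emb h (X n) (X m)" "h ` X n = X m" "h r = r" using XX by (auto simp: isomorphic_def)
    have "isomorphism h (ind (X n)) (ind (X m))"
      using isomorphism_ind[of "X n" h "X m"] X(1)[of n] h by (simp add: piece_def)
    then have i: "isomorphism (\<lambda>x. inv_into (verts (fst (F m))) (g m) (h (g n x))) (fst (F n)) (fst (F m))"
      using isomorphism_comp[OF isomorphism_comp[OF g(1)[of n]] isomorphism_inv[OF g(1)[of m]]] by blast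
    have "snd (F m) \<in> verts (fst (F m))"
      using F(1)[of m] by (auto simp: sibling_rooted_trees_def rooted_tree_def split: prod.splits)
    then have "inv_into (verts (fst (F m))) (g m) r = snd (F m)"
      using g[of m] by (metis bij_betw_inv_into_left isomorphism_def)
    then have "\<exists>f. rooted_isomorphism f (F n) (F m)"
      using i g(2)[of n] h(3) by (auto simp: rooted_isomorphism_iff)
    then show "n = m" using F by blast
  qed
  then have "(\<forall>n. piece (X n, r) \<and> equimorphic (B, r) (X n, r)) \<and>
      (\<forall>n m. isomorphic (X n, r) (X m, r) \<longrightarrow> n = m)"
    using X by blast
  then show ?thesis unfolding many_siblings_def by (rule exI[where x = "\<lambda>n. (X n, r)"])
qed

text \<open>
  The assumption \<open>inv\<close> lets every isomorphism between the modified trees permute the blocks, so that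
  it detects the modification.
\<close>

lemma Sib_infinite_if_block_many:
  assumes C: "conn C" and r0: "r0 \<in> C" and many_siblings: "many_siblings (rooted_block V (proj C) r0)"
    and inv: "\<And>X Y f f' g. \<lbrakk>conn X; conn Y; C \<subseteq> X; C \<subseteq> Y; emb f V X; emb f' V Y; emb g X Y; g ` X = Y\<rbrakk>
      \<Longrightarrow> g ` C = C"
  shows "Sib T = \<infinity>"
proof -
  have D: "decomposition V C (proj C)" using C by (intro dec_proj conn_V) (auto simp: conn_def)
  obtain W where W: "\<And>n r. r \<in> C \<Longrightarrow> W n r \<subseteq> block V (proj C) r \<and> piece (W n r, r) \<and>
      equimorphic (rooted_block V (proj C) r) (W n r, r)"
    and dist: "\<And>(n::nat) m s. s \<in> C \<Longrightarrow> isomorphic (W n r0, r0) (W m s, s) \<Longrightarrow> n = m"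
    using replace_blocks[OF D r0 many_siblings] by blast
  define F where "F n = (\<Union>r\<in>C. W n r)" for n
  have e: "decomposition (F n) C (proj C)" "\<And>r. r \<in> C \<Longrightarrow> block (F n) (proj C) r = W n r"
    "\<exists>f. emb f V (F n) \<and> (\<forall>r\<in>C. f r = r)" for n
    using replaced_blocks_embed[OF D W[where n = n]] unfolding F_def by blast+
  have CF: "C \<subseteq> F n" for n using e(1)[of n] by (simp add: decomposition_def)
  show ?thesis
  proof (rule Sib_infinite)
    show cn: "conn (F n)" for n by (rule dec_conn[OF e(1)])
    show ex: "\<exists>f. emb f V (F n)" for n using e(3) by blast
    fix n m g assume g: "emb g (F n) (F m)" "g ` F n = F m"
    have gC: "g ` C = C" using inv[OF cn cn CF CF _ _ g] ex by blast
    have "v \<in> C" if "v \<in> F n" "g v \<in> C" for v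
    proof -
      obtain c where "c \<in> C" "g v = g c" using gC \<open>g v \<in> C\<close> by (metis imageE)
      then show ?thesis using g(1) CF that(1) by (auto simp: emb_def dest!: inj_onD)
    qed
    note sd = split_dec(2)[OF e(1) e(1) g(1) eq_refl[OF gC] this r0 g(2)]
    have "g r0 \<in> C" using gC r0 by blast
    then show "n = m" using sd e(2)[OF r0, of n] e(2)[of "g r0" m] dist by simp
  qed
qed

lemma conn_block_Int:
  assumes C: "conn C" and X: "conn X" "C \<subseteq> X" and r: "r \<in> C"
  shows "block X (proj C) r = X \<inter> block V (proj C) r" "piece (rooted_block X (proj C) r)"
  using X dec_piece[OF dec_proj[OF X(1) C X(2)] r] by (auto simp: block_def conn_def)

text \<open>
  Suppose that every block has a single sibling, and let \<open>f\<close> embed \<open>T\<close> in \<open>X\<close>.  It permutes the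
  finitely many points of \<open>C\<close> with non-trivial block, hence every such \<open>r\<close> returns to itself under
  some positive power of \<open>f\<close>.  This power embeds the block of \<open>T\<close> at \<open>r\<close> in the block of \<open>X\<close> at \<open>r\<close>.
  The two are therefore equimorphic, hence isomorphic, and the isomorphisms are glued along the
  identity of \<open>C\<close>.
\<close>

theorem one_or_infinite_if_invariant_centre:
  assumes C: "conn C" and inv: "\<And>f. emb f V V \<Longrightarrow> f ` C = C"
    and fin: "finite {r \<in> C. block V (proj C) r \<noteq> {r}}"
    and rayless: "\<And>r. r \<in> C \<Longrightarrow> rayless (block V (proj C) r) r"
  shows "Sib T = 1 \<or> Sib T = \<infinity>"
proof (cases "\<exists>r\<in>C. many_siblings (rooted_block V (proj C) r)")
  case True
  then obtain r where r: "r \<in> C" "many_siblings (rooted_block V (proj C) r)" by blast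
  have "g ` C = C" if "conn Y" "emb f V X" "emb g X Y" "conn X" for X Y f g
  proof -
    have XY: "X \<subseteq> V" "Y \<subseteq> V" using that by (auto simp: conn_def)
    have "emb f V V" using that(2) XY by (auto simp: emb_def)
    moreover have "emb (\<lambda>x. g (f x)) V V" using emb_comp[OF that(2,3)] XY by (auto simp: emb_def)
    ultimately have "f ` C = C" "(\<lambda>x. g (f x)) ` C = C" by (auto simp only: inv)
    then show ?thesis by (metis image_image)
  qed
  note centre = this
  have "Sib T = \<infinity>"
  proof (rule Sib_infinite_if_block_many[OF C r])
    fix X Y f f' g assume "conn X" "conn Y" "emb f V X" "emb g X Y"
    then show "g ` C = C" using centre by blast
  qed
  then show ?thesis ..
next
  case False
  have D: "decomposition V C (proj C)" using C by (intro dec_proj conn_V) (auto simp: conn_def)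
  have unique_sibling: "unique_sibling (rooted_block V (proj C) r)" if "r \<in> C" for r
    using rooted_one_or_many[OF rayless[OF that] dec_piece[OF D that] dec_piece[OF D that] embeds_refl] False that
    by blast
  have "Sib T = 1"
  proof (rule Sib_one)
    fix X f assume X: "conn X" and f: "emb f V X"
    have XV: "X \<subseteq> V" using X by (simp add: conn_def)
    have fV: "emb f V V" using f XV by (auto simp: emb_def)
    have fC: "f ` C = C" by (rule inv[OF fV])
    have CV: "C \<subseteq> V" using C by (simp add: conn_def)
    have CX: "C \<subseteq> X" using fC f CV by (auto simp: emb_def)
    have inj: "inj_on f V" using f by (simp add: emb_def)
    have DX: "decomposition X C (proj C)" by (rule dec_proj[OF X C CX])
    have fback: "v \<in> C" if "v \<in> V" "f v \<in> C" for v
    proof -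
      obtain c where "c \<in> C" "f v = f c" using fC \<open>f v \<in> C\<close> by (metis imageE)
      then show ?thesis using inj CV that(1) by (auto dest!: inj_onD)
    qed
    have down: "emb f (block V (proj C) r) (block X (proj C) (f r))" if "r \<in> C" for r
      by (rule split_dec(1)[OF D DX f eq_refl[OF fC] fback that])
    let ?N = "{r \<in> C. block V (proj C) r \<noteq> {r}}"
    have pow: "(f ^^ n) r \<in> C \<and> emb (f ^^ n) (block V (proj C) r) (block V (proj C) ((f ^^ n) r))"
      if "r \<in> C" for n r
      using that
    proof (induction n)
      case 0
      then show ?case using emb_id[OF order_refl] by (simp add: id_def)
    next
      case (Suc n)
      then have n: "(f ^^ n) r \<in> C" by simp
      have "emb f (block V (proj C) ((f ^^ n) r)) (block V (proj C) (f ((f ^^ n) r)))"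
        using down[OF n] XV by (auto simp: emb_def block_def)
      moreover have "emb (f ^^ n) (block V (proj C) r) (block V (proj C) ((f ^^ n) r))" using Suc by simp
      ultimately have "emb (\<lambda>x. f ((f ^^ n) x)) (block V (proj C) r) (block V (proj C) (f ((f ^^ n) r)))"
        by (rule emb_comp[rotated])
      moreover have "f ((f ^^ n) r) \<in> C" using fC n by blast
      ultimately show ?case by (simp add: comp_def)
    qed
    have fN: "f r \<in> ?N" if rN: "r \<in> ?N" for r
    proof -
      have r: "r \<in> C" using that by simp
      have fr: "f r \<in> C" using fC imageI[OF r, of f] by simp
      obtain v where v: "v \<in> block V (proj C) r" "v \<noteq> r" 
        using rN dec_blk[OF D r] by blast
      then have "f v \<in> block V (proj C) (f r)" using down[OF r] XV by (auto simp: emb_def block_def)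
      moreover have "f v \<noteq> f r" using inj v r CV by (auto simp: block_def dest: inj_onD)
      ultimately show ?thesis using fr by auto
    qed
    have embeds: "embeds (rooted_block V (proj C) r) (rooted_block X (proj C) r)" if r: "r \<in> C" for r
    proof (cases "r \<in> ?N")
      case False
      then have "block V (proj C) r = {r}" using r by simp
      then have "block X (proj C) r = {r}" using conn_block_Int(1)[OF C X CX r] r CX by auto
      then show ?thesis using \<open>block V (proj C) r = {r}\<close> embeds_refl by simp
    next
      case True
      obtain n where n: "(f ^^ Suc n) r = r"
      proof -
        have "(f ^^ k) r \<in> ?N" for k by (induction k) (use True fN in auto)
        then have "\<not> inj (\<lambda>k. (f ^^ k) r)"
          using fin finite_subset[of "range (\<lambda>k. (f ^^ k) r)" ?N] range_inj_infinite
          by (metis (no_types, lifting) image_subsetI)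
        then obtain i j where ij: "i < j" "(f ^^ i) r = (f ^^ j) r"
          unfolding inj_def by (metis linorder_neqE_nat)
        then obtain m where m: "j = i + Suc m" using less_imp_Suc_add by (metis add_Suc_right)
        have "inj_on (f ^^ i) V" using emb_funpow[OF fV, of i] by (simp add: emb_def)
        moreover have "(f ^^ i) r = (f ^^ i) ((f ^^ Suc m) r)" using ij m by (simp add: funpow_add funpow_swap1)
        moreover have "r \<in> V" "(f ^^ Suc m) r \<in> V" using r CV pow[OF r, of "Suc m"] by auto
        ultimately have "(f ^^ Suc m) r = r" by (metis inj_onD)
        then show thesis by (rule that)
      qed
      have n': "f ((f ^^ n) r) = r" using n by simp
      have p: "(f ^^ n) r \<in> C" "emb (f ^^ n) (block V (proj C) r) (block V (proj C) ((f ^^ n) r))"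
        using pow[OF r] by auto
      have "emb (\<lambda>x. f ((f ^^ n) x)) (block V (proj C) r) (block X (proj C) r)"
        using emb_comp[OF p(2) down[OF p(1)]] n' by simp
      then show ?thesis using n' by (auto simp: embeds_def)
    qed
    have isomorphic: "isomorphic (rooted_block V (proj C) r) (rooted_block X (proj C) r)" if r: "r \<in> C" for r
    proof -
      have "embeds (rooted_block X (proj C) r) (rooted_block V (proj C) r)"
        using conn_block_Int(1)[OF C X CX r] by (intro embeds_subset) auto
      then show ?thesis using unique_sibling[OF r] embeds[OF r] conn_block_Int(2)[OF C X CX r]
        by (auto simp: unique_sibling_def equimorphic_def)
    qed
    show "\<exists>g. emb g V X \<and> g ` V = X"
      by (rule glue_iso[OF D DX emb_id[OF order_refl]]) (use isomorphic in auto)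
  qed
  then show ?thesis ..
qed

section \<open>Pruning\<close>

text \<open>
  One step of deletion, on vertex sets.  The condition \<open>W \<subseteq> pruned W\<close> says that \<open>W\<close> induces a
  subgraph of minimum degree at least two; such a \<open>W\<close> survives all deletions.
\<close>

definition pruned :: "'a set \<Rightarrow> 'a set" where
  "pruned X = {v \<in> X. \<exists>a\<in>X. \<exists>b\<in>X. a \<noteq> b \<and> adj T v a \<and> adj T v b}"

lemma pruned_subset: "pruned X \<subseteq> X"
  by (auto simp: pruned_def)

lemma pruned_mono: "X \<subseteq> Y \<Longrightarrow> pruned X \<subseteq> pruned Y"
  unfolding pruned_def by blast

lemma pruned_iter_mono: "X \<subseteq> Y \<Longrightarrow> (pruned ^^ n) X \<subseteq> (pruned ^^ n) Y"
  by (induction n) (auto dest: pruned_mono)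

lemma pruned_iter_antimono: "n \<le> m \<Longrightarrow> (pruned ^^ m) X \<subseteq> (pruned ^^ n) X"
proof (induction m rule: dec_induct)
  case (step m) then show ?case using pruned_subset[of "(pruned ^^ m) X"] by simp
qed simp

lemma pruned_iter_subset: "(pruned ^^ n) X \<subseteq> X"
  using pruned_iter_antimono[of 0 n X] by simp

lemma pruned_iter_fixed:
  assumes "(pruned ^^ Suc i) X = (pruned ^^ i) X" "i \<le> j" shows "(pruned ^^ j) X = (pruned ^^ i) X"
  using assms(2) by (induction j rule: dec_induct) (use assms(1) in auto)

lemma thick_pruned_iter: "W \<subseteq> pruned W \<Longrightarrow> W \<subseteq> X \<Longrightarrow> W \<subseteq> (pruned ^^ n) X"
proof (induction n)
  case (Suc n)
  then have "pruned W \<subseteq> pruned ((pruned ^^ n) X)" by (intro pruned_mono) simp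
  then show ?case using Suc.prems by simp
qed simp

lemma pruned_emb:
  assumes "emb f X Y" "X' \<subseteq> X" shows "f ` pruned X' \<subseteq> pruned (f ` X')"
proof
  fix y assume "y \<in> f ` pruned X'"
  then obtain v a b where v: "y = f v" "v \<in> X'" "a \<in> X'" "b \<in> X'" "a \<noteq> b" "adj T v a" "adj T v b"
    by (auto simp: pruned_def)
  then have "f a \<noteq> f b" "adj T (f v) (f a)" "adj T (f v) (f b)"
    using assms unfolding emb_def by (blast dest: inj_onD)+
  then show "y \<in> pruned (f ` X')" using v unfolding pruned_def by blast
qed

lemma pruned_emb_eq:
  assumes "conn X" "emb f X Y" "X' \<subseteq> X" shows "pruned (f ` X') = f ` pruned X'"
proof
  show "pruned (f ` X') \<subseteq> f ` pruned X'"
  proof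
    fix y assume "y \<in> pruned (f ` X')"
    then obtain v a b where v: "y = f v" "v \<in> X'" "a \<in> X'" "b \<in> X'" "f a \<noteq> f b"
      "adj T (f v) (f a)" "adj T (f v) (f b)"
      by (auto simp: pruned_def)
    then have "adj T v a" "adj T v b"
      using emb_reflects_adj[OF assms(1,2), of v a] emb_reflects_adj[OF assms(1,2), of v b] assms(3)
      by (simp_all add: subset_iff)
    moreover have "a \<noteq> b" using v(5) by auto
    ultimately have "v \<in> pruned X'" using v(2-4) unfolding pruned_def by blast
    then show "y \<in> f ` pruned X'" using v(1) by simp
  qed
qed (rule pruned_emb[OF assms(2,3)])

lemma pruned_iter_emb_eq:
  assumes "conn X" "emb f X Y" shows "(pruned ^^ n) (f ` X) = f ` (pruned ^^ n) X"
  by (induction n) (use pruned_emb_eq[OF assms pruned_iter_subset] in auto)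

lemma rtrancl_path_interior:
  "rtrancl_path (step X) x xs y \<Longrightarrow> distinct (x # xs) \<Longrightarrow> v \<in> set xs \<Longrightarrow> v \<noteq> y \<Longrightarrow>
    \<exists>a\<in>set (x # xs). \<exists>b\<in>set (x # xs). a \<noteq> b \<and> adj T v a \<and> adj T v b"
proof (induction arbitrary: v rule: rtrancl_path.induct)
  case (step x y ys z)
  show ?case
  proof (cases "v = y")
    case True
    obtain w ws where w: "ys = w # ws" "step X y w"
      by (rule rtrancl_path.cases[OF step.hyps(2)]) (use step.prems True in auto)
    then show ?thesis
      using step.hyps(1) step.prems True adj_sym
      by (intro bexI[of _ x] bexI[of _ w]) (auto simp: step_def)
  next
    case False
    then have "v \<in> set ys" using step.prems by auto
    then show ?thesis using step.IH[of v] step.prems by auto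
  qed
qed simp

text \<open>
  Inner vertices of a path have two neighbours on the path, so the assumption \<open>convex\<close> applies to
  the vertex set \<open>P\<close> of a path between points of \<open>Y\<close>.  It holds for \<open>pruned X\<close> and for the core.
\<close>

lemma conn_if_convex:
  assumes X: "conn X" and Y: "Y \<subseteq> X" "Y \<noteq> {}"
    and convex: "\<And>P. P \<subseteq> X \<Longrightarrow>
      \<forall>v\<in>P. v \<in> Y \<or> (\<exists>a\<in>P. \<exists>b\<in>P. a \<noteq> b \<and> adj T v a \<and> adj T v b) \<Longrightarrow> P \<subseteq> Y"
  shows "conn Y"
proof -
  have "(step Y)\<^sup>*\<^sup>* u v" if uv: "u \<in> Y" "v \<in> Y" for u v
  proof -
    have "(step X)\<^sup>*\<^sup>* u v" using X Y uv by (auto simp: conn_def)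
    then obtain xs where xs: "rtrancl_path (step X) u xs v" "distinct (u # xs)"
      by (rule rtranclp_distinct_path)
    have "set xs \<subseteq> X"
      using xs(1) by (induction rule: rtrancl_path.induct) (auto simp: step_def)
    then have "set (u # xs) \<subseteq> X" using uv(1) Y(1) by auto
    then have "set (u # xs) \<subseteq> Y"
    proof (rule convex)
      show "\<forall>w\<in>set (u # xs). w \<in> Y \<or> (\<exists>a\<in>set (u # xs). \<exists>b\<in>set (u # xs). a \<noteq> b \<and> adj T w a \<and> adj T w b)"
        using rtrancl_path_interior[OF xs] uv by auto
    qed
    then show ?thesis
      by (intro mono_rtranclp[THEN mp, rotated, OF rtrancl_path_imp_rtranclp_on[OF xs(1)]])
        (auto simp: step_def)
  qed
  then show ?thesis using X Y by (auto simp: conn_def)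
qed

lemma conn_pruned: "conn X \<Longrightarrow> pruned X \<noteq> {} \<Longrightarrow> conn (pruned X)"
proof (rule conn_if_convex[OF _ pruned_subset])
  fix P assume "P \<subseteq> X" "\<forall>v\<in>P. v \<in> pruned X \<or> (\<exists>a\<in>P. \<exists>b\<in>P. a \<noteq> b \<and> adj T v a \<and> adj T v b)"
  then show "P \<subseteq> pruned X" unfolding pruned_def by blast
qed

lemma conn_pruned_iter: "conn X \<Longrightarrow> (pruned ^^ n) X \<noteq> {} \<Longrightarrow> conn ((pruned ^^ n) X)"
proof (induction n)
  case (Suc n)
  then have "(pruned ^^ n) X \<noteq> {}" using pruned_subset by fastforce
  then show ?case using Suc conn_pruned by auto
qed simp

lemma prune_ind: assumes "X \<subseteq> V" shows "prune (ind X) = ind (pruned X)"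
proof -
  have "degree (ind X) v \<le> 1 \<longleftrightarrow> v \<notin> pruned X" if "v \<in> X" for v
    using that unfolding degree_def ecard_le_one by (auto simp: step_def pruned_def)
  then have v: "X - {v \<in> X. degree (ind X) v \<le> 1} = pruned X"
    using pruned_subset by blast
  show ?thesis using pruned_subset[of X] unfolding prune_def delete_verts_def verts_ind v
    by (auto simp: ind_def)
qed

definition stage_verts :: "'a ordinal \<Rightarrow> 'a set" where
  "stage_verts \<alpha> = verts (stage T \<alpha>)"

text \<open>
  The last conjunct, carried through the transfinite induction, makes the core the greatest set that
  induces minimum degree at least two.
\<close>

lemma stage_ind:
  fixes \<alpha> :: "'a ordinal"
  shows "stage T \<alpha> = ind (stage_verts \<alpha>) \<and> stage_verts \<alpha> \<subseteq> V \<and>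
    (\<forall>W. W \<subseteq> V \<longrightarrow> W \<subseteq> pruned W \<longrightarrow> W \<subseteq> stage_verts \<alpha>)"
proof (induction \<alpha> rule: less_induct)
  case (less \<alpha>)
  consider "\<And>\<beta>. \<alpha> \<le> \<beta>" | \<gamma> where "is_succ \<gamma> \<alpha>" | \<beta> where "\<beta> < \<alpha>" "\<And>\<gamma>. \<not> is_succ \<gamma> \<alpha>"
    by (meson leI)
  then show ?case
  proof cases
    case 1
    then have "stage T \<alpha> = T" by (rule stage_zero)
    then show ?thesis by (simp add: ind_V stage_verts_def)
  next
    case 2
    then have g: "stage T \<gamma> = ind (stage_verts \<gamma>)" "stage_verts \<gamma> \<subseteq> V"
      "\<And>W. W \<subseteq> V \<Longrightarrow> W \<subseteq> pruned W \<Longrightarrow> W \<subseteq> stage_verts \<gamma>"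
      using less.IH[of \<gamma>] by (auto simp: is_succ_def)
    have s: "stage T \<alpha> = ind (pruned (stage_verts \<gamma>))"
      using stage_succ[OF 2, of T] g prune_ind by simp
    then have "stage_verts \<alpha> = pruned (stage_verts \<gamma>)" by (simp add: stage_verts_def)
    moreover have "W \<subseteq> pruned (stage_verts \<gamma>)" if "W \<subseteq> V" "W \<subseteq> pruned W" for W
      using pruned_mono[OF g(3)[OF that]] that by blast
    moreover have "pruned (stage_verts \<gamma>) \<subseteq> V" using g(2) pruned_subset by blast
    ultimately show ?thesis using s by simp
  next
    case 3
    have IH: "stage T \<gamma> = ind (stage_verts \<gamma>)" "stage_verts \<gamma> \<subseteq> V"
      "\<And>W. W \<subseteq> V \<Longrightarrow> W \<subseteq> pruned W \<Longrightarrow> W \<subseteq> stage_verts \<gamma>" if "\<gamma> < \<alpha>" for \<gamma>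
      using less.IH[OF that] by auto
    note st = stage_limit[OF 3, of T]
    have v: "stage_verts \<alpha> = (\<Inter>\<beta>\<in>{..<\<alpha>}. stage_verts \<beta>)"
      by (simp add: stage_verts_def st)
    have e: "edges (stage T \<gamma>) = {e \<in> edges T. e \<subseteq> stage_verts \<gamma>}" if "\<gamma> < \<alpha>" for \<gamma>
      using IH(1)[OF that] by (simp add: ind_def)
    have "(\<Inter>\<beta>\<in>{..<\<alpha>}. edges (stage T \<beta>)) = {e \<in> edges T. e \<subseteq> stage_verts \<alpha>}"
      unfolding v using 3(1) e by (fastforce simp: subset_iff)
    then have "stage T \<alpha> = ind (stage_verts \<alpha>)"
      using st by (simp add: ind_def stage_verts_def)
    moreover have "stage_verts \<alpha> \<subseteq> V" using v IH(2)[OF 3(1)] 3(1) by blast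
    moreover have "W \<subseteq> stage_verts \<alpha>" if "W \<subseteq> V" "W \<subseteq> pruned W" for W
      unfolding v using IH(3) that by blast
    ultimately show ?thesis by blast
  qed
qed

definition core_verts :: "'a set" where
  "core_verts = verts (core T)"

lemma core_ind: "core T = ind core_verts"
  using stage_ind[of "rank T"] by (simp add: core_def core_verts_def stage_verts_def)

lemma core_greatest: "W \<subseteq> V \<Longrightarrow> W \<subseteq> pruned W \<Longrightarrow> W \<subseteq> core_verts"
  using stage_ind[of "rank T"] by (simp add: core_def core_verts_def stage_verts_def)

lemma core_verts_subset: "core_verts \<subseteq> V"
  using stage_ind[of "rank T"] by (simp add: core_def core_verts_def stage_verts_def)

lemma pruned_core: "pruned core_verts = core_verts"
proof -
  have "simple_graph T" using tree by (simp add: tree_def)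
  then have "stage T (osucc (rank T)) = core T"
    unfolding core_def rank_def by (rule LeastI_ex[OF rank_exists])
  moreover have "stage T (osucc (rank T)) = prune (core T)"
    unfolding core_def by (rule stage_succ[OF is_succ_osucc])
  ultimately have "ind core_verts = ind (pruned core_verts)"
    using prune_ind[OF core_verts_subset] core_ind by simp
  then show ?thesis by (metis verts_ind)
qed

text \<open>
  Vertices already known to be in the core may have small degree in \<open>W\<close>: the union of \<open>W\<close> and the core
  induces minimum degree at least two.
\<close>

lemma thick_subset_core: "W \<subseteq> V \<Longrightarrow> (\<And>v. v \<in> W \<Longrightarrow> v \<in> pruned W \<or> v \<in> core_verts) \<Longrightarrow> W \<subseteq> core_verts"
proof -
  assume W: "W \<subseteq> V" "\<And>v. v \<in> W \<Longrightarrow> v \<in> pruned W \<or> v \<in> core_verts"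
  have "W \<union> core_verts \<subseteq> pruned (W \<union> core_verts)"
    using W(2) pruned_mono[of W "W \<union> core_verts"] pruned_mono[of core_verts "W \<union> core_verts"] pruned_core
    by blast
  then show ?thesis using core_greatest[of "W \<union> core_verts"] W(1) core_verts_subset by blast
qed

lemma conn_core: "core_verts \<noteq> {} \<Longrightarrow> conn core_verts"
proof (rule conn_if_convex[OF conn_V core_verts_subset])
  fix P assume "P \<subseteq> V" "\<forall>v\<in>P. v \<in> core_verts \<or> (\<exists>a\<in>P. \<exists>b\<in>P. a \<noteq> b \<and> adj T v a \<and> adj T v b)"
  then show "P \<subseteq> core_verts" by (intro thick_subset_core) (auto simp: pruned_def)
qed

lemma emb_core: "emb f X V \<Longrightarrow> core_verts \<subseteq> X \<Longrightarrow> f ` core_verts \<subseteq> core_verts"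
  using pruned_emb[of f X V core_verts] pruned_core unfolding emb_def
  by (intro core_greatest) (blast, simp add: emb_def)

section \<open>Walks that do not turn back\<close>

text \<open>
  In a tree, these walks are the rays.  By the condition, each vertex but the first has two
  neighbours on the walk.
\<close>

definition nonbacktracking :: "(nat \<Rightarrow> 'a) \<Rightarrow> bool" where
  "nonbacktracking x \<longleftrightarrow> (\<forall>n. adj T (x n) (x (Suc n)) \<and> x (Suc (Suc n)) \<noteq> x n)"

lemma nonbacktracking_V: "nonbacktracking x \<Longrightarrow> x n \<in> V"
  using adj_verts by (auto simp: nonbacktracking_def)

lemma nonbacktracking_pruned: "nonbacktracking x \<Longrightarrow> {x n, x (Suc (Suc n))} \<subseteq> X \<Longrightarrow> x (Suc n) \<in> X \<Longrightarrow> x (Suc n) \<in> pruned X"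
  unfolding nonbacktracking_def pruned_def using adj_sym by blast

lemma nonbacktracking_in_core: assumes x: "nonbacktracking x" and x0: "x 0 \<in> core_verts" shows "x n \<in> core_verts"
proof -
  have "range x \<subseteq> core_verts"
  proof (rule thick_subset_core)
    show "range x \<subseteq> V" using nonbacktracking_V[OF x] by auto
    fix v assume "v \<in> range x"
    then obtain m where "v = x m" by auto
    then show "v \<in> pruned (range x) \<or> v \<in> core_verts"
      using x0 nonbacktracking_pruned[OF x, of "m - 1" "range x"] by (cases m) auto
  qed
  then show ?thesis by auto
qed

lemma nonbacktracking_pruned_iter: assumes x: "nonbacktracking x" shows "k \<le> n \<Longrightarrow> x n \<in> (pruned ^^ k) V"
proof (induction k arbitrary: n)
  case 0 then show ?case using nonbacktracking_V[OF x] by simp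
next
  case (Suc k)
  then obtain m where m: "n = Suc m" "k \<le> m" by (cases n) auto
  then show ?case using Suc.IH nonbacktracking_pruned[OF x, of m "(pruned ^^ k) V"] by simp
qed

lemma nonbacktracking_exists:
  assumes C: "C \<subseteq> pruned C" and ab: "a \<in> C" "b \<in> C" "adj T a b"
  obtains x where "nonbacktracking x" "x 0 = a" "x 1 = b" "\<And>n. x n \<in> C"
proof -
  have "\<exists>s. \<forall>n. ((fst (s n) \<in> C \<and> snd (s n) \<in> C \<and> adj T (fst (s n)) (snd (s n))) \<and>
      (n = 0 \<longrightarrow> s n = (a, b))) \<and> fst (s (Suc n)) = snd (s n) \<and> snd (s (Suc n)) \<noteq> fst (s n)"
  proof (rule dependent_nat_choice)
    show "\<exists>p. (fst p \<in> C \<and> snd p \<in> C \<and> adj T (fst p) (snd p)) \<and> (0 = (0::nat) \<longrightarrow> p = (a, b))"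
      using ab by (intro exI[of _ "(a, b)"]) auto
    fix p and n :: nat
    assume p: "(fst p \<in> C \<and> snd p \<in> C \<and> adj T (fst p) (snd p)) \<and> (n = 0 \<longrightarrow> p = (a, b))"
    then have "snd p \<in> pruned C" using C by auto
    then obtain w where "w \<in> C" "adj T (snd p) w" "w \<noteq> fst p" unfolding pruned_def by blast
    then show "\<exists>q. ((fst q \<in> C \<and> snd q \<in> C \<and> adj T (fst q) (snd q)) \<and> (Suc n = 0 \<longrightarrow> q = (a, b))) \<and>
        fst q = snd p \<and> snd q \<noteq> fst p"
      using p by (intro exI[of _ "(snd p, w)"]) auto
  qed
  then obtain s where s: "\<And>n. fst (s n) \<in> C" "\<And>n. adj T (fst (s n)) (snd (s n))" "s 0 = (a, b)"
    "\<And>n. fst (s (Suc n)) = snd (s n)" "\<And>n. snd (s (Suc n)) \<noteq> fst (s n)"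
    by metis
  have "nonbacktracking (\<lambda>n. fst (s n))" using s by (auto simp: nonbacktracking_def)
  then show thesis using that[of "\<lambda>n. fst (s n)"] s by simp
qed

lemma rayless_block_if_no_walk:
  assumes C: "conn C" and r: "r \<in> C"
    and no: "\<And>x. nonbacktracking x \<Longrightarrow> x 0 = r \<Longrightarrow> (\<And>n. x n \<in> block V (proj C) r) \<Longrightarrow> False"
  shows "rayless (block V (proj C) r) r"
proof (rule ccontr)
  assume n: "\<not> ?thesis"
  have "decomposition V C (proj C)" using C by (intro dec_proj conn_V) (auto simp: conn_def)
  then have "piece (rooted_block V (proj C) r)" using r by (rule dec_piece)
  then show False using not_rayless_walk[OF n] no unfolding nonbacktracking_def by blast
qed

text \<open>
  A ray that starts in the core stays in the core, but a block meets the core only in its root.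
\<close>

lemma rayless_core_block:
  assumes "r \<in> core_verts" shows "rayless (block V (proj core_verts) r) r"
proof -
  have C: "conn core_verts" using assms conn_core by blast
  have "decomposition V core_verts (proj core_verts)" using C by (intro dec_proj conn_V core_verts_subset)
  then have i: "block V (proj core_verts) r \<inter> core_verts = {r}" using assms by (rule dec_blk_Int)
  show ?thesis
  proof (rule rayless_block_if_no_walk[OF C assms])
    fix x assume x: "nonbacktracking x" "x 0 = r" "\<And>n. x n \<in> block V (proj core_verts) r"
    then have "x 1 \<in> core_verts" using nonbacktracking_in_core assms by auto
    then have "x 1 = x 0" using x(2,3) i by auto
    then show False using x(1) adj_irrefl by (metis One_nat_def nonbacktracking_def)
  qed
qed

section \<open>Leafy branches are blocks of the core\<close>

text \<open>
  Every edge of \<open>H\<close> is off the core, hence its ends have the same nearest point in the core.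
\<close>

lemma core_disjoint_subtree_in_block:
  assumes C: "core_verts \<noteq> {}" and H: "core_disjoint_subtree T H"
  obtains r where "r \<in> core_verts" "subgraph H (ind (block V (proj core_verts) r))"
proof -
  have cn: "conn core_verts" using C by (rule conn_core)
  have HT: "verts H \<subseteq> V" "edges H \<subseteq> edges T" "tree H" "edges H \<inter> edges (core T) = {}"
    using H by (auto simp: core_disjoint_subtree_def subgraph_def)
  have he: "e \<subseteq> verts H" if "e \<in> edges H" for e using HT(3) that by (auto simp: tree_def simple_graph_def)
  have same: "proj core_verts u = proj core_verts v" if uv: "adj H u v" for u v
  proof -
    have "adj T u v" using uv HT(2) by (auto simp: adj_def)
    moreover have "\<not> (u \<in> core_verts \<and> v \<in> core_verts)"
      using uv HT(2,4) by (auto simp: core_ind ind_def adj_def)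
    ultimately show ?thesis using proj_adj[OF cn] by blast
  qed
  have wk: "proj core_verts u = proj core_verts v" if "(adj H)\<^sup>*\<^sup>* u v" for u v
    using that by (induction rule: rtranclp_induct) (auto dest: same)
  obtain u where u: "u \<in> verts H" using HT(3) by (auto simp: tree_def connected_graph_def)
  let ?r = "proj core_verts u"
  have "verts H \<subseteq> block V (proj core_verts) ?r"
    using HT(1,3) wk u by (fastforce simp: block_def tree_def connected_graph_def)
  then have "subgraph H (ind (block V (proj core_verts) ?r))"
    using HT(2) he by (force simp: subgraph_def ind_def)
  moreover have "?r \<in> core_verts" using proj_exists[OF cn] u HT(1) by blast
  ultimately show thesis by (rule that[rotated])
qed

lemma block_core_disjoint:
  assumes r: "r \<in> core_verts" and nt: "block V (proj core_verts) r \<noteq> {r}"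
  shows "core_disjoint_subtree T (ind (block V (proj core_verts) r))"
proof -
  let ?B = "block V (proj core_verts) r"
  have cn: "conn core_verts" using r conn_core by blast
  have D: "decomposition V core_verts (proj core_verts)" using cn by (intro dec_proj conn_V core_verts_subset)
  have B: "conn ?B" "r \<in> ?B" "?B \<inter> core_verts = {r}"
    using D r dec_blk[OF D r] dec_blk_Int[OF D r] by (auto simp: decomposition_def)
  have "False" if e: "e \<in> edges T" "e \<subseteq> ?B" "e \<subseteq> core_verts" for e
  proof -
    have "e \<subseteq> {r}" using e B(3) by blast
    moreover have "card e = 2" using e(1) tree by (auto simp: tree_def simple_graph_def)
    ultimately show False using card_mono[of "{r}" e] by simp
  qed
  then have "edges (ind ?B) \<inter> edges (core T) = {}" by (auto simp: core_ind ind_def)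
  moreover have "subgraph (ind ?B) T" by (auto simp: subgraph_def ind_def block_def)
  moreover have "\<exists>u\<in>?B. \<exists>v\<in>?B. u \<noteq> v" using B(2) nt by blast
  ultimately show ?thesis using tree_ind[OF B(1)] by (simp add: core_disjoint_subtree_def)
qed

lemma subgraph_antisym: "subgraph G H \<Longrightarrow> subgraph H G \<Longrightarrow> G = (H :: 'b graph)"
  by (cases G; cases H) (auto simp: subgraph_def)

lemma leafy_branch_iff_block:
  assumes C: "core_verts \<noteq> {}"
  shows "leafy_branch T H \<longleftrightarrow>
    (\<exists>r\<in>core_verts. block V (proj core_verts) r \<noteq> {r} \<and> H = ind (block V (proj core_verts) r))"
proof
  let ?B = "\<lambda>r. block V (proj core_verts) r"
  have D: "decomposition V core_verts (proj core_verts)"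
    using conn_core[OF C] by (intro dec_proj conn_V core_verts_subset)
  {
    assume H: "leafy_branch T H"
    then have Hd: "core_disjoint_subtree T H" by (simp add: leafy_branch_def)
    then obtain r where r: "r \<in> core_verts" "subgraph H (ind (?B r))"
      by (rule core_disjoint_subtree_in_block[OF C])
    have "verts H \<subseteq> ?B r" using r(2) by (simp add: subgraph_def)
    moreover obtain u v where "u \<in> verts H" "v \<in> verts H" "u \<noteq> v"
      using Hd by (auto simp: core_disjoint_subtree_def)
    ultimately have "u \<in> ?B r" "v \<in> ?B r" "u \<noteq> v" by auto
    then have "?B r \<noteq> {r}" by auto
    moreover from this have "ind (?B r) = H"
      using H block_core_disjoint[OF r(1)] r(2) by (auto simp: leafy_branch_def)
    ultimately show "\<exists>r\<in>core_verts. ?B r \<noteq> {r} \<and> H = ind (?B r)" using r(1) by auto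
  }
  assume "\<exists>r\<in>core_verts. ?B r \<noteq> {r} \<and> H = ind (?B r)"
  then obtain r where r: "r \<in> core_verts" "?B r \<noteq> {r}" "H = ind (?B r)" by blast
  have "H' = H" if H': "core_disjoint_subtree T H'" "subgraph H H'" for H'
  proof -
    obtain s where s: "s \<in> core_verts" "subgraph H' (ind (?B s))"
      using core_disjoint_subtree_in_block[OF C H'(1)] .
    have "?B r \<subseteq> ?B s" using H'(2) s(2) r(3) by (auto simp: subgraph_def)
    then have "r = s" using dec_blk[OF D r(1)] dec_blk_Int[OF D s(1)] r(1) by auto
    then show ?thesis using H'(2) s(2) r(3) by (auto intro: subgraph_antisym)
  qed
  then show "leafy_branch T H"
    using r block_core_disjoint[OF r(1,2)] C by (auto simp: leafy_branch_def core_verts_def)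
qed

lemma finite_nontrivial_blocks:
  assumes "core_verts \<noteq> {}" "finite {H. leafy_branch T H}"
  shows "finite {r \<in> core_verts. block V (proj core_verts) r \<noteq> {r}}"
proof (rule finite_imageD)
  let ?N = "{r \<in> core_verts. block V (proj core_verts) r \<noteq> {r}}"
  have D: "decomposition V core_verts (proj core_verts)"
    using conn_core[OF assms(1)] by (intro dec_proj conn_V core_verts_subset)
  have "(\<lambda>r. ind (block V (proj core_verts) r)) ` ?N \<subseteq> {H. leafy_branch T H}"
    using leafy_branch_iff_block[OF assms(1)] by auto
  then show "finite ((\<lambda>r. ind (block V (proj core_verts) r)) ` ?N)"
    using assms(2) by (rule finite_subset)
  show "inj_on (\<lambda>r. ind (block V (proj core_verts) r)) ?N"
  proof (rule inj_onI)
    fix r s assume rs: "r \<in> ?N" "s \<in> ?N"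
      "ind (block V (proj core_verts) r) = ind (block V (proj core_verts) s)"
    then have "block V (proj core_verts) r = block V (proj core_verts) s" by (metis verts_ind)
    then have "{r} = {s}" using dec_blk_Int[OF D] rs by (metis (no_types, lifting) mem_Collect_eq)
    then show "r = s" by simp
  qed
qed

text \<open>
  An isomorphism and its inverse preserve sets inducing minimum degree at least two, so they map the
  core into itself.
\<close>

theorem Sib_infinite_if_leafy_branch_infinite:
  assumes H: "rooted_leafy_branch T (H, r)" and inf: "rooted_Sib (H, r) = \<infinity>"
  shows "Sib T = \<infinity>"
proof -
  have lb: "leafy_branch T H" "verts H \<inter> core_verts = {r}"
    using H by (auto simp: rooted_leafy_branch_def core_verts_def)
  then have C: "core_verts \<noteq> {}" by (auto simp: leafy_branch_def core_verts_def)
  have cn: "conn core_verts" by (rule conn_core[OF C])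
  have D: "decomposition V core_verts (proj core_verts)" using cn by (intro dec_proj conn_V core_verts_subset)
  obtain s where s: "s \<in> core_verts" "H = ind (block V (proj core_verts) s)"
    using lb(1) leafy_branch_iff_block[OF C] by blast
  then have sr: "s = r" using lb(2) dec_blk_Int[OF D s(1)] by simp
  have m: "many_siblings (rooted_block V (proj core_verts) r)"
    using many_siblings_if_rooted_Sib_infinite[OF dec_piece[OF D s(1)]] inf s sr by simp
  show ?thesis
  proof (rule Sib_infinite_if_block_many[OF cn _ m])
    show "r \<in> core_verts" using s sr by simp
    fix X Y f f' g
    assume X: "conn X" "conn Y" "core_verts \<subseteq> X" "core_verts \<subseteq> Y" and g: "emb g X Y" "g ` X = Y"
    have XV: "X \<subseteq> V" "Y \<subseteq> V" using X by (auto simp: conn_def)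
    have i: "emb (inv_into X g) Y X" by (rule emb_inv[OF X(1) g])
    have "g ` core_verts \<subseteq> core_verts" using g XV X by (intro emb_core[of g X]) (auto simp: emb_def)
    moreover have "inv_into X g ` core_verts \<subseteq> core_verts"
      using i XV X by (intro emb_core[of _ Y]) (auto simp: emb_def)
    then have "core_verts \<subseteq> g ` core_verts"
      using X(4) g(2) by (auto simp: image_subset_iff) (metis f_inv_into_f imageI subsetD)
    ultimately show "g ` core_verts = core_verts" by blast
  qed
qed

section \<open>Finite rank\<close>

lemma stage_verts_finite:
  fixes \<alpha> :: "'a ordinal"
  assumes "finite {..<\<alpha>}" shows "stage_verts \<alpha> = (pruned ^^ card {..<\<alpha>}) V"
  using assms
proof (induction \<alpha> rule: less_induct)
  case (less \<alpha>)
  show ?case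
  proof (cases "{..<\<alpha>} = {}")
    case True
    then have "\<And>\<beta>. \<alpha> \<le> \<beta>" by (metis empty_iff lessThan_iff not_le)
    then show ?thesis using True stage_zero[of \<alpha> T] by (simp add: stage_verts_def)
  next
    case False
    define m where "m = Max {..<\<alpha>}"
    have m: "m < \<alpha>" and max: "\<And>\<beta>. \<beta> < \<alpha> \<Longrightarrow> \<beta> \<le> m"
      using Max_in[OF less.prems False] Max_ge[OF less.prems] by (auto simp: m_def)
    then have s: "is_succ m \<alpha>" unfolding is_succ_def by (meson leD not_le)
    have split: "{..<\<alpha>} = insert m {..<m}" using m max by (auto simp: order_le_less)
    then have fin: "finite {..<m}" using less.prems by simp
    have sm: "stage T m = ind (stage_verts m)" "stage_verts m \<subseteq> V" using stage_ind[of m] by blast+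
    have "stage T \<alpha> = ind (pruned (stage_verts m))"
      unfolding stage_succ[OF s, of T] by (subst sm(1)) (rule prune_ind[OF sm(2)])
    then have "stage_verts \<alpha> = pruned (stage_verts m)" unfolding stage_verts_def[of \<alpha>] by simp
    then show ?thesis using less.IH[OF m fin] split fin by simp
  qed
qed

lemma finite_rank_core: "finite_rank T \<Longrightarrow> \<exists>n. core_verts = (pruned ^^ n) V"
  using stage_verts_finite[of "rank T"]
  by (auto simp: finite_rank_def core_verts_def core_def stage_verts_def)

text \<open>
  The values \<open>\<rho> (G k)\<close> are finite but unbounded, so that infinitely many of the \<open>G k\<close> are
  non-isomorphic.
\<close>

lemma Sib_infinite_by_invariant:
  fixes G :: "nat \<Rightarrow> 'a set" and \<rho> :: "'a set \<Rightarrow> nat"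
  assumes G: "\<And>k. conn (G k)" "\<And>k. \<exists>f. emb f V (G k)"
    and unbounded: "\<And>k. k < \<rho> (G k)"
    and inv: "\<And>k l g. emb g (G k) (G l) \<Longrightarrow> g ` G k = G l \<Longrightarrow> \<rho> (G k) = \<rho> (G l)"
  shows "Sib T = \<infinity>"
proof -
  let ?R = "range (\<lambda>k. \<rho> (G k))"
  have "infinite ?R"
    unfolding infinite_nat_iff_unbounded using unbounded by blast
  then obtain h :: "nat \<Rightarrow> nat" where h: "inj h" "range h \<subseteq> ?R"
    using infinite_countable_subset by blast
  have "\<exists>k. \<rho> (G k) = h n" for n
  proof -
    have "h n \<in> ?R" using h(2) by blast
    then show ?thesis by (auto simp: image_iff)
  qed
  then obtain s where s: "\<And>n. \<rho> (G (s n)) = h n" by metis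
  show ?thesis
  proof (rule Sib_infinite[of "\<lambda>n. G (s n)"])
    show "conn (G (s n))" "\<exists>f. emb f V (G (s n))" for n by (rule G)+
    fix n m g assume "emb g (G (s n)) (G (s m))" "g ` G (s n) = G (s m)"
    then have "\<rho> (G (s n)) = \<rho> (G (s m))" by (rule inv)
    then show "n = m" using s h(1) by (simp add: inj_eq)
  qed
qed

text \<open>
  For sets whose deletion process stops after finitely many steps this is the rank; it serves as the
  isomorphism invariant below.
\<close>

definition pruned_rank :: "'a set \<Rightarrow> nat" where
  "pruned_rank X = (LEAST i. (pruned ^^ Suc i) X = (pruned ^^ i) X)"

lemma pruned_rank_image:
  assumes "conn X" "emb g X Y" "g ` X = Y" shows "pruned_rank X = pruned_rank Y"
proof -
  have inj: "inj_on g X" using assms by (simp add: emb_def)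
  have "(pruned ^^ Suc i) X = (pruned ^^ i) X \<longleftrightarrow> (pruned ^^ Suc i) Y = (pruned ^^ i) Y" for i
    using pruned_iter_emb_eq[OF assms(1,2), of "Suc i"] pruned_iter_emb_eq[OF assms(1,2), of i] assms(3)
      inj_on_image_eq_iff[OF inj pruned_iter_subset[of "Suc i"] pruned_iter_subset[of i]] by simp
  then show ?thesis by (simp add: pruned_rank_def)
qed

lemma conn_insert:
  assumes X: "conn X" and x: "x \<in> X" "adj T x y"
  shows "conn (insert y X)"
proof (rule connI[of _ x])
  show "insert y X \<subseteq> V" using X adj_verts[OF x(2)] by (auto simp: conn_def)
  fix v assume v: "v \<in> insert y X"
  show "(step (insert y X))\<^sup>*\<^sup>* v x"
  proof (cases "v \<in> X")
    case True
    then have "(step X)\<^sup>*\<^sup>* v x" using X x by (auto simp: conn_def)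
    then show ?thesis by (rule step_mono[rotated]) auto
  next
    case False
    then have "step (insert y X) v x" using v x adj_sym by (auto simp: step_def)
    then show ?thesis by blast
  qed
qed (use x in auto)

lemma pruned_insert_leaf:
  assumes A: "conn A" and y: "y \<notin> A" shows "pruned (insert y A) \<subseteq> A"
proof
  fix v assume v: "v \<in> pruned (insert y A)"
  show "v \<in> A"
  proof (rule ccontr)
    assume "v \<notin> A"
    then have "v = y" using v by (auto simp: pruned_def)
    then obtain a b where ab: "a \<noteq> b" "adj T y a" "adj T y b" "a \<in> insert y A" "b \<in> insert y A"
      using v unfolding pruned_def by blast
    then have A': "a \<in> A" "b \<in> A" using adj_irrefl by auto
    have "off A a y" "off A y b" using ab y adj_sym by (auto simp: off_def)
    then have "(off A)\<^sup>*\<^sup>* a b" by (rule rtranclp.rtrancl_into_rtrancl[OF r_into_rtranclp[of "off A"]])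
    then show False using off_separates[OF A A'] ab(1) by simp
  qed
qed

text \<open>
  Since the core is connected, an edge leads from the image of the core to the rest of the core, and
  can be continued to a ray \<open>y\<close> in the core.  It leaves the image of \<open>T\<close>: otherwise its
  preimage would be a ray starting in the core, hence lie in the core, whereas \<open>y 1\<close> is not in
  the image of the core.  In the sibling that consists of the image of \<open>T\<close> and an initial segment of
  \<open>y\<close>, the segment is attached like a long leafy path and is deleted one vertex at a time.
\<close>

theorem Sib_infinite_if_core_shrinks:
  assumes rank: "core_verts = (pruned ^^ n) V" and f: "emb f V V" and shrink: "f ` core_verts \<noteq> core_verts"
  shows "Sib T = \<infinity>"
proof -
  let ?C = core_verts
  have sub: "f ` ?C \<subseteq> ?C" by (rule emb_core[OF f core_verts_subset])
  then obtain w where w: "w \<in> ?C" "w \<notin> f ` ?C" using shrink by blast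
  then have C: "conn ?C" using conn_core by blast
  have inj: "inj_on f V" using f by (simp add: emb_def)
  have cn: "conn (f ` V)" by (rule conn_image[OF conn_V f order_refl])
  have "(step ?C)\<^sup>*\<^sup>* (f w) w" using C w sub by (auto simp: conn_def)
  from exists_crossing_step[OF this, of "\<lambda>v. v \<in> f ` ?C"]
  obtain a b where ab: "step ?C a b" "a \<in> f ` ?C" "b \<notin> f ` ?C" using w by blast
  then obtain y where y: "nonbacktracking y" "y 0 = a" "y 1 = b" "\<And>n. y n \<in> ?C"
    using nonbacktracking_exists[OF eq_refl[OF pruned_core[symmetric]], of a b] by (auto simp: step_def)
  have "\<exists>p. y p \<notin> f ` V"
  proof (rule ccontr)
    assume "\<not> ?thesis"
    then have "\<forall>m. \<exists>v\<in>V. y m = f v" by blast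
    then obtain x where x: "\<And>m. x m \<in> V" "\<And>m. y m = f (x m)" by metis
    have "adj T (x m) (x (Suc m))" for m
      using emb_reflects_adj[OF conn_V f x(1) x(1)] y(1) x(2) by (simp add: nonbacktracking_def)
    moreover have "x (Suc (Suc m)) \<noteq> x m" for m using y(1) x(2) by (metis nonbacktracking_def)
    ultimately have "nonbacktracking x" by (simp add: nonbacktracking_def)
    moreover have "x 0 \<in> ?C"
    proof -
      obtain c where "c \<in> ?C" "f (x 0) = f c" using ab(2) y(2) x(2) by (metis imageE)
      then show ?thesis using inj x(1) core_verts_subset by (metis inj_onD subsetD)
    qed
    ultimately have "x 1 \<in> ?C" by (rule nonbacktracking_in_core)
    then show False using ab(3) y(3) x(2) by auto
  qed
  then obtain p where p: "y p \<notin> f ` V" ..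
  define A where "A m = f ` V \<union> y ` {..m}" for m
  have y0: "y 0 \<in> f ` V" using ab(2) y(2) core_verts_subset by blast
  have A0: "A 0 = f ` V" using y0 by (auto simp: A_def)
  have AS: "A (Suc m) = insert (y (Suc m)) (A m)" for m by (auto simp: A_def atMost_Suc)
  have cA: "conn (A m)" for m
  proof (induction m)
    case 0 then show ?case using cn A0 by simp
  next
    case (Suc m)
    have "y m \<in> A m" by (simp add: A_def)
    then show ?case unfolding AS using Suc y(1) by (intro conn_insert) (auto simp: nonbacktracking_def)
  qed
  have AV: "A m \<subseteq> V" for m using cA by (simp add: conn_def)
  \<comment> \<open>each new vertex of the segment is a leaf, so it costs one more deletion\<close>
  have upper: "(pruned ^^ (n + m)) (A m) \<subseteq> f ` ?C" for m
  proof (induction m)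
    case 0 then show ?case using pruned_iter_emb_eq[OF conn_V f, of n] rank A0 by simp
  next
    case (Suc m)
    show ?case
    proof (cases "y (Suc m) \<in> A m")
      case True
      then have "A (Suc m) = A m" using AS by auto
      then show ?thesis using Suc pruned_subset by fastforce
    next
      case False
      have "pruned (A (Suc m)) \<subseteq> A m" unfolding AS by (rule pruned_insert_leaf[OF cA False])
      then have "(pruned ^^ (n + m)) (pruned (A (Suc m))) \<subseteq> (pruned ^^ (n + m)) (A m)" by (rule pruned_iter_mono)
      then show ?thesis using Suc by (simp add: funpow_swap1)
    qed
  qed
  have lower: "f ` ?C \<subseteq> (pruned ^^ i) (A m)" for i m
  proof (rule thick_pruned_iter)
    show "f ` ?C \<subseteq> pruned (f ` ?C)" using pruned_emb[OF f core_verts_subset] pruned_core by simp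
    show "f ` ?C \<subseteq> A m" using core_verts_subset by (auto simp: A_def)
  qed
  \<comment> \<open>conversely, every deletion shortens the segment by at most one vertex\<close>
  have path: "j \<le> m \<Longrightarrow> y j \<in> (pruned ^^ i) (A (i + m))" for i j m
  proof (induction i arbitrary: j m)
    case 0 then show ?case by (simp add: A_def)
  next
    case (Suc i)
    have IH: "y l \<in> (pruned ^^ i) (A (Suc i + m))" if "l \<le> Suc m" for l
      using Suc.IH[of l "Suc m"] that by simp
    show ?case
    proof (cases j)
      case 0
      then show ?thesis using lower[of "Suc i" "Suc i + m"] ab(2) y(2) by auto
    next
      case (Suc l)
      then show ?thesis using nonbacktracking_pruned[OF y(1), of l] IH \<open>j \<le> m\<close> by simp
    qed
  qed
  define G where "G k = A (k + p)" for k
  show ?thesis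
  proof (rule Sib_infinite_by_invariant[of G pruned_rank])
    show cG: "conn (G k)" for k using cA by (simp add: G_def)
    show "\<exists>f. emb f V (G k)" for k
      using f by (intro exI[of _ f]) (auto simp: emb_def G_def A_def)
    show "pruned_rank (G k) = pruned_rank (G l)" if "emb g (G k) (G l)" "g ` G k = G l" for k l g
      using pruned_rank_image[OF cG that] .
    show "k < pruned_rank (G k)" for k
    proof (rule ccontr)
      let ?i = "pruned_rank (G k)" and ?m = "k + p"
      assume "\<not> ?thesis"
      then have ik: "?i \<le> k" by simp
      have eq: "(pruned ^^ (n + ?m)) (G k) = f ` ?C"
        using upper[of ?m] lower[of "n + ?m" ?m] unfolding G_def by (rule subset_antisym)
      have "(pruned ^^ Suc (n + ?m)) (G k) = (pruned ^^ (n + ?m)) (G k)"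
        using lower[of "Suc (n + ?m)" ?m] pruned_subset[of "(pruned ^^ (n + ?m)) (G k)"] eq
        by (simp add: G_def)
      then have "(pruned ^^ Suc ?i) (G k) = (pruned ^^ ?i) (G k)"
        unfolding pruned_rank_def by (rule LeastI)
      then have "(pruned ^^ (n + ?m)) (G k) = (pruned ^^ k) (G k)"
        using pruned_iter_fixed[of ?i "G k" k] pruned_iter_fixed[of ?i "G k" "n + ?m"] ik by simp
      moreover have "y p \<in> (pruned ^^ k) (G k)" using path[of p p k] by (simp add: G_def)
      ultimately show False using eq p core_verts_subset by auto
    qed
  qed
qed

text \<open>
  The \<open>n\<close>-th vertex of any ray survives \<open>n\<close> deletions.  At finite rank, a missed ray thus
  contains a vertex of the core, which is then not in the image of the core.
\<close>

theorem Sib_infinite_if_ray_missed: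
  assumes rank: "core_verts = (pruned ^^ n) V" and f: "embedding f T T"
    and ray: "contains_ray (delete_verts T (f ` V))"
  shows "Sib T = \<infinity>"
proof (rule Sib_infinite_if_core_shrinks[OF rank])
  show fe: "emb f V V" using f embedding_ind[of f V V] by (simp add: ind_V)
  obtain x :: "nat \<Rightarrow> 'a" where x: "inj x" "range x \<subseteq> V - f ` V"
    "\<And>n. adj (delete_verts T (f ` V)) (x n) (x (Suc n))"
    using ray by (auto simp: contains_ray_def delete_verts_def)
  have "nonbacktracking x" using x(1,3) by (auto simp: nonbacktracking_def delete_verts_def adj_def inj_eq)
  then have "x n \<in> core_verts" using nonbacktracking_pruned_iter[of x n n] rank by simp
  moreover have "x n \<notin> f ` core_verts" using x(2) core_verts_subset by blast
  ultimately show "f ` core_verts \<noteq> core_verts" by blast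
qed

text \<open>
  If no vertex has two neighbours, a connected set is a single vertex or the two ends of an edge.
\<close>

lemma finite_if_pruned_empty:
  assumes D: "conn D" and e: "pruned D = {}" shows "finite D"
proof -
  have uniq: "a = b" if "v \<in> D" "a \<in> D" "b \<in> D" "adj T v a" "adj T v b" for v a b
    using that e by (auto simp: pruned_def)
  obtain a where a: "a \<in> D" using D by (auto simp: conn_def)
  have fin: "finite (kids D v)" if "v \<in> D" for v
  proof (cases "kids D v = {}")
    case False
    then obtain b where "b \<in> kids D v" by blast
    then have "kids D v \<subseteq> {b}" using uniq[OF that] by (auto simp: kids_def)
    then show ?thesis by (rule finite_subset) simp
  qed simp
  have "v \<in> insert a (kids D a)" if "(step D)\<^sup>*\<^sup>* a v" for v
    using that
  proof (induction rule: rtranclp_induct)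
    case (step v w)
    then have vw: "v \<in> D" "w \<in> D" "adj T v w" by (auto simp: step_def)
    show ?case
    proof (cases "v = a")
      case True then show ?thesis using vw by (simp add: kids_def)
    next
      case False
      then have "adj T v a" using step.IH adj_sym by (auto simp: kids_def)
      then have "w = a" using uniq[OF vw(1,2) a vw(3)] by simp
      then show ?thesis by simp
    qed
  qed simp
  then have "D \<subseteq> insert a (kids D a)" using D a by (auto simp: conn_def)
  then show ?thesis using fin[OF a] finite_subset by blast
qed

text \<open>
  The last non-empty set \<open>D\<close> in the sequence of deletions is finite, and embeddings of \<open>T\<close> map it into
  itself, hence onto itself.
\<close>

theorem Sib_alternative_if_core_empty:
  assumes empty: "(pruned ^^ n) V = {}"
  shows "Sib T = 1 \<or> Sib T = \<infinity>"
proof -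
  have "V \<noteq> {}" using conn_V by (auto simp: conn_def)
  define m where "m = (LEAST i. (pruned ^^ i) V = {})"
  have m: "(pruned ^^ m) V = {}" unfolding m_def using empty by (rule LeastI)
  obtain k where k: "m = Suc k" using m \<open>V \<noteq> {}\<close> by (cases m) auto
  let ?D = "(pruned ^^ k) V"
  have "?D \<noteq> {}" using not_less_Least[of k "\<lambda>i. (pruned ^^ i) V = {}"] k unfolding m_def by simp
  then have D: "conn ?D" using conn_pruned_iter[OF conn_V] by blast
  have fin: "finite ?D" using finite_if_pruned_empty[OF D] m k by simp
  show ?thesis
  proof (rule one_or_infinite_if_invariant_centre[OF D])
    show "f ` ?D = ?D" if f: "emb f V V" for f
    proof (rule card_subset_eq[OF fin])
      have fV: "f ` V \<subseteq> V" using f by (simp add: emb_def)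
      show "f ` ?D \<subseteq> ?D" using pruned_iter_mono[OF fV, of k] pruned_iter_emb_eq[OF conn_V f, of k] by simp
      have "inj_on f V" using f by (simp add: emb_def)
      then have "inj_on f ?D" by (rule inj_on_subset) (rule pruned_iter_subset)
      then show "card (f ` ?D) = card ?D" by (rule card_image)
    qed
    show "finite {r \<in> ?D. block V (proj ?D) r \<noteq> {r}}" using fin by simp
    show "rayless (block V (proj ?D) r) r" if "r \<in> ?D" for r
    proof (rule rayless_block_if_no_walk[OF D that])
      fix x assume "nonbacktracking x"
      then show False using nonbacktracking_pruned_iter[of x m m] m by simp
    qed
  qed
qed

theorem Sib_alternative_if_finitely_many_leafy_branches:
  assumes rank: "core_verts = (pruned ^^ n) V" and fin: "finite {H. leafy_branch T H}"
  shows "Sib T = 1 \<or> Sib T = \<infinity>"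
proof (cases "core_verts = {}")
  case True
  then show ?thesis using Sib_alternative_if_core_empty rank by simp
next
  case False
  show ?thesis
  proof (cases "\<forall>f. emb f V V \<longrightarrow> f ` core_verts = core_verts")
    case True
    then show ?thesis
      using finite_nontrivial_blocks[OF False fin] rayless_core_block
      by (intro one_or_infinite_if_invariant_centre[OF conn_core[OF False]]) auto
  next
    case False
    then obtain f where "emb f V V" "f ` core_verts \<noteq> core_verts" by auto
    then have "Sib T = \<infinity>" by (rule Sib_infinite_if_core_shrinks[OF rank])
    then show ?thesis ..
  qed
qed

end

section \<open>The tree alternative\<close>

theorem theorem3p7:
  fixes T :: "'a graph"
  assumes "tree T"
    and "(\<exists>H r. rooted_leafy_branch T (H, r) \<and> rooted_Sib (H, r) = \<infinity>)
       \<or> (finite_rank T \<and> (\<exists>f. embedding f T T \<and> contains_ray (delete_verts T (f ` verts T))))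
       \<or> (finite_rank T \<and> finite {H. leafy_branch T H})"
  shows "Sib T = 1 \<or> Sib T = \<infinity>"
proof -
  interpret tree_graph T using assms(1) by unfold_locales
  from assms(2) show ?thesis
  proof (elim disjE exE conjE)
    fix H r assume "rooted_leafy_branch T (H, r)" "rooted_Sib (H, r) = \<infinity>"
    then have "Sib T = \<infinity>" by (rule Sib_infinite_if_leafy_branch_infinite)
    then show ?thesis ..
  next
    fix f assume fin: "finite_rank T"
      and f: "embedding f T T" "contains_ray (delete_verts T (f ` verts T))"
    obtain n where "core_verts = (pruned ^^ n) V" using finite_rank_core[OF fin] ..
    then have "Sib T = \<infinity>" using f by (rule Sib_infinite_if_ray_missed)
    then show ?thesis ..
  next
    assume fin: "finite_rank T" and lb: "finite {H. leafy_branch T H}"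
    obtain n where "core_verts = (pruned ^^ n) V" using finite_rank_core[OF fin] ..
    then show ?thesis using lb by (rule Sib_alternative_if_finitely_many_leafy_branches)
  qed
qed

end
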